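(* In the setting and with the truncated Euler–Maruyama scheme described in the context, assume (A1) and (A2). Then there is a constant $L>0$ such that $$\sup_{\Delta\in(0,1]}\ \sup_{k\ge-N}\ \mathbb E|Y^\Delta(t_k)|^p\le L,$$ where the supremum over $\Delta$ is over all admissible step sizes $\Delta=\tau/N$, $N\ge\tau$ an integer, and $p$ is the exponent in (A2).
   Context: Setting: $\tau>0$; $\mathcal C=C([-\tau,0];\mathbb R^n)$ with sup norm $\|\cdot\|$; $|\cdot|$ is the Euclidean norm on vectors and the trace norm on matrices; $B$ is a $d$-dimensional Brownian motion on a filtered probability space with the usual conditions; $f:\mathcal C\to\mathbb R^n$, $g:\mathcal C\to\mathbb R^{n\times d}$; $\xi\in\mathcal C$ is the initial datum of the SFDE $\mathrm dx(t)=f(x_t)\mathrm dt+g(x_t)\mathrm dB(t)$, $x(t)=\xi(t)$ on $[-\tau,0]$. $\mathcal W$: bounded Borel $\rho:[-\tau,0]\to[0,\infty)$ with $\int_{-\tau}^0\rho=1$. (A1): for each $\ell>0$ there is $R_\ell>0$ with $|f(\phi)-f(\bar\phi)|\vee|g(\phi)-g(\bar\phi)|\le R_\ell(|\phi(0)-\bar\phi(0)|+\frac1\tau\int_{-\tau}^0|\phi-\bar\phi|\mathrm d\theta)$ whenever $\|\phi\|\vee\|\bar\phi\|\le\ell$. (A2): there are $p\ge2$, $\varrho>0$, $a_1,a_2,a_3>0$ with $a_2>a_3$ and $\rho_1\in\mathcal W$ with $2\phi(0)^Tf(\phi)+(p-1)|g(\phi)|^2\le a_1(1+|\phi(0)|^2+\frac1\tau\int_{-\tau}^0|\phi|^2\mathrm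 d\theta)-a_2|\phi(0)|^{2+\varrho}+a_3\int_{-\tau}^0|\phi(\theta)|^{2+\varrho}\rho_1(\theta)\mathrm d\theta$ for all $\phi\in\mathcal C$. Scheme: let $\Psi(\phi,\bar\phi)=|\phi(0)-\bar\phi(0)|^2+\frac1\tau\int_{-\tau}^0|\phi-\bar\phi|^2\mathrm d\theta$. Fix a strictly increasing continuous $\Gamma:[1,\infty)\to[0,\infty)$ with $\Gamma(l)\to\infty$ and $\sup\{\frac{|f(\phi)-f(\bar\phi)|}{\Psi(\phi,\bar\phi)^{1/2}}\vee\frac{|g(\phi)-g(\bar\phi)|^2}{\Psi(\phi,\bar\phi)}:\|\phi\|\vee\|\bar\phi\|\le l,\phi\ne\bar\phi\}\le\Gamma(l)$ for $l\ge1$; $\Gamma^{-1}$ its inverse on $[\Gamma(1),\infty)$. $K=\Gamma(1)\vee|f(\mathbf 0)|\vee|g(\mathbf 0)|^2$, and $\lambda\in(0,1/2)$ is fixed. Step size $\Delta=\tau/N$ with integer $N\ge\tau$, $t_k=k\Delta$; $\Lambda(x)=(|x|\wedge\Gamma^{-1}(K\Delta^{-\lambda}))x/|x|$ ($x/|x|:=0$ if $x=0$). $\breve Y^\Delta(t_k)=\xi(t_k)$, $k=-N,\dots,0$; $Y^\Delta(t_k)=\Lambda(\breve Y^\Delta(t_k))$, $k\ge-N$; $\breve Y^\Delta(t_{k+1})=Y^\Delta(t_k)+f(\bar Y^\Delta_{t_k})\Delta+g(\bar Y^\Delta_{t_k})(B(t_{k+1})-B(t_k))$, $k\ge0$, where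 $\bar Y^\Delta_{t_k}(\theta)=\frac{(j+1)\Delta-\theta}{\Delta}Y^\Delta(t_{k+j})+\frac{\theta-j\Delta}{\Delta}Y^\Delta(t_{k+j+1})$ for $\theta\in[j\Delta,(j+1)\Delta]$, $j=-N,\dots,-1$. *)

theory Defs
  imports "HOL-Analysis.Analysis" "HOL-Probability.Probability"
begin

text \<open>The space C([-tau,0];R^n) is represented by functions real => real^n that are
continuous on [-tau,0] and vanish outside [-tau,0] (a canonical representative).\<close>

definition Cset :: "real \<Rightarrow> (real \<Rightarrow> real^'n) set" where
  "Cset \<tau> = {\<phi>. continuous_on {-\<tau>..0} \<phi> \<and> (\<forall>\<theta>. \<theta> \<notin> {-\<tau>..0} \<longrightarrow> \<phi> \<theta> = 0)}"

definition supnorm :: "real \<Rightarrow> (real \<Rightarrow> real^'n) \<Rightarrow> real" where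
  "supnorm \<tau> \<phi> = Sup ((\<lambda>\<theta>. norm (\<phi> \<theta>)) ` {-\<tau>..0})"

definition Wset :: "real \<Rightarrow> (real \<Rightarrow> real) set" where
  "Wset \<tau> = {\<rho>. \<rho> \<in> borel_measurable (restrict_space borel {-\<tau>..0})
      \<and> bounded (\<rho> ` {-\<tau>..0}) \<and> (\<forall>\<theta>\<in>{-\<tau>..0}. 0 \<le> \<rho> \<theta>)
      \<and> (\<rho> has_integral 1) {-\<tau>..0}}"

definition Psi :: "real \<Rightarrow> (real \<Rightarrow> real^'n) \<Rightarrow> (real \<Rightarrow> real^'n) \<Rightarrow> real" where
  "Psi \<tau> \<phi> \<phi>' = (norm (\<phi> 0 - \<phi>' 0))\<^sup>2 + (1/\<tau>) * integral {-\<tau>..0} (\<lambda>\<theta>. (norm (\<phi> \<theta> - \<phi>' \<theta>))\<^sup>2)"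

definition brownian_motion :: "'a measure \<Rightarrow> (real \<Rightarrow> 'a \<Rightarrow> real^'d) \<Rightarrow> bool" where
  "brownian_motion M B \<longleftrightarrow> prob_space M
     \<and> (\<forall>t. B t \<in> borel_measurable M)
     \<and> (\<forall>\<omega>\<in>space M. B 0 \<omega> = 0)
     \<and> (\<forall>\<omega>\<in>space M. continuous_on {0..} (\<lambda>t. B t \<omega>))
     \<and> (\<forall>s t. 0 \<le> s \<and> s < t \<longrightarrow>
          distr M borel (\<lambda>\<omega>. B t \<omega> - B s \<omega>)
            = density lborel (\<lambda>x. ennreal (\<Prod>i\<in>UNIV. normal_density 0 (sqrt (t - s)) (x $ i))))
     \<and> (\<forall>ts::real list. sorted ts \<and> distinct ts \<and> (\<forall>t\<in>set ts. 0 \<le> t) \<longrightarrow>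
          prob_space.indep_vars M (\<lambda>_. borel)
            (\<lambda>i \<omega>. B (ts ! Suc i) \<omega> - B (ts ! i) \<omega>) {..<length ts - 1})"

definition Gamma_inv :: "(real \<Rightarrow> real) \<Rightarrow> real \<Rightarrow> real" where
  "Gamma_inv \<Gamma> y = (THE l. 1 \<le> l \<and> \<Gamma> l = y)"

definition trunc :: "real \<Rightarrow> real^'n \<Rightarrow> real^'n" where
  "trunc h x = min (norm x) h *\<^sub>R sgn x"

definition interp :: "real \<Rightarrow> nat \<Rightarrow> (int \<Rightarrow> real^'n) \<Rightarrow> int \<Rightarrow> real \<Rightarrow> real^'n" where
  "interp \<Delta> N Y k \<theta> =
     (if - (real N * \<Delta>) \<le> \<theta> \<and> \<theta> \<le> 0 then
        (let j = min (-1) \<lfloor>\<theta> / \<Delta>\<rfloor> in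
          (((real_of_int j + 1) * \<Delta> - \<theta>) / \<Delta>) *\<^sub>R Y (k + j)
          + ((\<theta> - real_of_int j * \<Delta>) / \<Delta>) *\<^sub>R Y (k + j + 1))
      else 0)"

text \<open>breve_seq ... k gives the values breve Y(t_j) for all j <= k (other entries junk).\<close>
primrec breve_seq ::
  "((real \<Rightarrow> real^'n) \<Rightarrow> real^'n) \<Rightarrow> ((real \<Rightarrow> real^'n) \<Rightarrow> real^'d^'n) \<Rightarrow>
   (real \<Rightarrow> 'a \<Rightarrow> real^'d) \<Rightarrow> (real \<Rightarrow> real^'n) \<Rightarrow> real \<Rightarrow> nat \<Rightarrow> real \<Rightarrow> 'a \<Rightarrow>
   nat \<Rightarrow> int \<Rightarrow> real^'n" where
  "breve_seq f g B \<xi> \<Delta> N h \<omega> 0 = (\<lambda>j. \<xi> (real_of_int j * \<Delta>))"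
| "breve_seq f g B \<xi> \<Delta> N h \<omega> (Suc k) =
     (let Yb = breve_seq f g B \<xi> \<Delta> N h \<omega> k;
          Y = (\<lambda>j. trunc h (Yb j));
          \<phi> = interp \<Delta> N Y (int k)
      in Yb(int k + 1 := Y (int k) + \<Delta> *\<^sub>R f \<phi>
                          + g \<phi> *v (B (real (Suc k) * \<Delta>) \<omega> - B (real k * \<Delta>) \<omega>)))"

definition TEM_Y ::
  "((real \<Rightarrow> real^'n) \<Rightarrow> real^'n) \<Rightarrow> ((real \<Rightarrow> real^'n) \<Rightarrow> real^'d^'n) \<Rightarrow>
   (real \<Rightarrow> 'a \<Rightarrow> real^'d) \<Rightarrow> (real \<Rightarrow> real^'n) \<Rightarrow> real \<Rightarrow> (real \<Rightarrow> real) \<Rightarrow> real \<Rightarrow>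
   nat \<Rightarrow> int \<Rightarrow> 'a \<Rightarrow> real^'n" where
  "TEM_Y f g B \<xi> \<tau> \<Gamma> lam N k \<omega> =
     (let \<Delta> = \<tau> / real N;
          K = max (\<Gamma> 1) (max (norm (f (\<lambda>_. 0))) ((norm (g (\<lambda>_. 0)))\<^sup>2));
          h = Gamma_inv \<Gamma> (K * \<Delta> powr (-lam))
      in trunc h (breve_seq f g B \<xi> \<Delta> N h \<omega> (nat k) k))"

end

theory Submission
  imports Defs
begin

text \<open>With \<open>q = p / 2\<close> and \<open>z = 1 + \<bar>Y\<bar>\<^sup>2\<close>, one step of the scheme is averaged over \<open>y\<close> and \<open>- y\<close>, which kills the odd
  powers of the Gaussian increment in the expansion of \<open>z powr q\<close>. What remains is the drift that the dissipativity
  condition controls, up to errors that are \<open>\<Delta>\<close> times terms of lower order than the dissipation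
  \<open>- a2 \<bar>Y\<bar> powr (p + \<rho>)\<close>; this uses \<open>\<lambda> < 1/2\<close>. Since \<open>a2 > a3\<close>, taking expectations gives for small \<open>\<Delta>\<close> a linear
  recursion with delay whose solutions are bounded uniformly in time. For the other, finitely many, step sizes
  the truncation itself bounds the scheme.\<close>

section \<open>Symmetrised expansion of powers\<close>

text \<open>The obstacle is that the coefficients see the whole delay window. They are bounded
  through a quantity \<open>P\<close> comparable to 1 plus the squares over that window, and
  \<open>P\<close> may exceed the present \<open>z\<close> by any factor, so an increment need not
  be small relative to \<open>z\<close> however small \<Delta> is. Taylor expansion is therefore
  paired with a crude power bound for large relative increments. The truncation radius h satisfies
  \<open>\<Gamma> h = K * \<Delta> powr (-lam)\<close>, so the relative size \<theta> of a step is
  of order \<open>\<Delta> powr (1 - lam) * P / z\<close>; its square carries a factor at most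
  \<Delta> because 2 (1 - lam) >= 1. For 1 < q < 2 the crude bound offers only the power q of
  \<theta>, whose factor can exceed \<Delta>. There the dissipativity condition is read backwards,
  as an upper bound on |g|^2 in which \<open>\<Delta> powr (-lam)\<close> multiplies only sqrt z
  sqrt P. The threshold for \<Delta> depends on the constants of the problem but not on h, and
  truncation never lengthens a vector, so nothing is lost in passing from the untruncated to the
  truncated value.\<close>

lemma powr_taylor4:
  fixes q :: real
  obtains C where "C \<ge> 0" "\<And>v. \<bar>v\<bar> \<le> 1/2 \<Longrightarrow>
    (1 + v) powr q \<le> 1 + q * v + q * (q - 1) / 2 * v\<^sup>2 + q * (q - 1) * (q - 2) / 6 * v ^ 3 + C * v ^ 4"
proof -
  \<comment> \<open>\<open>diff m\<close> is the m-th derivative of \<open>(1 + v) powr q\<close>.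
    In \<open>C\<close> the factor \<open>2 powr \<bar>q - 4\<bar>\<close> dominates
    \<open>(1 + t) powr (q - 4)\<close> for t between -1/2 and 1/2, whatever the sign of q -
    4.\<close>
  define diff where "diff m v = (\<Prod>i<m. q - real i) * (1 + v) powr (q - real m)" for m and v :: real
  define C where "C = \<bar>\<Prod>i<4. q - real i\<bar> / 24 * 2 powr \<bar>q - 4\<bar>"
  have deriv: "DERIV (diff m) t :> diff (Suc m) t" if "\<bar>t\<bar> \<le> 1/2" for m t
    unfolding diff_def using that
    by (auto intro!: derivative_eq_intros simp: algebra_simps)
  have "(1 + v) powr q \<le> 1 + q * v + q * (q - 1) / 2 * v\<^sup>2 + q * (q - 1) * (q - 2) / 6 * v ^ 3 + C * v ^ 4"
    if v: "\<bar>v\<bar> \<le> 1/2" for v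
  proof -
    have "diff 0 = (\<lambda>v. (1 + v) powr q)" by (simp add: diff_def fun_eq_iff)
    moreover have "\<forall>m t. m < 4 \<and> \<bar>t\<bar> \<le> \<bar>v\<bar> \<longrightarrow> DERIV (diff m) t :> diff (Suc m) t"
      using deriv v by auto
    ultimately obtain t where t: "\<bar>t\<bar> \<le> \<bar>v\<bar>"
      and eq: "(1 + v) powr q = (\<Sum>m<4. diff m 0 / fact m * v ^ m) + diff 4 t / fact 4 * v ^ 4"
      using Maclaurin_bi_le by blast
    have "(1 + t) powr (q - 4) \<le> 2 powr \<bar>q - 4\<bar>"
    proof (cases "q \<ge> 4")
      case True
      then show ?thesis using t v by (auto intro!: powr_mono2)
    next
      case False
      have "(1 + t) powr (q - 4) \<le> (1/2) powr (q - 4)"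
        using False t v by (intro powr_mono2') auto
      also have "\<dots> = 2 powr \<bar>q - 4\<bar>" using False by (simp add: powr_divide powr_minus_divide[symmetric])
      finally show ?thesis .
    qed
    then have "diff 4 t / fact 4 \<le> C"
      using mult_mono[OF abs_ge_self[of "\<Prod>i<4. q - real i"], of "(1 + t) powr (q - 4)" "2 powr \<bar>q - 4\<bar>"]
      by (simp add: diff_def C_def fact_numeral)
    then have "diff 4 t / fact 4 * v ^ 4 \<le> C * v ^ 4"
      by (intro mult_right_mono) auto
    moreover have "(\<Sum>m<4. diff m 0 / fact m * v ^ m)
        = 1 + q * v + q * (q - 1) / 2 * v\<^sup>2 + q * (q - 1) * (q - 2) / 6 * v ^ 3"
      by (simp add: diff_def eval_nat_numeral)
    ultimately show ?thesis using eq by linarith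
  qed
  moreover have "C \<ge> 0" by (simp add: C_def)
  ultimately show ?thesis using that by blast
qed

text \<open>Applied with \<open>u0 = 2 (x \<bullet> e) / z\<close> and \<open>u1 = 2 (a \<bullet> e) / z\<close>. Both are odd in the increment \<open>e\<close>, but \<open>u1\<close> is as small
  as \<open>\<theta>\<close>, so only \<open>u0\<close> enters the quadratic term.\<close>

lemma symmetric_powr_expansion:
  fixes q :: real
  assumes q: "q \<ge> 1"
  obtains C where "C \<ge> 0" "q = 1 \<Longrightarrow> C = 0"
    "\<And>a u0 u1 \<theta>. \<bar>a\<bar> \<le> \<theta> \<Longrightarrow> \<bar>u1\<bar> \<le> \<theta> \<Longrightarrow> u0\<^sup>2 \<le> 4 * \<theta> \<Longrightarrow> \<bar>u0 * u1\<bar> \<le> 4 * \<theta>\<^sup>2 \<Longrightarrow>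
      0 \<le> 1 + a + (u0 + u1) \<Longrightarrow> 0 \<le> 1 + a - (u0 + u1) \<Longrightarrow>
      ((1 + a + (u0 + u1)) powr q + (1 + a - (u0 + u1)) powr q) / 2
        \<le> 1 + q * a + q * (q - 1) / 2 * u0\<^sup>2 + C * (if \<theta> \<le> 1/64 then \<theta>\<^sup>2 else \<theta> powr q)"
proof (cases "q = 1")
  case True
  \<comment> \<open>At q = 1 the average is exactly 1 + a. That C vanishes here is recorded in the
    statement because the later smallness factor \<open>\<Delta> powr ((q - 1) / 2)\<close>
    degenerates to 1 in this case.\<close>
  show ?thesis by (rule that[of 0]) (use True in \<open>auto simp: field_simps\<close>)
next
  case False
  with q have q: "q > 1" by simp
  obtain C4 where C4: "C4 \<ge> 0" and taylor: "\<And>v. \<bar>v\<bar> \<le> 1/2 \<Longrightarrow>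
    (1 + v) powr q \<le> 1 + q * v + q * (q - 1) / 2 * v\<^sup>2 + q * (q - 1) * (q - 2) / 6 * v ^ 3 + C4 * v ^ 4"
    using powr_taylor4[of q] by blast
  define c3 where "c3 = q * (q - 1) * (q - 2) / 6"
  \<comment> \<open>\<open>CA\<close> serves the Taylor regime, one summand each for the orders 2, 3
    and 4; \<open>CB\<close> serves large \<theta>, where both powers and the linear term are
    dominated by \<open>\<theta> powr q\<close>.\<close>
  define CA where "CA = q * (q - 1) / 2 * 10 + \<bar>c3\<bar> * 40 + C4 * 600"
  define CB where "CB = 100 powr q + q * 64 powr q"
  define C where "C = CA + CB"
  have CA: "CA \<ge> 0" using q C4 by (auto simp: CA_def)
  have CB: "CB \<ge> 0" using q by (auto simp: CB_def)
  show ?thesis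
  proof (rule that[of C])
    show "C \<ge> 0" using CA CB by (simp add: C_def)
    show "C = 0" if "q = 1" using that False by simp
    fix a u0 u1 \<theta> :: real
    assume a: "\<bar>a\<bar> \<le> \<theta>" and u1: "\<bar>u1\<bar> \<le> \<theta>" and u0: "u0\<^sup>2 \<le> 4 * \<theta>" and u01: "\<bar>u0 * u1\<bar> \<le> 4 * \<theta>\<^sup>2"
      and pos: "0 \<le> 1 + a + (u0 + u1)" "0 \<le> 1 + a - (u0 + u1)"
    define u where "u = u0 + u1"
    have \<theta>: "\<theta> \<ge> 0" using a by linarith
    have u0s: "\<bar>u0\<bar> \<le> 2 * sqrt \<theta>"
      using real_sqrt_le_mono[OF u0] by (simp add: real_sqrt_mult)
    show "((1 + a + (u0 + u1)) powr q + (1 + a - (u0 + u1)) powr q) / 2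
        \<le> 1 + q * a + q * (q - 1) / 2 * u0\<^sup>2 + C * (if \<theta> \<le> 1/64 then \<theta>\<^sup>2 else \<theta> powr q)"
    proof (cases "\<theta> \<le> 1/64")
      case True
      \<comment> \<open>The threshold 1/64 is chosen so that |u0| <= 2 sqrt \<theta> <= 1/4, which
        with |a|, |u1| <= 1/64 keeps both arguments of the Taylor bound within 1/2.\<close>
      have "sqrt \<theta> \<le> sqrt ((1/8)\<^sup>2)" using True by (intro real_sqrt_le_mono) (auto simp: power2_eq_square)
      then have u0b: "\<bar>u0\<bar> \<le> 1/4" using u0s by simp
      have b: "\<bar>a + u\<bar> \<le> 1/2" "\<bar>a - u\<bar> \<le> 1/2" using a u1 u0b True unfolding u_def by linarith+
      have \<theta>2: "\<theta>\<^sup>2 \<le> \<theta>" using True \<theta> by (simp add: power2_eq_square mult_left_le)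
      have a2: "a\<^sup>2 \<le> \<theta>\<^sup>2" using power_mono[OF a, of 2] by simp
      have u1sq: "u1\<^sup>2 \<le> \<theta>\<^sup>2" using power_mono[OF u1, of 2] by simp
      have ueq: "u\<^sup>2 = u0\<^sup>2 + 2 * (u0 * u1) + u1\<^sup>2" by (simp add: u_def power2_sum)
      have usq: "u\<^sup>2 \<le> u0\<^sup>2 + 9 * \<theta>\<^sup>2" using ueq u01 u1sq by linarith
      have usq': "u\<^sup>2 \<le> 13 * \<theta>" using usq u0 \<theta>2 by linarith
      have q2: "a\<^sup>2 + u\<^sup>2 \<le> u0\<^sup>2 + 10 * \<theta>\<^sup>2" using usq a2 by linarith
      have "\<bar>a\<bar> * (a\<^sup>2 + 3 * u\<^sup>2) \<le> \<theta> * (40 * \<theta>)"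
        using a a2 \<theta>2 usq' \<theta> by (intro mult_mono) auto
      moreover have "\<bar>a ^ 3 + 3 * a * u\<^sup>2\<bar> = \<bar>a\<bar> * (a\<^sup>2 + 3 * u\<^sup>2)"
      proof -
        have "a ^ 3 + 3 * a * u\<^sup>2 = a * (a\<^sup>2 + 3 * u\<^sup>2)"
          by (simp add: power2_eq_square power3_eq_cube distrib_left)
        then show ?thesis by (simp only: abs_mult) simp
      qed
      ultimately have cube: "\<bar>a ^ 3 + 3 * a * u\<^sup>2\<bar> \<le> 40 * \<theta>\<^sup>2"
        by (simp add: power2_eq_square)
      have "c3 * (a ^ 3 + 3 * a * u\<^sup>2) \<le> \<bar>c3 * (a ^ 3 + 3 * a * u\<^sup>2)\<bar>" by (rule abs_ge_self)
      also have "\<dots> = \<bar>c3\<bar> * \<bar>a ^ 3 + 3 * a * u\<^sup>2\<bar>" by (rule abs_mult)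
      also have "\<dots> \<le> \<bar>c3\<bar> * (40 * \<theta>\<^sup>2)" by (rule mult_left_mono[OF cube]) simp
      finally have q3: "c3 * (a ^ 3 + 3 * a * u\<^sup>2) \<le> \<bar>c3\<bar> * (40 * \<theta>\<^sup>2)" .
      have "(a\<^sup>2 + u\<^sup>2)\<^sup>2 \<le> (14 * \<theta>)\<^sup>2" using usq' a2 \<theta>2 by (intro power_mono) auto
      then have "((a + u) ^ 4 + (a - u) ^ 4) / 2 \<le> 600 * \<theta>\<^sup>2"
      proof -
        have "((a + u) ^ 4 + (a - u) ^ 4) / 2 = (a\<^sup>2 + u\<^sup>2)\<^sup>2 + 4 * (a\<^sup>2 * u\<^sup>2)"
          by (simp add: power2_eq_square power4_eq_xxxx field_simps)
        moreover have "4 * (a\<^sup>2 * u\<^sup>2) \<le> (a\<^sup>2 + u\<^sup>2)\<^sup>2 * 2"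
          using zero_le_power2[of "a\<^sup>2 - u\<^sup>2"] zero_le_power2[of "a\<^sup>2 + u\<^sup>2"]
          by (simp add: power2_sum power2_diff)
        moreover assume "(a\<^sup>2 + u\<^sup>2)\<^sup>2 \<le> (14 * \<theta>)\<^sup>2"
        moreover have "(14 * \<theta>)\<^sup>2 = 196 * \<theta>\<^sup>2" by (simp add: power_mult_distrib)
        ultimately show ?thesis using zero_le_power2[of \<theta>] by linarith
      qed
      then have q4: "C4 * (((a + u) ^ 4 + (a - u) ^ 4) / 2) \<le> C4 * (600 * \<theta>\<^sup>2)"
        using C4 by (intro mult_left_mono) auto
      have q2': "q * (q - 1) / 2 * (a\<^sup>2 + u\<^sup>2) \<le> q * (q - 1) / 2 * (u0\<^sup>2 + 10 * \<theta>\<^sup>2)"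
        using q2 q by (intro mult_left_mono) auto
      have "((1 + a + u) powr q + (1 + a - u) powr q) / 2 \<le>
          1 + q * a + q * (q - 1) / 2 * (a\<^sup>2 + u\<^sup>2) + c3 * (a ^ 3 + 3 * a * u\<^sup>2)
           + C4 * (((a + u) ^ 4 + (a - u) ^ 4) / 2)"
      proof -
        have e3: "c3 * (a + u) ^ 3 + c3 * (a - u) ^ 3 = 2 * (c3 * (a ^ 3 + 3 * a * u\<^sup>2))"
          by (simp add: power2_eq_square power3_eq_cube algebra_simps)
        have e2: "q * (q - 1) / 2 * (a + u)\<^sup>2 + q * (q - 1) / 2 * (a - u)\<^sup>2 = 2 * (q * (q - 1) / 2 * (a\<^sup>2 + u\<^sup>2))"
          by (simp add: power2_eq_square field_simps)
        have e1: "q * (a + u) + q * (a - u) = 2 * (q * a)" by (simp add: algebra_simps)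
        have "(1 + a + u) powr q \<le> 1 + q * (a + u) + q * (q - 1) / 2 * (a + u)\<^sup>2 + c3 * (a + u) ^ 3 + C4 * (a + u) ^ 4"
          using taylor[OF b(1)] unfolding c3_def by (simp only: add.assoc)
        moreover have "(1 + a - u) powr q \<le> 1 + q * (a - u) + q * (q - 1) / 2 * (a - u)\<^sup>2 + c3 * (a - u) ^ 3 + C4 * (a - u) ^ 4"
          using taylor[OF b(2)] unfolding c3_def by (simp only: add.assoc add_diff_eq)
        moreover have "C4 * (((a + u) ^ 4 + (a - u) ^ 4) / 2) = (C4 * (a + u) ^ 4 + C4 * (a - u) ^ 4) / 2"
          by (simp add: distrib_left)
        ultimately show ?thesis using e1 e2 e3 by argo
      qed
      also have "\<dots> \<le> 1 + q * a + q * (q - 1) / 2 * u0\<^sup>2 + CA * \<theta>\<^sup>2"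
      proof -
        have "CA * \<theta>\<^sup>2 = q * (q - 1) / 2 * (10 * \<theta>\<^sup>2) + \<bar>c3\<bar> * (40 * \<theta>\<^sup>2) + C4 * (600 * \<theta>\<^sup>2)"
          by (simp only: CA_def distrib_right mult.assoc)
        then show ?thesis using q2' q3 q4 unfolding distrib_left[of "q * (q - 1) / 2" "u0\<^sup>2"] by linarith
      qed
      also have "\<dots> \<le> 1 + q * a + q * (q - 1) / 2 * u0\<^sup>2 + C * \<theta>\<^sup>2"
        using CB by (simp add: C_def distrib_right)
      finally show ?thesis using True by (simp add: u_def)
    next
      case False
      have s: "sqrt \<theta> \<le> 8 * \<theta>"
      proof -
        have "sqrt \<theta> * 1 \<le> sqrt \<theta> * (8 * sqrt \<theta>)"
        proof (rule mult_left_mono)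
          have "sqrt ((1/8)\<^sup>2) \<le> sqrt \<theta>" using False by (intro real_sqrt_le_mono) (auto simp: power2_eq_square)
          then show "1 \<le> 8 * sqrt \<theta>" by simp
        qed (use \<theta> in auto)
        also have "sqrt \<theta> * (8 * sqrt \<theta>) = 8 * \<theta>" using \<theta> by (simp add: mult.left_commute[of "sqrt \<theta>"])
        finally show ?thesis by simp
      qed
      \<comment> \<open>Since \<theta> > 1/64, the summands 1, |a|, |u1| and |u0| are at most 64, 1,
        1 and 16 times \<theta>; the total 82 is rounded up to 100.\<close>
      have up: "(1 + a + s) powr q \<le> 100 powr q * \<theta> powr q" if "0 \<le> 1 + a + s" "\<bar>s\<bar> \<le> \<bar>u0\<bar> + \<bar>u1\<bar>" for s
      proof -
        have "(1 + a + s) powr q \<le> (100 * \<theta>) powr q"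
          using that a u1 u0s s False q by (intro powr_mono2) auto
        then show ?thesis using \<theta> by (simp add: powr_mult)
      qed
      have "((1 + a + u) powr q + (1 + a - u) powr q) / 2 \<le> 100 powr q * \<theta> powr q"
      proof -
        have "(1 + a + u) powr q \<le> 100 powr q * \<theta> powr q" using pos by (intro up) (auto simp: u_def)
        moreover have "(1 + a + - u) powr q \<le> 100 powr q * \<theta> powr q" using pos by (intro up) (auto simp: u_def)
        ultimately show ?thesis by simp
      qed
      moreover have "- (q * a) \<le> q * 64 powr q * \<theta> powr q"
      proof -
        have "(64 * \<theta>) powr 1 \<le> (64 * \<theta>) powr q" using False q by (intro powr_mono) auto
        then have "\<theta> \<le> 64 powr q * \<theta> powr q" using False by (simp add: powr_mult)
        then have "q * (-a) \<le> q * (64 powr q * \<theta> powr q)" using a q by (intro mult_left_mono) auto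
        then show ?thesis by simp
      qed
      moreover have "0 \<le> q * (q - 1) / 2 * u0\<^sup>2" using q by auto
      moreover have "0 \<le> CA * \<theta> powr q" using CA by auto
      moreover have "C * \<theta> powr q = CA * \<theta> powr q + 100 powr q * \<theta> powr q + q * 64 powr q * \<theta> powr q"
        by (simp add: C_def CB_def distrib_right)
      ultimately have "((1 + a + u) powr q + (1 + a - u) powr q) / 2
          \<le> 1 + q * a + q * (q - 1) / 2 * u0\<^sup>2 + C * \<theta> powr q" by linarith
      then show ?thesis using False by (simp add: u_def)
    qed
  qed
qed

text \<open>Quadratic near zero, which makes a step cost only O(\<Delta>), and of growth q far out,
  where no more than the size of the power itself is known.\<close>

definition remainder_fun :: "real \<Rightarrow> real \<Rightarrow> real" where
  "remainder_fun q \<theta> = (if \<theta> \<le> 1/64 then \<theta>\<^sup>2 else \<theta> powr q)"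

text \<open>Expanding the square and dividing by z = 1 + |x|^2 leaves 1 + \<eta>/z plus or minus (t0
  + t1)/z, to which the scalar expansion applies with \<theta> = \<Theta>/z. Here \<Theta> majorises
  \<eta> term by term by Cauchy-Schwarz, and it contains |e|^2, which controls t0^2 by 4 z
  \<Theta>.\<close>

lemma symmetric_norm_powr_expansion:
  fixes q :: real
  assumes q: "q \<ge> 1"
  obtains C where "C \<ge> 0" "q = 1 \<Longrightarrow> C = 0"
    "\<And>x a e :: 'v::real_inner.
      ((1 + (norm (x + a + e))\<^sup>2) powr q + (1 + (norm (x + a - e))\<^sup>2) powr q) / 2
      \<le> (1 + (norm x)\<^sup>2) powr q
         + q * (1 + (norm x)\<^sup>2) powr (q - 1) * (2 * (x \<bullet> a) + (norm a)\<^sup>2 + (norm e)\<^sup>2)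
         + q * (q - 1) / 2 * (1 + (norm x)\<^sup>2) powr (q - 2) * (2 * (x \<bullet> e))\<^sup>2
         + C * ((1 + (norm x)\<^sup>2) powr q
             * remainder_fun q ((2 * norm x * norm a + (norm a)\<^sup>2 + (norm e)\<^sup>2) / (1 + (norm x)\<^sup>2)))"
proof -
  obtain C where C: "C \<ge> 0" "q = 1 \<Longrightarrow> C = 0"
    and bound: "\<And>a u0 u1 \<theta>. \<bar>a\<bar> \<le> \<theta> \<Longrightarrow> \<bar>u1\<bar> \<le> \<theta> \<Longrightarrow> u0\<^sup>2 \<le> 4 * \<theta> \<Longrightarrow> \<bar>u0 * u1\<bar> \<le> 4 * \<theta>\<^sup>2 \<Longrightarrow>
      0 \<le> 1 + a + (u0 + u1) \<Longrightarrow> 0 \<le> 1 + a - (u0 + u1) \<Longrightarrow>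
      ((1 + a + (u0 + u1)) powr q + (1 + a - (u0 + u1)) powr q) / 2
        \<le> 1 + q * a + q * (q - 1) / 2 * u0\<^sup>2 + C * remainder_fun q \<theta>"
    using symmetric_powr_expansion[OF q] unfolding remainder_fun_def by metis
  show ?thesis
  proof (rule that[OF C])
    fix x a e :: 'v
    define z where "z = 1 + (norm x)\<^sup>2"
    define \<eta> where "\<eta> = 2 * (x \<bullet> a) + (norm a)\<^sup>2 + (norm e)\<^sup>2"
    define \<Theta> where "\<Theta> = 2 * norm x * norm a + (norm a)\<^sup>2 + (norm e)\<^sup>2"
    define t0 where "t0 = 2 * (x \<bullet> e)"
    define t1 where "t1 = 2 * (a \<bullet> e)"
    have z: "z \<ge> 1" "z > 0" "(norm x)\<^sup>2 \<le> z" by (auto simp: z_def)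
       (metis add_pos_nonneg zero_le_power2 zero_less_one)
    have xa: "\<bar>x \<bullet> a\<bar> \<le> norm x * norm a" and xe: "\<bar>x \<bullet> e\<bar> \<le> norm x * norm e"
      and ae: "\<bar>a \<bullet> e\<bar> \<le> norm a * norm e" by (rule Cauchy_Schwarz_ineq2)+
    have \<eta>: "\<bar>\<eta>\<bar> \<le> \<Theta>"
    proof -
      have "0 \<le> (norm a)\<^sup>2" "0 \<le> (norm e)\<^sup>2" by auto
      then show ?thesis using xa unfolding \<eta>_def \<Theta>_def mult.assoc by linarith
    qed
    have \<Theta>0: "\<Theta> \<ge> 0" using \<eta> by linarith
    have t1: "\<bar>t1\<bar> \<le> \<Theta>"
    proof -
      have "2 * (norm a * norm e) \<le> (norm a)\<^sup>2 + (norm e)\<^sup>2"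
        using zero_le_power2[of "norm a - norm e"] by (simp add: power2_diff)
      moreover have "0 \<le> norm x * norm a" by simp
      ultimately show ?thesis using ae using zero_le_power2[of "norm a"] unfolding t1_def \<Theta>_def mult.assoc abs_mult by linarith
    qed
    have e\<Theta>: "(norm e)\<^sup>2 \<le> \<Theta>" by (simp add: \<Theta>_def)
    have t0: "t0\<^sup>2 \<le> 4 * (z * \<Theta>)"
    proof -
      have "\<bar>x \<bullet> e\<bar>\<^sup>2 \<le> (norm x * norm e)\<^sup>2" using xe by (intro power_mono) auto
      also have "\<dots> \<le> z * \<Theta>" unfolding power_mult_distrib using z e\<Theta> by (intro mult_mono) auto
      finally show ?thesis by (simp add: t0_def power_mult_distrib)
    qed
    \<comment> \<open>The norms are regrouped so that |x| meets |a| and the two factors |e| form a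
      square, both being parts of \<Theta>. Bounding t0 and t1 separately would yield only the power
      3/2 of the relative size.\<close>
    have t01: "\<bar>t0 * t1\<bar> \<le> 4 * \<Theta>\<^sup>2"
    proof -
      have "\<bar>t0 * t1\<bar> = 4 * (\<bar>x \<bullet> e\<bar> * \<bar>a \<bullet> e\<bar>)" by (simp add: t0_def t1_def abs_mult)
      also have "\<dots> \<le> 4 * ((norm x * norm e) * (norm a * norm e))"
        using xe ae by (intro mult_left_mono mult_mono) auto
      also have "\<dots> = 2 * ((2 * norm x * norm a) * (norm e)\<^sup>2)" by (simp add: power2_eq_square)
      also have "\<dots> \<le> 2 * (\<Theta> * \<Theta>)"
        using e\<Theta> \<Theta>0 by (intro mult_left_mono mult_mono) (auto simp: \<Theta>_def)
      also have "\<dots> \<le> 4 * \<Theta>\<^sup>2" by (simp add: power2_eq_square)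
      finally show ?thesis .
    qed
    have plus: "1 + (norm (x + a + e))\<^sup>2 = z * (1 + \<eta>/z + (t0/z + t1/z))"
      and minus: "1 + (norm (x + a - e))\<^sup>2 = z * (1 + \<eta>/z - (t0/z + t1/z))"
    proof -
      have "z * (1 + \<eta>/z + (t0/z + t1/z)) = z + \<eta> + (t0 + t1)" using z by (simp add: field_simps)
      moreover have "z * (1 + \<eta>/z - (t0/z + t1/z)) = z + \<eta> - (t0 + t1)" using z by (simp add: field_simps)
      ultimately show "1 + (norm (x + a + e))\<^sup>2 = z * (1 + \<eta>/z + (t0/z + t1/z))"
        "1 + (norm (x + a - e))\<^sup>2 = z * (1 + \<eta>/z - (t0/z + t1/z))"
        by (simp_all add: z_def \<eta>_def t0_def t1_def power2_norm_eq_inner inner_simps inner_commute)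
    qed
    have pos: "0 \<le> 1 + \<eta>/z + (t0/z + t1/z)" "0 \<le> 1 + \<eta>/z - (t0/z + t1/z)"
      using plus minus z by (metis add_nonneg_nonneg zero_le_mult_iff zero_le_one zero_le_power2 less_le_not_le)+
    have "((1 + (norm (x + a + e))\<^sup>2) powr q + (1 + (norm (x + a - e))\<^sup>2) powr q) / 2
      = z powr q * (((1 + \<eta>/z + (t0/z + t1/z)) powr q + (1 + \<eta>/z - (t0/z + t1/z)) powr q) / 2)"
    proof -
      have "(z * s) powr q = z powr q * s powr q" if "0 \<le> s" for s using that z by (simp add: powr_mult)
      from this[OF pos(1)] this[OF pos(2)] show ?thesis unfolding plus minus by (simp only: distrib_left add_divide_distrib times_divide_eq_right)
    qed
    also have "\<dots> \<le> z powr q * (1 + q * (\<eta>/z) + q * (q - 1) / 2 * (t0/z)\<^sup>2 + C * remainder_fun q (\<Theta>/z))"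
    proof (intro mult_left_mono bound pos)
      show "\<bar>\<eta>/z\<bar> \<le> \<Theta>/z" "\<bar>t1/z\<bar> \<le> \<Theta>/z" using \<eta> t1 z by (auto simp: abs_divide divide_right_mono)
      show "(t0/z)\<^sup>2 \<le> 4 * (\<Theta>/z)" using t0 z by (simp add: power_divide field_simps power2_eq_square)
      show "\<bar>t0/z * (t1/z)\<bar> \<le> 4 * (\<Theta>/z)\<^sup>2"
        using divide_right_mono[OF t01, of "z\<^sup>2"] z by (simp add: abs_mult power_divide power2_eq_square)
    qed auto
    also have "\<dots> = z powr q + q * z powr (q - 1) * \<eta> + q * (q - 1) / 2 * z powr (q - 2) * t0\<^sup>2
        + C * (z powr q * remainder_fun q (\<Theta>/z))"
    proof -
      have 1: "z powr q * (q * (\<eta>/z)) = q * z powr (q - 1) * \<eta>" using z by (simp add: powr_diff)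
      have 2: "z powr q * (q * (q - 1) / 2 * (t0/z)\<^sup>2) = q * (q - 1) / 2 * z powr (q - 2) * t0\<^sup>2"
        using z by (simp add: powr_diff power_divide)
      show ?thesis by (simp only: distrib_left 1 2 mult_1_right mult.left_commute[of C])
    qed
    finally show "((1 + (norm (x + a + e))\<^sup>2) powr q + (1 + (norm (x + a - e))\<^sup>2) powr q) / 2
      \<le> (1 + (norm x)\<^sup>2) powr q
         + q * (1 + (norm x)\<^sup>2) powr (q - 1) * (2 * (x \<bullet> a) + (norm a)\<^sup>2 + (norm e)\<^sup>2)
         + q * (q - 1) / 2 * (1 + (norm x)\<^sup>2) powr (q - 2) * (2 * (x \<bullet> e))\<^sup>2
         + C * ((1 + (norm x)\<^sup>2) powr q
             * remainder_fun q ((2 * norm x * norm a + (norm a)\<^sup>2 + (norm e)\<^sup>2) / (1 + (norm x)\<^sup>2)))"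
      by (simp add: z_def \<eta>_def \<Theta>_def t0_def)
  qed
qed

section \<open>Size of the remainder of one step\<close>

lemma remainder_fun_le_sum: "0 \<le> \<theta> \<Longrightarrow> remainder_fun q \<theta> \<le> \<theta>\<^sup>2 + \<theta> powr q"
  by (simp add: remainder_fun_def)

text \<open>For q between 1 and 2, \<open>remainder_fun q \<theta>\<close> is at most 64 times the
  smaller of the square and the power q of \<theta>. So whichever of the two parts is larger can be
  estimated with the power that suits it; the doubling costs a further factor of at most 4.\<close>

lemma remainder_fun_split:
  assumes q: "1 \<le> q" "q \<le> 2" and \<theta>: "0 \<le> \<theta>" "\<theta> \<le> \<theta>1 + \<theta>2" and pos: "0 \<le> \<theta>1" "0 \<le> \<theta>2"
  shows "remainder_fun q \<theta> \<le> 256 * (\<theta>1\<^sup>2 + \<theta>2 powr q)"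
proof -
  have sq: "remainder_fun q \<theta> \<le> 64 * \<theta>\<^sup>2"
  proof (cases "\<theta> \<le> 1/64")
    case False
    have "\<theta> powr q = \<theta> powr (2 + (q - 2))" by simp
    also have "\<dots> = \<theta> powr 2 * \<theta> powr (q - 2)" by (rule powr_add)
    also have "\<dots> \<le> \<theta> powr 2 * (1/64) powr (q - 2)"
      using False q by (intro mult_left_mono powr_mono2') auto
    also have "(1/64) powr (q - 2) \<le> (1/64) powr (-1 :: real)" using q by (intro powr_mono') auto
    also have "(1/64) powr (-1 :: real) = 64" by (simp add: powr_minus)
    finally show ?thesis using False by (simp add: remainder_fun_def powr_numeral mult_left_mono)
  qed (use zero_le_power2[of \<theta>] in \<open>auto simp: remainder_fun_def\<close>)
  have pw: "remainder_fun q \<theta> \<le> 64 * \<theta> powr q"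
  proof (cases "\<theta> \<le> 1/64")
    case True
    have "\<theta>\<^sup>2 \<le> \<theta> powr q"
    proof (cases "\<theta> = 0")
      case False
      then have "\<theta> powr 2 \<le> \<theta> powr q" using True q \<theta> by (intro powr_mono') auto
      then show ?thesis using \<theta> False by (simp add: powr_numeral)
    qed simp
    then show ?thesis using True by (simp add: remainder_fun_def) (smt (verit) powr_ge_zero)
  qed (auto simp: remainder_fun_def)
  show ?thesis
  proof (cases "\<theta>2 \<le> \<theta>1")
    case True
    then have "\<theta>\<^sup>2 \<le> (2 * \<theta>1)\<^sup>2" using \<theta> by (intro power_mono) auto
    also have "(2 * \<theta>1)\<^sup>2 = 4 * \<theta>1\<^sup>2" by (simp add: power_mult_distrib)
    finally have "64 * \<theta>\<^sup>2 \<le> 256 * \<theta>1\<^sup>2" by simp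
    moreover have "0 \<le> 256 * \<theta>2 powr q" by simp
    ultimately show ?thesis using sq unfolding distrib_left by linarith
  next
    case False
    then have "\<theta> powr q \<le> (2 * \<theta>2) powr q" using \<theta> q by (intro powr_mono2) auto
    also have "\<dots> = 2 powr q * \<theta>2 powr q" using pos by (simp add: powr_mult)
    also have "\<dots> \<le> 4 * \<theta>2 powr q"
      using powr_mono[of q 2 2] q by (intro mult_right_mono) (auto simp: powr_numeral)
    finally have "64 * \<theta> powr q \<le> 256 * \<theta>2 powr q" by simp
    moreover have "0 \<le> 256 * \<theta>1\<^sup>2" by simp
    ultimately show ?thesis using pw unfolding distrib_left by linarith
  qed
qed

lemma powr_eq_mult_powr_diff: "0 \<le> x \<Longrightarrow> x * x powr (q - 1) = x powr q" for x :: real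
  using powr_mult_base[of x "q - 1"] by simp

text \<open>Here \<open>S\<close> stands for \<open>\<Delta> powr (1 - lam)\<close>, \<open>\<alpha>\<close> for \<open>\<Delta> \<bar>f\<bar>\<close> and \<open>\<gamma>\<close> for \<open>\<Delta> \<bar>g\<bar>\<^sup>2\<close>. For \<open>q < 2\<close> the growth bound
  on \<open>\<gamma>\<close> alone only yields order \<open>S powr q\<close>, which may exceed \<open>\<Delta>\<close>; the second bound on \<open>\<gamma>\<close>,
  a consequence of the dissipativity condition, repairs this.\<close>

lemma remainder_bound:
  assumes q: "q \<ge> 1" and \<kappa>: "\<kappa> \<ge> 1"
  obtains C where "C \<ge> 0"
    "\<And>\<Delta> S z P W \<alpha> \<gamma> n X e2. 0 < \<Delta> \<Longrightarrow> \<Delta> \<le> 1 \<Longrightarrow> 0 < S \<Longrightarrow> S\<^sup>2 \<le> \<Delta> \<Longrightarrow> 1 \<le> z \<Longrightarrow> z \<le> P \<Longrightarrow> 0 \<le> W \<Longrightarrow>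
      1 \<le> n \<Longrightarrow> 0 \<le> X \<Longrightarrow> X\<^sup>2 \<le> z \<Longrightarrow> 0 \<le> \<alpha> \<Longrightarrow> \<alpha> \<le> \<kappa> * (S * sqrt P) \<Longrightarrow> 0 \<le> \<gamma> \<Longrightarrow> \<gamma> \<le> \<kappa> * (S * P) \<Longrightarrow>
      \<gamma> \<le> \<kappa> * (S * (sqrt z * sqrt P) + \<Delta> * (P + W)) \<Longrightarrow> 0 \<le> e2 \<Longrightarrow> e2 \<le> \<gamma> * n \<Longrightarrow>
      z powr q * remainder_fun q ((2 * X * \<alpha> + \<alpha>\<^sup>2 + e2) / z)
        \<le> C * (\<Delta> * (P powr q + \<Delta> powr ((q - 1) / 2) * (W * P powr (q - 1)))) * n powr (max 2 q)"
proof -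
  define C where "C = (if q \<ge> 2 then 16 * \<kappa> ^ 4 + (4 * \<kappa>\<^sup>2) powr q else 256 * (16 * \<kappa>\<^sup>2 + 4 * \<kappa> ^ 4 + 8 * \<kappa>\<^sup>2))"
  have C0: "C \<ge> 0" using \<kappa> by (auto simp: C_def)
  show ?thesis
  proof (rule that[OF C0])
    fix \<Delta> S z P W \<alpha> \<gamma> n X e2 :: real
    assume \<Delta>: "0 < \<Delta>" "\<Delta> \<le> 1" and S: "0 < S" "S\<^sup>2 \<le> \<Delta>" and z: "1 \<le> z" "z \<le> P" and W: "0 \<le> W"
      and n: "1 \<le> n" and X: "0 \<le> X" "X\<^sup>2 \<le> z" and \<alpha>: "0 \<le> \<alpha>" "\<alpha> \<le> \<kappa> * (S * sqrt P)"
      and \<gamma>: "0 \<le> \<gamma>" "\<gamma> \<le> \<kappa> * (S * P)" "\<gamma> \<le> \<kappa> * (S * (sqrt z * sqrt P) + \<Delta> * (P + W))"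
      and e2: "0 \<le> e2" "e2 \<le> \<gamma> * n"
    define \<Theta> where "\<Theta> = 2 * X * \<alpha> + \<alpha>\<^sup>2 + e2"
    \<comment> \<open>The excess over \<open>P powr q\<close> caused by the kernel average W. Its
      prefactor in \<Delta> is what later makes it absorbable, since it has the same order as the
      dissipation.\<close>
    define E where "E = \<Delta> powr ((q - 1) / 2) * (W * P powr (q - 1))"
    have E: "E \<ge> 0" using W by (simp add: E_def)
    have P: "P \<ge> 1" using z by linarith
    have \<Theta>: "\<Theta> \<ge> 0" using X \<alpha> e2 by (auto simp: \<Theta>_def)
    have S1: "S \<le> 1" using S \<Delta> power2_le_imp_le[of S 1] by simp
    have Ssqrt: "S \<le> sqrt \<Delta>" using real_le_rsqrt S by blast
    have Xz: "X \<le> sqrt z" using X by (simp add: real_le_rsqrt)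
    have zP: "sqrt z \<le> sqrt P" using z by simp
    have \<alpha>2: "\<alpha>\<^sup>2 \<le> \<kappa>\<^sup>2 * (\<Delta> * P)"
    proof -
      have "\<alpha>\<^sup>2 \<le> (\<kappa> * (S * sqrt P))\<^sup>2" using \<alpha> by (intro power_mono) auto
      also have "\<dots> = \<kappa>\<^sup>2 * (S\<^sup>2 * P)" using P by (simp add: power_mult_distrib)
      also have "\<dots> \<le> \<kappa>\<^sup>2 * (\<Delta> * P)" using S P by (intro mult_left_mono mult_right_mono) auto
      finally show ?thesis .
    qed
    have X\<alpha>: "2 * X * \<alpha> \<le> 2 * \<kappa> * (S * (sqrt z * sqrt P))"
    proof -
      have "X * \<alpha> \<le> sqrt z * (\<kappa> * (S * sqrt P))" using Xz X \<alpha> z by (intro mult_mono) auto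
      then show ?thesis by (simp add: ac_simps)
    qed
    have n2: "n powr 2 \<le> n powr max 2 q" by (rule powr_mono) (use n in auto)
    have nq: "n powr q \<le> n powr max 2 q" by (rule powr_mono) (use n in auto)
    have Pq: "0 \<le> P powr q" by simp
    show "z powr q * remainder_fun q ((2 * X * \<alpha> + \<alpha>\<^sup>2 + e2) / z)
        \<le> C * (\<Delta> * (P powr q + \<Delta> powr ((q - 1) / 2) * (W * P powr (q - 1)))) * n powr (max 2 q)"
      unfolding \<Theta>_def[symmetric] E_def[symmetric]
    proof (cases "q \<ge> 2")
      case True
      \<comment> \<open>With q >= 2 both S^2 and \<open>S powr q\<close> are at most \<Delta>, so
        one bound linear in S P n suffices for the two branches of the remainder.\<close>
      define D where "D = 4 * \<kappa>\<^sup>2 * (S * P * n)"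
      have \<Theta>D: "\<Theta> \<le> D"
      proof -
        have k2: "\<kappa> \<le> \<kappa>\<^sup>2" using \<kappa> by (simp add: power2_eq_square)
        have "sqrt z * sqrt P \<le> P" using z P zP mult_right_mono[OF zP, of "sqrt P"] by simp
        then have "2 * \<kappa> * (S * (sqrt z * sqrt P)) \<le> 2 * \<kappa>\<^sup>2 * (S * P)"
          using k2 \<kappa> S z P by (intro mult_mono) auto
        then have 1: "2 * X * \<alpha> \<le> 2 * \<kappa>\<^sup>2 * (S * P)" using X\<alpha> by linarith
        have "\<alpha>\<^sup>2 \<le> (\<kappa> * (S * sqrt P))\<^sup>2" using \<alpha> by (intro power_mono) auto
        also have "\<dots> = \<kappa>\<^sup>2 * (S\<^sup>2 * P)" using P by (simp add: power_mult_distrib)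
        also have "\<dots> \<le> \<kappa>\<^sup>2 * (S * P)" using S S1 P
          by (intro mult_left_mono mult_right_mono) (auto simp: power2_eq_square)
        finally have 2: "\<alpha>\<^sup>2 \<le> \<kappa>\<^sup>2 * (S * P)" .
        have "S * P * 1 \<le> S * P * n" using S P n by (intro mult_left_mono) auto
        then have 3: "\<kappa>\<^sup>2 * (S * P) \<le> \<kappa>\<^sup>2 * (S * P * n)" by (intro mult_left_mono) auto
        have "e2 \<le> \<kappa> * (S * P) * n" using e2 \<gamma> n by (meson mult_right_mono order_trans zero_le_one)
        also have "\<dots> \<le> \<kappa>\<^sup>2 * (S * P) * n" using k2 S P n by (intro mult_right_mono) auto
        finally have 4: "e2 \<le> \<kappa>\<^sup>2 * (S * P * n)" by (simp add: mult.assoc)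
        show ?thesis unfolding \<Theta>_def D_def using 1 2 3 4 by linarith
      qed
      have D0: "D \<ge> 0" using \<Theta> \<Theta>D by linarith
      have "z powr q * remainder_fun q (\<Theta> / z) \<le> z powr q * ((\<Theta>/z)\<^sup>2 + (\<Theta>/z) powr q)"
        using \<Theta> z by (intro mult_left_mono remainder_fun_le_sum) auto
      also have "\<dots> = z powr (q - 2) * \<Theta>\<^sup>2 + \<Theta> powr q"
        using z \<Theta> by (simp add: powr_diff powr_divide power_divide distrib_left)
      also have "\<dots> \<le> P powr (q - 2) * D\<^sup>2 + D powr q"
        using z \<Theta> \<Theta>D True by (intro add_mono mult_mono power_mono powr_mono2) auto
      also have "P powr (q - 2) * D\<^sup>2 = 16 * \<kappa> ^ 4 * (S\<^sup>2 * P powr q * n powr 2)"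
        using P n by (simp add: D_def power_mult_distrib powr_diff)
      also have "\<dots> \<le> 16 * \<kappa> ^ 4 * (\<Delta> * P powr q * n powr max 2 q)"
        using S n2 \<kappa> \<Delta> by (intro mult_left_mono mult_mono) auto
      also have "D powr q = (4 * \<kappa>\<^sup>2) powr q * (S powr q * P powr q * n powr q)"
        using S P n by (simp add: D_def powr_mult)
      also have "\<dots> \<le> (4 * \<kappa>\<^sup>2) powr q * (\<Delta> * P powr q * n powr max 2 q)"
      proof -
        have "S powr q \<le> S powr 2" using S S1 True by (intro powr_mono') auto
        then have "S powr q \<le> \<Delta>" using S by (simp add: powr_numeral)
        then show ?thesis using nq \<Delta> by (intro mult_left_mono mult_mono) auto
      qed
      finally have "z powr q * remainder_fun q (\<Theta> / z) \<le> C * (\<Delta> * P powr q * n powr max 2 q)"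
        using True by (simp add: C_def algebra_simps)
      also have "\<dots> \<le> C * (\<Delta> * (P powr q + E) * n powr max 2 q)"
        using E \<Delta> C0 by (intro mult_left_mono mult_right_mono) auto
      finally show "z powr q * remainder_fun q (\<Theta> / z) \<le> C * (\<Delta> * (P powr q + E)) * n powr max 2 q"
        by (simp only: mult.assoc)
    next
      case False
      then have q2: "q \<le> 2" by simp
      have split: "z powr q * remainder_fun q (\<Theta> / z) \<le> 256 * (z powr (q - 2) * \<Theta>1\<^sup>2 + \<Theta>2 powr q)"
        if "\<Theta> \<le> \<Theta>1 + \<Theta>2" "0 \<le> \<Theta>1" "0 \<le> \<Theta>2" for \<Theta>1 \<Theta>2
      proof -
        have "remainder_fun q (\<Theta>/z) \<le> 256 * ((\<Theta>1/z)\<^sup>2 + (\<Theta>2/z) powr q)"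
          using that q q2 z \<Theta> by (intro remainder_fun_split) (auto simp: add_divide_distrib[symmetric] divide_right_mono)
        then have "z powr q * remainder_fun q (\<Theta>/z) \<le> z powr q * (256 * ((\<Theta>1/z)\<^sup>2 + (\<Theta>2/z) powr q))"
          by (intro mult_left_mono) auto
        also have "\<dots> = 256 * (z powr (q - 2) * \<Theta>1\<^sup>2 + \<Theta>2 powr q)"
          using z that by (simp add: powr_diff powr_divide power_divide distrib_left)
        finally show ?thesis .
      qed
      \<comment> \<open>Now q - 2 < 0, so \<open>z powr (q - 2)\<close> cannot be replaced by the
        same power of P. It is the factor sqrt z in the bound, squared, that raises the exponent to
        q - 1 >= 0, after which z <= P applies.\<close>
      have good: "z powr (q - 2) * \<Theta>1\<^sup>2 \<le> 16 * \<kappa>\<^sup>2 * (\<Delta> * P powr q * n powr 2)"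
        if "\<Theta>1 \<le> 4 * \<kappa> * (S * (sqrt z * sqrt P)) * n" "0 \<le> \<Theta>1" for \<Theta>1
      proof -
        have "\<Theta>1\<^sup>2 \<le> (4 * \<kappa> * (S * (sqrt z * sqrt P)) * n)\<^sup>2" using that by (intro power_mono) auto
        also have "\<dots> = 16 * \<kappa>\<^sup>2 * (S\<^sup>2 * (z * P)) * n powr 2"
          using z P n by (simp add: power_mult_distrib)
        finally have "z powr (q - 2) * \<Theta>1\<^sup>2 \<le> z powr (q - 2) * (16 * \<kappa>\<^sup>2 * (S\<^sup>2 * (z * P)) * n powr 2)"
          by (intro mult_left_mono) auto
        also have "\<dots> = 16 * \<kappa>\<^sup>2 * (S\<^sup>2 * (z powr (q - 1) * P) * n powr 2)"
        proof -
          have "z powr (q - 2) * z = z powr (q - 1)"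
            using powr_eq_mult_powr_diff[of z "q - 1"] z by (simp add: mult.commute)
          then show ?thesis by (simp add: ac_simps)
        qed
        also have "\<dots> \<le> 16 * \<kappa>\<^sup>2 * (\<Delta> * (P powr (q - 1) * P) * n powr 2)"
          using S z P q \<Delta> by (intro mult_left_mono mult_right_mono mult_mono powr_mono2) auto
        also have "P powr (q - 1) * P = P powr q"
          using powr_eq_mult_powr_diff[of P q] P by (simp add: mult.commute)
        finally show ?thesis .
      qed
      have goodn: "16 * \<kappa>\<^sup>2 * (\<Delta> * P powr q * n powr 2) \<le> 16 * \<kappa>\<^sup>2 * (\<Delta> * (P powr q + E) * n powr 2)"
        using E \<Delta> by (intro mult_left_mono mult_right_mono) auto
      \<comment> \<open>\<alpha>^2 is of order \<Delta> P rather than S P, so its power q is already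
        of order \<Delta> and it may sit in the second part of the split.\<close>
      have \<alpha>q: "(\<alpha>\<^sup>2) powr q \<le> \<kappa> ^ 4 * (\<Delta> * (P powr q + E) * n powr 2)"
      proof -
        have "(\<alpha>\<^sup>2) powr q \<le> (\<kappa>\<^sup>2 * (\<Delta> * P)) powr q" using \<alpha>2 q by (intro powr_mono2) auto
        also have "\<dots> = (\<kappa>\<^sup>2) powr q * (\<Delta> powr q * P powr q)" using \<Delta> P by (simp add: powr_mult)
        also have "\<dots> \<le> \<kappa> ^ 4 * (\<Delta> * P powr q)"
        proof -
          have "(\<kappa>\<^sup>2) powr q \<le> (\<kappa>\<^sup>2) powr 2" using \<kappa> q2 by (intro powr_mono) auto
          moreover have "\<Delta> powr q \<le> \<Delta> powr 1" using \<Delta> q by (intro powr_mono') auto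
          ultimately show ?thesis using \<kappa> \<Delta> by (intro mult_mono) (auto simp: powr_numeral)
        qed
        also have "\<dots> \<le> \<kappa> ^ 4 * (\<Delta> * (P powr q + E) * n powr 2)"
        proof -
          have "\<Delta> * P powr q * 1 \<le> \<Delta> * (P powr q + E) * n powr 2"
            using \<Delta> E n powr_mono[of 0 2 n] by (intro mult_mono) auto
          then show ?thesis using \<kappa> by (intro mult_left_mono) auto
        qed
        finally show ?thesis .
      qed
      \<comment> \<open>Case split on which summand dominates the dissipative bound on \<gamma>. If
        it is S sqrt z sqrt P, then e2 joins the quadratic part. Otherwise \<gamma> is linear in
        \<Delta>, and e2 is estimated with the power q.\<close>
      have "z powr q * remainder_fun q (\<Theta> / z) \<le> C * (\<Delta> * (P powr q + E) * n powr 2)"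
      proof (cases "\<gamma> \<le> 2 * \<kappa> * (S * (sqrt z * sqrt P))")
        case True
        define \<Theta>1 where "\<Theta>1 = 2 * X * \<alpha> + e2"
        have "e2 \<le> 2 * \<kappa> * (S * (sqrt z * sqrt P)) * n" using e2 True n
          by (meson mult_right_mono order_trans zero_le_one)
        moreover have "2 * \<kappa> * (S * (sqrt z * sqrt P)) * 1 \<le> 2 * \<kappa> * (S * (sqrt z * sqrt P)) * n"
          using n \<kappa> S z P by (intro mult_left_mono) auto
        ultimately have "\<Theta>1 \<le> 4 * \<kappa> * (S * (sqrt z * sqrt P)) * n" using X\<alpha> unfolding \<Theta>1_def by linarith
        moreover have "0 \<le> \<Theta>1" using X \<alpha> e2 by (auto simp: \<Theta>1_def)
        ultimately have "z powr q * remainder_fun q (\<Theta> / z) \<le>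
            256 * (16 * \<kappa>\<^sup>2 * (\<Delta> * (P powr q + E) * n powr 2) + \<kappa> ^ 4 * (\<Delta> * (P powr q + E) * n powr 2))"
          using split[of \<Theta>1 "\<alpha>\<^sup>2"] good[of \<Theta>1] goodn \<alpha>q by (simp add: \<Theta>_def \<Theta>1_def)
        also have "\<dots> = 256 * (16 * \<kappa>\<^sup>2 + \<kappa> ^ 4) * (\<Delta> * (P powr q + E) * n powr 2)" by (simp add: distrib_right)
        also have "\<dots> \<le> C * (\<Delta> * (P powr q + E) * n powr 2)"
          using \<Delta> E False \<kappa> by (intro mult_right_mono) (auto simp: C_def)
        finally show ?thesis .
      next
        case large: False
        then have \<gamma>': "\<gamma> \<le> 2 * \<kappa> * (\<Delta> * (P + W))" using \<gamma>(3) by (simp add: algebra_simps)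
        define T where "T = \<Delta> * (P powr q + E) * n powr 2"
        have "2 * X * \<alpha> \<le> 4 * \<kappa> * (S * (sqrt z * sqrt P)) * n"
        proof -
          have "2 * \<kappa> * (S * (sqrt z * sqrt P)) * 1 \<le> 4 * \<kappa> * (S * (sqrt z * sqrt P)) * n"
            using n \<kappa> S z P by (intro mult_mono) auto
          then show ?thesis using X\<alpha> by linarith
        qed
        moreover have X\<alpha>0: "0 \<le> 2 * X * \<alpha>" using X \<alpha> by auto
        ultimately have c1: "z powr (q - 2) * (2 * X * \<alpha>)\<^sup>2 \<le> 16 * \<kappa>\<^sup>2 * T"
          using good[of "2 * X * \<alpha>"] goodn unfolding T_def by linarith
        have c2: "(\<alpha>\<^sup>2 + e2) powr q \<le> 4 * ((\<alpha>\<^sup>2) powr q + e2 powr q)"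
        proof -
          have "(\<alpha>\<^sup>2 + e2) powr q \<le> (2 * max (\<alpha>\<^sup>2) e2) powr q" using e2 q by (intro powr_mono2) auto
          also have "\<dots> = 2 powr q * max (\<alpha>\<^sup>2) e2 powr q" using e2 by (simp add: powr_mult)
          also have "\<dots> \<le> 4 * max (\<alpha>\<^sup>2) e2 powr q"
            using powr_mono[of q 2 2] q2 by (intro mult_right_mono) (auto simp: powr_numeral)
          also have "\<dots> \<le> 4 * ((\<alpha>\<^sup>2) powr q + e2 powr q)" by (auto simp: max_def)
          finally show ?thesis .
        qed
        \<comment> \<open>Of the q factors \<gamma>, one is spent on the bound linear in \<Delta>,
          and the remaining power q - 1 on the growth bound. The latter yields
          \<open>S powr (q - 1)\<close>, at most \<open>\<Delta> powr ((q - 1) / 2)\<close>, which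
          is the small factor in front of W.\<close>
        have c3: "e2 powr q \<le> 2 * \<kappa>\<^sup>2 * (\<Delta> * (P powr q + E) * n powr 2)"
        proof -
          have "e2 powr q \<le> (\<gamma> * n) powr q" using e2 q by (intro powr_mono2) auto
          also have "\<dots> = \<gamma> * \<gamma> powr (q - 1) * n powr q" using \<gamma> n by (simp add: powr_mult powr_eq_mult_powr_diff)
          also have "\<dots> \<le> (2 * \<kappa> * (\<Delta> * (P + W))) * (\<kappa> * (S powr (q - 1) * P powr (q - 1))) * n powr 2"
          proof -
            have "\<gamma> powr (q - 1) \<le> (\<kappa> * (S * P)) powr (q - 1)" using \<gamma> q by (intro powr_mono2) auto
            also have "\<dots> = \<kappa> powr (q - 1) * (S powr (q - 1) * P powr (q - 1))"
              using \<kappa> S P by (simp add: powr_mult)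
            also have "\<dots> \<le> \<kappa> powr 1 * (S powr (q - 1) * P powr (q - 1))"
              using \<kappa> q2 by (intro mult_right_mono powr_mono) auto
            finally have "\<gamma> powr (q - 1) \<le> \<kappa> * (S powr (q - 1) * P powr (q - 1))" using \<kappa> by simp
            moreover have "n powr q \<le> n powr 2" using n q2 by (intro powr_mono) auto
            ultimately show ?thesis using \<gamma>' \<gamma> \<kappa> \<Delta> P W by (intro mult_mono) auto
          qed
          also have "\<dots> = 2 * \<kappa>\<^sup>2 * (\<Delta> * (S powr (q - 1) * (P * P powr (q - 1)) + S powr (q - 1) * (W * P powr (q - 1))) * n powr 2)"
            by (simp add: power2_eq_square algebra_simps)
          also have "\<dots> \<le> 2 * \<kappa>\<^sup>2 * (\<Delta> * (P powr q + E) * n powr 2)"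
          proof -
            have "S powr (q - 1) \<le> 1" using S S1 q by (intro powr_le1) auto
            then have "S powr (q - 1) * (P * P powr (q - 1)) \<le> 1 * P powr q"
              unfolding powr_eq_mult_powr_diff[OF order_trans[OF zero_le_one P]] by (intro mult_right_mono) auto
            moreover have "S powr (q - 1) * (W * P powr (q - 1)) \<le> E"
            proof -
              have "S powr (q - 1) \<le> sqrt \<Delta> powr (q - 1)" using S Ssqrt q by (intro powr_mono2) auto
              also have "\<dots> = \<Delta> powr ((q - 1) / 2)" using \<Delta> by (simp add: powr_half_sqrt[symmetric] powr_powr)
              finally show ?thesis unfolding E_def using W by (intro mult_right_mono) auto
            qed
            ultimately show ?thesis using \<Delta> \<kappa> by (intro mult_left_mono mult_right_mono) auto
          qed
          finally show ?thesis .
        qed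
        have "z powr q * remainder_fun q (\<Theta> / z) \<le> 256 * (z powr (q - 2) * (2 * X * \<alpha>)\<^sup>2 + (\<alpha>\<^sup>2 + e2) powr q)"
          by (rule split) (use X\<alpha>0 e2 in \<open>auto simp: \<Theta>_def\<close>)
        also have "\<dots> \<le> 256 * (16 * \<kappa>\<^sup>2 * T + 4 * (\<kappa> ^ 4 * T + 2 * \<kappa>\<^sup>2 * T))"
          using c1 c2 c3[folded T_def] \<alpha>q[folded T_def] by (intro mult_left_mono add_mono) auto
        also have "\<dots> = 256 * (16 * \<kappa>\<^sup>2 + 4 * \<kappa> ^ 4 + 8 * \<kappa>\<^sup>2) * T" by (simp add: distrib_right distrib_left)
        also have "\<dots> = C * (\<Delta> * (P powr q + E) * n powr 2)"
          using False by (auto simp: C_def T_def)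
        finally show ?thesis .
      qed
      also have "\<dots> \<le> C * (\<Delta> * (P powr q + E) * n powr max 2 q)"
        using n2 \<Delta> E C0 by (intro mult_left_mono) auto
      finally show "z powr q * remainder_fun q (\<Theta> / z) \<le> C * (\<Delta> * (P powr q + E)) * n powr max 2 q"
        by (simp only: mult.assoc)
    qed
  qed
qed

section \<open>Centred Gaussian vectors\<close>

text \<open>Written with the very density that \<open>brownian_motion\<close> prescribes for its
  increments; \<sigma> is the standard deviation.\<close>

definition gauss :: "real \<Rightarrow> (real^'d) measure" where
  "gauss \<sigma> = density lborel (\<lambda>x. ennreal (\<Prod>i\<in>UNIV. normal_density 0 \<sigma> (x $ i)))"

lemma sets_gauss [simp, measurable_cong]: "sets (gauss \<sigma>) = sets borel"
  by (simp add: gauss_def)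

lemma space_gauss [simp]: "space (gauss \<sigma>) = UNIV"
  by (simp add: gauss_def)

lemma prod_Basis_vec:
  fixes f :: "real^'d \<Rightarrow> _ \<Rightarrow> 'b::comm_monoid_mult"
  shows "(\<Prod>b\<in>Basis. f b (x \<bullet> b)) = (\<Prod>i\<in>UNIV. f (axis i 1) (x $ i))"
proof -
  have "(Basis :: (real^'d) set) = range (\<lambda>i. axis i 1)" by (auto simp: Basis_vec_def)
  moreover have "inj (\<lambda>i::'d. axis i (1::real))" by (auto simp: inj_def axis_eq_axis)
  ultimately have "(\<Prod>b\<in>Basis. f b (x \<bullet> b)) = (\<Prod>i\<in>UNIV. f (axis i 1) (x \<bullet> axis i 1))"
    using prod.reindex[of "\<lambda>i::'d. axis i (1::real)" UNIV "\<lambda>b. f b (x \<bullet> b)"] by (simp only: o_def)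
  then show ?thesis by (simp add: inner_axis)
qed

lemma nn_integral_gauss_prod:
  fixes h :: "'d::finite \<Rightarrow> real \<Rightarrow> real"
  assumes [measurable]: "\<And>i. h i \<in> borel_measurable borel" and nn: "\<And>i x. 0 \<le> h i x" and \<sigma>: "\<sigma> > 0"
  shows "(\<integral>\<^sup>+y. ennreal (\<Prod>i\<in>UNIV. h i (y $ i)) \<partial>gauss \<sigma>)
    = (\<Prod>i\<in>UNIV. (\<integral>\<^sup>+x. ennreal (normal_density 0 \<sigma> x * h i x) \<partial>lborel))"
proof -
  \<comment> \<open>Recovers the coordinate from a basis vector, so that the product over
    coordinates becomes one over \<open>Basis\<close>, the form in which Tonelli's theorem for
    \<open>lborel\<close> is available.\<close>
  define idx where "idx b = (THE i. b = axis i (1::real))" for b :: "real^'d"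
  have idx: "idx (axis i 1) = i" for i by (simp add: idx_def axis_eq_axis)
  define F where "F b x = ennreal (normal_density 0 \<sigma> x * h (idx b) x)" for b :: "real^'d" and x
  have [measurable]: "F b \<in> borel_measurable borel" for b unfolding F_def by measurable
  have "(\<integral>\<^sup>+y. ennreal (\<Prod>i\<in>UNIV. h i (y $ i)) \<partial>gauss \<sigma>)
      = (\<integral>\<^sup>+y. (\<Prod>b\<in>Basis. F b (y \<bullet> b)) \<partial>lborel)"
    unfolding gauss_def prod_Basis_vec[of F]
    by (subst nn_integral_density)
       (auto simp: F_def idx prod_ennreal nn ennreal_mult[symmetric] prod_nonneg prod.distrib intro!: nn_integral_cong)
  also have "\<dots> = (\<Prod>b\<in>Basis. (\<integral>\<^sup>+x. F b x \<partial>lborel))" by (rule nn_integral_lborel_prod) auto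
  also have "\<dots> = (\<Prod>i\<in>UNIV. (\<integral>\<^sup>+x. ennreal (normal_density 0 \<sigma> x * h i x) \<partial>lborel))"
    using prod_Basis_vec[where f="\<lambda>b _. \<integral>\<^sup>+x. F b x \<partial>lborel" and x=0] by (simp add: F_def idx)
  finally show ?thesis .
qed

lemma nn_integral_normal_density: "\<sigma> > 0 \<Longrightarrow> (\<integral>\<^sup>+x. ennreal (normal_density 0 \<sigma> x) \<partial>lborel) = 1"
  by (subst nn_integral_eq_integral) (auto simp: integrable_normal_density integral_normal_density)

lemma prob_space_gauss: "\<sigma> > 0 \<Longrightarrow> prob_space (gauss \<sigma>)"
  using nn_integral_gauss_prod[of "\<lambda>_ _. 1" \<sigma>]
  by (intro prob_spaceI) (simp add: nn_integral_normal_density)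

text \<open>Lebesgue measure is invariant under coordinate reflections and the density depends on
  squares only. Flipping all signs gives the symmetry behind the averaging of a step; flipping a
  single one makes the mixed second moments vanish.\<close>

lemma distr_gauss_flip:
  fixes c :: "'d::finite \<Rightarrow> real"
  assumes c: "\<And>i. \<bar>c i\<bar> = 1"
  shows "distr (gauss \<sigma>) borel (\<lambda>x. \<chi> i. c i * x $ i) = (gauss \<sigma> :: (real^'d) measure)"
proof -
  define idx where "idx b = (THE i. b = axis i (1::real))" for b :: "real^'d"
  have idx: "idx (axis i 1) = i" for i by (simp add: idx_def axis_eq_axis)
  define T where "T x = (\<chi> i. c i * x $ i)" for x :: "real^'d"
  have T: "T x = 0 + (\<Sum>j\<in>Basis. (c (idx j) * (x \<bullet> j)) *\<^sub>R j)" for x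
  proof (rule euclidean_eqI)
    fix b :: "real^'d" assume b: "b \<in> Basis"
    then obtain i where i: "b = axis i 1" by (auto simp: Basis_vec_def)
    show "T x \<bullet> b = (0 + (\<Sum>j\<in>Basis. (c (idx j) * (x \<bullet> j)) *\<^sub>R j)) \<bullet> b"
      using b by (simp add: inner_sum_left_Basis) (simp add: i idx T_def inner_axis)
  qed
  have [measurable]: "T \<in> borel \<rightarrow>\<^sub>M borel" unfolding T by measurable
  have nz: "c i \<noteq> 0" for i using c[of i] by auto
  have leb: "lborel = distr lborel borel T"
  proof -
    have "lborel = density (distr lborel borel T) (\<lambda>_. \<Prod>j\<in>Basis. \<bar>c (idx j)\<bar>)"
      using lborel_affine_euclidean[of "\<lambda>j. c (idx j)" "0 :: real^'d"] nz unfolding T by simp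
    then show ?thesis by (simp add: c density_1)
  qed
  have dens: "normal_density 0 \<sigma> (c i * x) = normal_density 0 \<sigma> x" for i x
  proof -
    have "(c i * x)\<^sup>2 = x\<^sup>2" using c[of i] by (metis abs_mult mult_1 power2_abs)
    then show ?thesis by (simp add: normal_density_def)
  qed
  let ?d = "\<lambda>x :: real^'d. ennreal (\<Prod>i\<in>UNIV. normal_density 0 \<sigma> (x $ i))"
  have "distr (gauss \<sigma>) borel T = distr (density lborel (\<lambda>x. ?d (T x))) borel T"
    by (simp add: gauss_def T_def dens)
  also have "\<dots> = density (distr lborel borel T) ?d" by (rule density_distr[symmetric]) auto
  also have "\<dots> = gauss \<sigma>" by (simp add: leb[symmetric] gauss_def)
  finally show ?thesis by (simp add: T_def[abs_def])
qed

lemma distr_gauss_uminus: "distr (gauss \<sigma>) borel uminus = (gauss \<sigma> :: (real^'d) measure)"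
proof -
  have "(\<lambda>x::real^'d. \<chi> i. - 1 * x $ i) = uminus" by (auto simp: vec_eq_iff)
  then show ?thesis using distr_gauss_flip[of "\<lambda>_::'d. -1" \<sigma>] by simp
qed

lemma gauss_eq_distr_scaleR:
  assumes \<sigma>: "\<sigma> > 0"
  shows "gauss \<sigma> = (distr (gauss 1) borel (\<lambda>x. \<sigma> *\<^sub>R x) :: (real^'d) measure)"
proof -
  let ?d = "\<lambda>\<sigma> x. ennreal (\<Prod>i\<in>UNIV. normal_density 0 \<sigma> (x $ (i::'d)))"
  define S where "S = (\<lambda>x::real^'d. \<sigma> *\<^sub>R x)"
  have [measurable]: "S \<in> borel \<rightarrow>\<^sub>M borel" by (simp add: S_def)
  have leb: "lborel = density (distr lborel borel S) (\<lambda>_. ennreal (\<sigma> ^ CARD('d)))"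
    using lborel_affine[of \<sigma> "0 :: real^'d"] \<sigma> by (simp add: S_def)
  have one: "\<sigma> * normal_density 0 \<sigma> (\<sigma> * x) = normal_density 0 1 x" for x
    using \<sigma> by (simp add: normal_density_def power_mult_distrib real_sqrt_mult)
  have dens: "ennreal (\<sigma> ^ CARD('d)) * ?d \<sigma> (S x) = ?d 1 x" for x
  proof -
    have "\<sigma> ^ CARD('d) * (\<Prod>i\<in>UNIV. normal_density 0 \<sigma> (S x $ i)) = (\<Prod>i\<in>UNIV. \<sigma> * normal_density 0 \<sigma> (\<sigma> * x $ i))"
      by (simp add: prod.distrib S_def)
    also have "\<dots> = (\<Prod>i\<in>UNIV. normal_density 0 1 (x $ i))" by (simp only: one)
    finally show ?thesis using \<sigma> by (simp add: ennreal_mult[symmetric] prod_nonneg)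
  qed
  have "gauss \<sigma> = density (density (distr lborel borel S) (\<lambda>_. ennreal (\<sigma> ^ CARD('d)))) (?d \<sigma>)"
    by (simp add: gauss_def leb[symmetric])
  also have "\<dots> = density (distr lborel borel S) (\<lambda>x. ennreal (\<sigma> ^ CARD('d)) * ?d \<sigma> x)"
    by (rule density_density_eq) auto
  also have "\<dots> = distr (density lborel (\<lambda>x. ennreal (\<sigma> ^ CARD('d)) * ?d \<sigma> (S x))) borel S"
    by (rule density_distr) auto
  also have "\<dots> = distr (gauss 1) borel S" by (simp only: dens gauss_def)
  finally show ?thesis by (simp add: S_def)
qed

lemma one_plus_sum_le_prod:
  fixes f :: "'a \<Rightarrow> real"
  assumes "finite A" "\<And>i. 0 \<le> f i"
  shows "1 + (\<Sum>i\<in>A. f i) \<le> (\<Prod>i\<in>A. 1 + f i)"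
  using assms
proof (induction A rule: finite_induct)
  case (insert x A)
  have "1 \<le> (\<Prod>i\<in>A. 1 + f i)" using insert by (intro prod_ge_1) auto
  then have "f x * 1 \<le> f x * (\<Prod>i\<in>A. 1 + f i)" using insert by (intro mult_left_mono) auto
  then show ?case using insert by (simp add: distrib_right)
qed simp

text \<open>1 + |y|^2 is at most the product of the factors 1 + \<open>(y $ i)\<^sup>2\<close>, so
  the integral is dominated by a product of one-dimensional normal moments.\<close>

lemma integrable_gauss_polynomial: "integrable (gauss 1) (\<lambda>y::real^'d. (1 + (norm y)\<^sup>2) ^ m)"
proof (rule integrableI_nonneg)
  have fin: "(\<integral>\<^sup>+x. ennreal (normal_density 0 1 x * (1 + x\<^sup>2) ^ m) \<partial>lborel) < \<infinity>"
  proof -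
    have "integrable lborel (\<lambda>x. \<Sum>k\<le>m. of_nat (m choose k) * (normal_density 0 1 x * (x - 0) ^ (2 * (m - k))))"
      by (intro Bochner_Integration.integrable_sum integrable_mult_right integrable_normal_moment) auto
    also have "(\<lambda>x. \<Sum>k\<le>m. of_nat (m choose k) * (normal_density 0 1 x * (x - 0) ^ (2 * (m - k))))
        = (\<lambda>x::real. normal_density 0 1 x * (1 + x\<^sup>2) ^ m)"
      unfolding binomial_ring by (simp add: sum_distrib_left power_mult[symmetric] ac_simps)
    finally have "integrable lborel (\<lambda>x. normal_density 0 1 x * (1 + x\<^sup>2) ^ m)" .
    then show ?thesis by (subst nn_integral_eq_integral) auto
  qed
  have "(\<integral>\<^sup>+(y::real^'d). ennreal ((1 + (norm y)\<^sup>2) ^ m) \<partial>gauss 1)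
      \<le> (\<integral>\<^sup>+y. ennreal (\<Prod>i\<in>UNIV. (1 + (y $ (i::'d))\<^sup>2) ^ m) \<partial>gauss 1)"
  proof (intro nn_integral_mono ennreal_leI)
    fix y :: "real^'d"
    have "(norm y)\<^sup>2 = (\<Sum>i\<in>UNIV. (y $ i)\<^sup>2)" by (simp add: norm_vec_def L2_set_def sum_nonneg)
    then have "1 + (norm y)\<^sup>2 \<le> (\<Prod>i\<in>UNIV. 1 + (y $ i)\<^sup>2)"
      using one_plus_sum_le_prod[of UNIV "\<lambda>i. (y $ i)\<^sup>2"] by simp
    then show "(1 + (norm y)\<^sup>2) ^ m \<le> (\<Prod>i\<in>UNIV. (1 + (y $ i)\<^sup>2) ^ m)"
      unfolding prod_power_distrib[symmetric] by (intro power_mono) auto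
  qed
  also have "\<dots> = (\<Prod>i\<in>(UNIV::'d set). (\<integral>\<^sup>+x. ennreal (normal_density 0 1 x * (1 + x\<^sup>2) ^ m) \<partial>lborel))"
    by (rule nn_integral_gauss_prod) auto
  also have "\<dots> < \<infinity>" using fin by (simp add: power_less_top_ennreal)
  finally show "(\<integral>\<^sup>+(y::real^'d). ennreal ((1 + (norm y)\<^sup>2) ^ m) \<partial>gauss 1) < \<infinity>" .
qed auto

text \<open>After rescaling by \<sigma> the moments do not depend on \<sigma>; this is why the
  constants of a step are independent of the step size.\<close>

lemma integrable_gauss_powr:
  assumes \<sigma>: "\<sigma> > 0"
  shows "integrable (gauss \<sigma>) (\<lambda>y::real^'d. (1 + (norm y)\<^sup>2 / \<sigma>\<^sup>2) powr r)"
    and "(\<integral>(y::real^'d). (1 + (norm y)\<^sup>2 / \<sigma>\<^sup>2) powr r \<partial>gauss \<sigma>) = (\<integral>(y::real^'d). (1 + (norm y)\<^sup>2) powr r \<partial>gauss 1)"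
proof -
  obtain m :: nat where m: "r \<le> real m" using real_arch_simple by blast
  have ge: "1 + (norm (y::real^'d))\<^sup>2 \<ge> 1" for y by simp
  have "integrable (gauss 1) (\<lambda>y::real^'d. (1 + (norm y)\<^sup>2) powr r)"
  proof (rule Bochner_Integration.integrable_bound[OF integrable_gauss_polynomial[of m]])
    have "(1 + (norm y)\<^sup>2) powr r \<le> (1 + (norm y)\<^sup>2) ^ m" for y :: "real^'d"
      using powr_mono[OF m ge[of y]] less_le_trans[OF zero_less_one ge[of y]] by (simp add: powr_realpow)
    then show "AE y in gauss 1. norm ((1 + (norm (y::real^'d))\<^sup>2) powr r) \<le> norm ((1 + (norm y)\<^sup>2) ^ m)"
      by auto
  qed auto
  then show "integrable (gauss \<sigma>) (\<lambda>y::real^'d. (1 + (norm y)\<^sup>2 / \<sigma>\<^sup>2) powr r)"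
    unfolding gauss_eq_distr_scaleR[OF \<sigma>] using \<sigma>
    by (subst integrable_distr_eq) (auto simp: power_mult_distrib)
  show "(\<integral>(y::real^'d). (1 + (norm y)\<^sup>2 / \<sigma>\<^sup>2) powr r \<partial>gauss \<sigma>) = (\<integral>(y::real^'d). (1 + (norm y)\<^sup>2) powr r \<partial>gauss 1)"
    unfolding gauss_eq_distr_scaleR[OF \<sigma>] using \<sigma>
    by (subst integral_distr) (auto simp: power_mult_distrib)
qed

lemma integrable_gauss_norm_sq: "\<sigma> > 0 \<Longrightarrow> integrable (gauss \<sigma>) (\<lambda>y::real^'d. (norm y)\<^sup>2)"
proof (rule Bochner_Integration.integrable_bound[OF integrable_mult_right[OF integrable_gauss_powr(1)[of \<sigma> 1], of "\<sigma>\<^sup>2"]])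
  assume "\<sigma> > 0"
  then have "(norm y)\<^sup>2 \<le> \<sigma>\<^sup>2 * (1 + (norm y)\<^sup>2 / \<sigma>\<^sup>2) powr 1" for y :: "real^'d"
    by (simp add: distrib_left)
  then show "AE y in gauss \<sigma>. norm ((norm (y::real^'d))\<^sup>2) \<le> norm (\<sigma>\<^sup>2 * (1 + (norm y)\<^sup>2 / \<sigma>\<^sup>2) powr 1)"
    by auto
qed auto

lemma gauss_covariance:
  assumes \<sigma>: "\<sigma> > 0"
  shows "integrable (gauss \<sigma>) (\<lambda>y::real^'d. y $ i * y $ j)"
    and "(\<integral>(y::real^'d). y $ i * y $ j \<partial>gauss \<sigma>) = (if i = j then \<sigma>\<^sup>2 else 0)"
proof -
  have bd: "\<bar>y $ i * y $ j\<bar> \<le> (norm y)\<^sup>2" for y :: "real^'d"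
    using mult_mono[OF component_le_norm_cart[of y i] component_le_norm_cart[of y j]]
    by (simp add: abs_mult power2_eq_square)
  show "integrable (gauss \<sigma>) (\<lambda>y::real^'d. y $ i * y $ j)"
    by (rule Bochner_Integration.integrable_bound[OF integrable_gauss_norm_sq[OF \<sigma>]]) (use bd in auto)
  show "(\<integral>(y::real^'d). y $ i * y $ j \<partial>gauss \<sigma>) = (if i = j then \<sigma>\<^sup>2 else 0)"
  proof (cases "i = j")
    case True
    have m2: "has_bochner_integral lborel (\<lambda>x. normal_density 0 \<sigma> x * x\<^sup>2) (\<sigma>\<^sup>2)"
      using normal_moment_even[OF \<sigma>, of 0 1] by (simp add: fact_numeral)
    have "(\<integral>\<^sup>+(y::real^'d). ennreal (y $ i * y $ j) \<partial>gauss \<sigma>)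
        = (\<integral>\<^sup>+(y::real^'d). ennreal (\<Prod>k\<in>UNIV. (if k = i then (y $ k)\<^sup>2 else 1)) \<partial>gauss \<sigma>)"
      by (intro nn_integral_cong) (simp add: True power2_eq_square)
    also have "\<dots> = (\<Prod>k\<in>UNIV. (\<integral>\<^sup>+x. ennreal (normal_density 0 \<sigma> x * (if k = i then x\<^sup>2 else 1)) \<partial>lborel))"
      by (rule nn_integral_gauss_prod[of "\<lambda>k x. if k = i then x\<^sup>2 else 1", OF _ _ \<sigma>]) auto
    also have "\<dots> = (\<Prod>k\<in>UNIV. if k = i then ennreal (\<sigma>\<^sup>2) else 1)"
    proof (rule prod.cong)
      fix k :: 'd
      show "(\<integral>\<^sup>+x. ennreal (normal_density 0 \<sigma> x * (if k = i then x\<^sup>2 else 1)) \<partial>lborel) = (if k = i then ennreal (\<sigma>\<^sup>2) else 1)"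
        using has_bochner_integral_iff[THEN iffD1, OF m2] nn_integral_normal_density[OF \<sigma>]
        by (simp add: nn_integral_eq_integral)
    qed simp
    also have "\<dots> = ennreal (\<sigma>\<^sup>2)" by simp
    finally have "(\<integral>\<^sup>+(y::real^'d). ennreal (y $ i * y $ j) \<partial>gauss \<sigma>) = ennreal (\<sigma>\<^sup>2)" .
    then show ?thesis using True by (simp add: integral_eq_nn_integral)
  next
    case False
    \<comment> \<open>Reflecting coordinate i alone preserves the law and reverses the sign of the
      integrand, so the integral equals its own negative.\<close>
    let ?c = "\<lambda>k. if k = i then - 1 else 1 :: real"
    have "(\<integral>(y::real^'d). y $ i * y $ j \<partial>gauss \<sigma>) = (\<integral>(y::real^'d). y $ i * y $ j \<partial>distr (gauss \<sigma>) borel (\<lambda>x. \<chi> k. ?c k * x $ k))"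
      by (subst distr_gauss_flip) auto
    also have "\<dots> = (\<integral>(y::real^'d). (?c i * y $ i) * (?c j * y $ j) \<partial>gauss \<sigma>)"
    proof (subst integral_distr)
      show "(\<lambda>x::real^'d. \<chi> k. ?c k * x $ k) \<in> gauss \<sigma> \<rightarrow>\<^sub>M borel"
        unfolding measurable_cong_sets[OF sets_gauss refl]
        by (intro borel_measurable_continuous_onI continuous_intros)
    qed auto
    also have "\<dots> = - (\<integral>(y::real^'d). y $ i * y $ j \<partial>gauss \<sigma>)" using False by simp
    finally show ?thesis using False by simp
  qed
qed

lemma gauss_inner_sq:
  fixes c :: "real^'d"
  assumes \<sigma>: "\<sigma> > 0"
  shows "has_bochner_integral (gauss \<sigma>) (\<lambda>y. (c \<bullet> y)\<^sup>2) (\<sigma>\<^sup>2 * (norm c)\<^sup>2)"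
proof -
  have eq: "(c \<bullet> y)\<^sup>2 = (\<Sum>i\<in>UNIV. \<Sum>j\<in>UNIV. c $ i * c $ j * (y $ i * y $ j))" for y
    by (simp add: inner_vec_def power2_eq_square sum_product ac_simps)
  have "has_bochner_integral (gauss \<sigma>) (\<lambda>y. \<Sum>i\<in>UNIV. \<Sum>j\<in>UNIV. c $ i * c $ j * (y $ i * y $ j))
     (\<Sum>i\<in>UNIV. \<Sum>j\<in>UNIV. c $ i * c $ j * (if i = j then \<sigma>\<^sup>2 else 0))"
    by (intro has_bochner_integral_sum has_bochner_integral_mult_right)
      (simp add: has_bochner_integral_iff gauss_covariance[OF \<sigma>])
  also have "(\<Sum>i\<in>UNIV. \<Sum>j\<in>UNIV. c $ i * c $ j * (if i = j then \<sigma>\<^sup>2 else 0)) = \<sigma>\<^sup>2 * (norm c)\<^sup>2"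
    by (simp add: power2_norm_eq_inner inner_vec_def sum_distrib_left if_distrib ac_simps cong: if_cong)
  finally show ?thesis unfolding eq .
qed

lemma norm_vec_sq: "(norm (x :: 'a::real_normed_vector^'n))\<^sup>2 = (\<Sum>i\<in>UNIV. (norm (x $ i))\<^sup>2)"
  by (simp add: norm_vec_def L2_set_def sum_nonneg)

lemma matrix_vector_mult_inner: "((A :: real^'d^'n) *v y) $ i = A $ i \<bullet> y"
  by (simp add: matrix_vector_mult_def inner_vec_def)

text \<open>The norm of the type \<open>real^'d^'n\<close> is the Euclidean norm of the vector of
  row norms, hence the trace norm of the matrix, and the identity follows by summing over
  rows.\<close>

lemma gauss_matrix_sq:
  fixes A :: "real^'d^'n"
  assumes \<sigma>: "\<sigma> > 0"
  shows "has_bochner_integral (gauss \<sigma>) (\<lambda>y. (norm (A *v y))\<^sup>2) (\<sigma>\<^sup>2 * (norm A)\<^sup>2)"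
proof -
  have "has_bochner_integral (gauss \<sigma>) (\<lambda>y. \<Sum>i\<in>UNIV. (A $ i \<bullet> y)\<^sup>2) (\<Sum>i\<in>UNIV. \<sigma>\<^sup>2 * (norm (A $ i))\<^sup>2)"
    by (intro has_bochner_integral_sum gauss_inner_sq[OF \<sigma>])
  then show ?thesis by (simp add: norm_vec_sq matrix_vector_mult_inner sum_distrib_left)
qed

lemma norm_matrix_vector_mult_le: "norm ((A :: real^'d^'n) *v y) \<le> norm A * norm y"
proof (rule power2_le_imp_le)
  have "(norm (A *v y))\<^sup>2 = (\<Sum>i\<in>UNIV. \<bar>A $ i \<bullet> y\<bar>\<^sup>2)" by (simp add: norm_vec_sq matrix_vector_mult_inner)
  also have "\<dots> \<le> (\<Sum>i\<in>UNIV. (norm (A $ i) * norm y)\<^sup>2)"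
    by (intro sum_mono power_mono Cauchy_Schwarz_ineq2) auto
  also have "\<dots> = (norm A * norm y)\<^sup>2" by (simp add: norm_vec_sq[of A] power_mult_distrib sum_distrib_right)
  finally show "(norm (A *v y))\<^sup>2 \<le> (norm A * norm y)\<^sup>2" .
qed auto

lemma gauss_inner_matrix_sq:
  fixes A :: "real^'d^'n" and x :: "real^'n"
  assumes \<sigma>: "\<sigma> > 0"
  obtains s where "has_bochner_integral (gauss \<sigma>) (\<lambda>y. (x \<bullet> (A *v y))\<^sup>2) s" "s \<le> \<sigma>\<^sup>2 * ((norm x)\<^sup>2 * (norm A)\<^sup>2)"
proof -
  have "x \<bullet> (A *v y) = (x v* A) \<bullet> y" for y by (simp add: dot_lmul_matrix)
  then have "has_bochner_integral (gauss \<sigma>) (\<lambda>y. (x \<bullet> (A *v y))\<^sup>2) (\<sigma>\<^sup>2 * (norm (x v* A))\<^sup>2)"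
    using gauss_inner_sq[OF \<sigma>] by simp
  moreover have "norm (x v* A) \<le> norm x * norm A"
  proof (cases "x v* A = 0")
    case False
    have "norm (x v* A) * norm (x v* A) = x \<bullet> (A *v (x v* A))"
      by (simp add: dot_lmul_matrix[symmetric] power2_norm_eq_inner[symmetric] power2_eq_square)
    also have "\<dots> \<le> norm x * norm (A *v (x v* A))" by (rule norm_cauchy_schwarz)
    also have "\<dots> \<le> norm x * (norm A * norm (x v* A))" by (intro mult_left_mono norm_matrix_vector_mult_le) auto
    finally show ?thesis using False by (simp add: mult.assoc[symmetric])
  qed simp
  then have "(norm (x v* A))\<^sup>2 \<le> (norm x)\<^sup>2 * (norm A)\<^sup>2"
    unfolding power_mult_distrib[symmetric] by (intro power_mono) auto
  ultimately show ?thesis using that \<sigma> by (metis mult_left_mono zero_le_power2)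
qed

section \<open>One Gaussian step\<close>

text \<open>The bracket has the shape of the generator applied to the power q of 1 + |x|^2: the mean
  of |G y|^2 contributes |G|^2, and the mean of the squared inner product of x and G y contributes
  at most (2 q - 2) |G|^2. With p = 2 q the total 2 q - 1 is the coefficient p - 1 of the
  dissipativity condition. \<open>P\<close> measures the delay window, and \<open>W\<close> will be
  the kernel average of powers of order 2 + \<open>vrho\<close>.\<close>

lemma gauss_step_bound:
  fixes q \<kappa> :: real
  assumes q: "q \<ge> 1" and \<kappa>: "\<kappa> \<ge> 1"
  obtains C1 C2 where "C1 \<ge> 0" "C2 \<ge> 0" "q = 1 \<Longrightarrow> C2 = 0"
    "\<And>\<Delta> lam (x::real^'n) a (G::real^'d^'n) P W. 0 < \<Delta> \<Longrightarrow> \<Delta> \<le> 1 \<Longrightarrow> lam \<le> 1/2 \<Longrightarrow>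
      1 + (norm x)\<^sup>2 \<le> P \<Longrightarrow> 0 \<le> W \<Longrightarrow> norm a \<le> \<kappa> * (\<Delta> powr (-lam) * sqrt P) \<Longrightarrow>
      (norm G)\<^sup>2 \<le> \<kappa> * (\<Delta> powr (-lam) * P) \<Longrightarrow>
      (norm G)\<^sup>2 \<le> \<kappa> * (\<Delta> powr (-lam) * (sqrt (1 + (norm x)\<^sup>2) * sqrt P) + (P + W)) \<Longrightarrow>
      (\<integral>\<^sup>+y. ennreal ((1 + (norm (x + \<Delta> *\<^sub>R a + G *v y))\<^sup>2) powr q) \<partial>gauss (sqrt \<Delta>))
      \<le> ennreal ((1 + (norm x)\<^sup>2) powr q
          + q * \<Delta> * (1 + (norm x)\<^sup>2) powr (q - 1) * (2 * (x \<bullet> a) + (2 * q - 1) * (norm G)\<^sup>2)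
          + \<Delta> * (C1 * P powr q + C2 * \<Delta> powr ((q - 1) / 2) * (W * P powr (q - 1))))"
proof -
  obtain C where C: "C \<ge> 0" "q = 1 \<Longrightarrow> C = 0"
    and expansion: "\<And>x a e :: real^'n.
      ((1 + (norm (x + a + e))\<^sup>2) powr q + (1 + (norm (x + a - e))\<^sup>2) powr q) / 2
      \<le> (1 + (norm x)\<^sup>2) powr q
         + q * (1 + (norm x)\<^sup>2) powr (q - 1) * (2 * (x \<bullet> a) + (norm a)\<^sup>2 + (norm e)\<^sup>2)
         + q * (q - 1) / 2 * (1 + (norm x)\<^sup>2) powr (q - 2) * (2 * (x \<bullet> e))\<^sup>2
         + C * ((1 + (norm x)\<^sup>2) powr q
             * remainder_fun q ((2 * norm x * norm a + (norm a)\<^sup>2 + (norm e)\<^sup>2) / (1 + (norm x)\<^sup>2)))"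
    using symmetric_norm_powr_expansion[OF q, where 'v="real^'n"] by blast
  obtain C' where C': "C' \<ge> 0"
    and remainder: "\<And>\<Delta> S z P W \<alpha> \<gamma> n X e2. 0 < \<Delta> \<Longrightarrow> \<Delta> \<le> 1 \<Longrightarrow> 0 < S \<Longrightarrow> S\<^sup>2 \<le> \<Delta> \<Longrightarrow> 1 \<le> z \<Longrightarrow> z \<le> P \<Longrightarrow> 0 \<le> W \<Longrightarrow>
      1 \<le> n \<Longrightarrow> 0 \<le> X \<Longrightarrow> X\<^sup>2 \<le> z \<Longrightarrow> 0 \<le> \<alpha> \<Longrightarrow> \<alpha> \<le> \<kappa> * (S * sqrt P) \<Longrightarrow> 0 \<le> \<gamma> \<Longrightarrow> \<gamma> \<le> \<kappa> * (S * P) \<Longrightarrow>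
      \<gamma> \<le> \<kappa> * (S * (sqrt z * sqrt P) + \<Delta> * (P + W)) \<Longrightarrow> 0 \<le> e2 \<Longrightarrow> e2 \<le> \<gamma> * n \<Longrightarrow>
      z powr q * remainder_fun q ((2 * X * \<alpha> + \<alpha>\<^sup>2 + e2) / z)
        \<le> C' * (\<Delta> * (P powr q + \<Delta> powr ((q - 1) / 2) * (W * P powr (q - 1)))) * n powr (max 2 q)"
    using remainder_bound[OF q \<kappa>] by blast
  define m where "m = (\<integral>(y::real^'d). (1 + (norm y)\<^sup>2) powr max 2 q \<partial>gauss 1)"
  have m: "m \<ge> 0" by (simp add: m_def)
  \<comment> \<open>Only the scale-free moment \<open>m\<close> enters, so neither constant depends
    on \<Delta>. The additional \<open>q * \<kappa>\<^sup>2\<close> in \<open>C1\<close> pays for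
    the squared drift increment.\<close>
  define C2 where "C2 = C * C' * m"
  define C1 where "C1 = C2 + q * \<kappa>\<^sup>2"
  have C2: "C2 \<ge> 0" using C C' m by (simp add: C2_def)
  show ?thesis
  proof (rule that[of C1 C2])
    show "C1 \<ge> 0" "C2 \<ge> 0" "q = 1 \<Longrightarrow> C2 = 0" using C2 C q by (auto simp: C1_def C2_def)
    fix \<Delta> lam P W :: real and x a :: "real^'n" and G :: "real^'d^'n"
    assume \<Delta>: "0 < \<Delta>" "\<Delta> \<le> 1" and lam: "lam \<le> 1/2" and P: "1 + (norm x)\<^sup>2 \<le> P" and W: "0 \<le> W"
      and a: "norm a \<le> \<kappa> * (\<Delta> powr (-lam) * sqrt P)" and G1: "(norm G)\<^sup>2 \<le> \<kappa> * (\<Delta> powr (-lam) * P)"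
      and G2: "(norm G)\<^sup>2 \<le> \<kappa> * (\<Delta> powr (-lam) * (sqrt (1 + (norm x)\<^sup>2) * sqrt P) + (P + W))"
    define z where "z = 1 + (norm x)\<^sup>2"
    define S where "S = \<Delta> powr (1 - lam)"
    define E where "E = \<Delta> * (P powr q + \<Delta> powr ((q - 1) / 2) * (W * P powr (q - 1)))"
    \<comment> \<open>This normalisation gives both n y >= 1 and |y|^2 <= \<Delta> n y, so the
      random size of the increment separates from its scale.\<close>
    define n where "n y = 1 + (norm y)\<^sup>2 / (sqrt \<Delta>)\<^sup>2" for y :: "real^'d"
    have z: "z \<ge> 1" "z \<le> P" using P by (auto simp: z_def)
    have \<sigma>: "sqrt \<Delta> > 0" using \<Delta> by simp
    have S: "S > 0" using \<Delta> by (simp add: S_def)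
    \<comment> \<open>The restriction on the truncation exponent enters here: the exponent 2 (1 -
      lam) is at least 1 and \<Delta> <= 1.\<close>
    have S2: "S\<^sup>2 \<le> \<Delta>"
    proof -
      have "S\<^sup>2 = \<Delta> powr (2 * (1 - lam))" using \<Delta> by (simp add: S_def powr_power)
      also have "\<dots> \<le> \<Delta> powr 1" using \<Delta> lam by (intro powr_mono') auto
      finally show ?thesis using \<Delta> by simp
    qed
    have \<Delta>S: "\<Delta> * (\<Delta> powr (-lam) * t) = S * t" for t
      using \<Delta> by (simp add: S_def powr_diff powr_minus field_simps)
    have da: "\<Delta> * norm a \<le> \<kappa> * (S * sqrt P)"
      using mult_left_mono[OF a, of \<Delta>] \<Delta> by (simp add: mult.left_commute[of \<Delta> \<kappa>] \<Delta>S)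
    have dG1: "\<Delta> * (norm G)\<^sup>2 \<le> \<kappa> * (S * P)"
      using mult_left_mono[OF G1, of \<Delta>] \<Delta> by (simp add: mult.left_commute[of \<Delta> \<kappa>] \<Delta>S)
    have dG2: "\<Delta> * (norm G)\<^sup>2 \<le> \<kappa> * (S * (sqrt z * sqrt P) + \<Delta> * (P + W))"
      using mult_left_mono[OF G2, of \<Delta>] \<Delta> unfolding z_def[symmetric] mult.left_commute[of \<Delta> \<kappa>]
        distrib_left[of \<Delta> "\<Delta> powr (-lam) * _"] \<Delta>S by simp
    define R where "R y = z powr q + q * z powr (q - 1) * (2 * \<Delta> * (x \<bullet> a) + \<Delta>\<^sup>2 * (norm a)\<^sup>2 + (norm (G *v y))\<^sup>2)
       + q * (q - 1) / 2 * z powr (q - 2) * (4 * (x \<bullet> (G *v y))\<^sup>2) + C * (C' * E * n y powr max 2 q)" for y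
    let ?F = "\<lambda>y. (1 + (norm (x + \<Delta> *\<^sub>R a + G *v y))\<^sup>2) powr q"
    have [measurable]: "(\<lambda>y. G *v y) \<in> borel_measurable borel"
      by (intro borel_measurable_continuous_onI matrix_vector_mult_linear_continuous_on)
    have Fm[measurable]: "?F \<in> borel_measurable borel" by measurable
    have pointwise: "(?F y + ?F (- y)) / 2 \<le> R y" for y
    proof -
      have n: "n y \<ge> 1" using \<Delta> by (simp add: n_def)
      have "norm (G *v y) \<le> norm G * norm y" by (rule norm_matrix_vector_mult_le)
      then have "(norm (G *v y))\<^sup>2 \<le> (norm G)\<^sup>2 * (norm y)\<^sup>2"
        unfolding power_mult_distrib[symmetric] by (intro power_mono) auto
      also have "\<dots> \<le> (norm G)\<^sup>2 * (\<Delta> * n y)" using \<Delta> by (intro mult_left_mono) (auto simp: n_def field_simps)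
      finally have Gy: "(norm (G *v y))\<^sup>2 \<le> \<Delta> * (norm G)\<^sup>2 * n y" by (simp add: ac_simps)
      have "z powr q * remainder_fun q ((2 * norm x * (\<Delta> * norm a) + (\<Delta> * norm a)\<^sup>2 + (norm (G *v y))\<^sup>2) / z)
          \<le> C' * E * n y powr max 2 q"
        unfolding E_def
        by (rule remainder[OF \<Delta> S S2 z W n _ _ _ da _ dG1 dG2 _ Gy]) (use \<Delta> in \<open>auto simp: z_def\<close>)
      then have r1: "C * (z powr q * remainder_fun q ((2 * norm x * norm (\<Delta> *\<^sub>R a) + (norm (\<Delta> *\<^sub>R a))\<^sup>2 + (norm (G *v y))\<^sup>2) / z))
          \<le> C * (C' * E * n y powr max 2 q)" using C \<Delta> by (intro mult_left_mono) auto
      have e2: "q * z powr (q - 1) * (2 * (x \<bullet> (\<Delta> *\<^sub>R a)) + (norm (\<Delta> *\<^sub>R a))\<^sup>2 + (norm (G *v y))\<^sup>2)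
          = q * z powr (q - 1) * (2 * \<Delta> * (x \<bullet> a) + \<Delta>\<^sup>2 * (norm a)\<^sup>2 + (norm (G *v y))\<^sup>2)"
        by (simp add: power_mult_distrib)
      have e3: "(2 * (x \<bullet> (G *v y)))\<^sup>2 = 4 * (x \<bullet> (G *v y))\<^sup>2" by (simp add: power_mult_distrib)
      have e4: "x + \<Delta> *\<^sub>R a + G *v (- y) = x + \<Delta> *\<^sub>R a - G *v y"
        by (simp add: linear_neg[OF matrix_vector_mul_linear])
      show ?thesis
        using expansion[of x "\<Delta> *\<^sub>R a" "G *v y"] r1 unfolding R_def z_def[symmetric] e2 e3 e4 by linarith
    qed
    obtain s where s: "has_bochner_integral (gauss (sqrt \<Delta>)) (\<lambda>y. (x \<bullet> (G *v y))\<^sup>2) s"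
      "s \<le> (sqrt \<Delta>)\<^sup>2 * ((norm x)\<^sup>2 * (norm G)\<^sup>2)"
      using gauss_inner_matrix_sq[OF \<sigma>] by blast
    interpret prob_space "gauss (sqrt \<Delta>) :: (real^'d) measure" using prob_space_gauss[OF \<sigma>] .
    have const: "has_bochner_integral (gauss (sqrt \<Delta>) :: (real^'d) measure) (\<lambda>_. c) c" for c :: real
      using prob_space by (simp add: has_bochner_integral_iff)
    have R_int: "has_bochner_integral (gauss (sqrt \<Delta>)) R
      (z powr q + q * z powr (q - 1) * (2 * \<Delta> * (x \<bullet> a) + \<Delta>\<^sup>2 * (norm a)\<^sup>2 + (sqrt \<Delta>)\<^sup>2 * (norm G)\<^sup>2)
       + q * (q - 1) / 2 * z powr (q - 2) * (4 * s) + C * (C' * E * m))" (is "has_bochner_integral _ _ ?I")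
      unfolding R_def
    proof (intro has_bochner_integral_add has_bochner_integral_mult_right const s gauss_matrix_sq \<sigma>)
      show "has_bochner_integral (gauss (sqrt \<Delta>)) (\<lambda>y. n y powr max 2 q) m"
        using integrable_gauss_powr[OF \<sigma>, of "max 2 q", where 'd='d] by (simp add: has_bochner_integral_iff n_def m_def)
    qed
    \<comment> \<open>Invariance of the Gaussian law under y -> -y supplies the second copy of the
      integral. The identity is stated for twice the integral, so that the pointwise bound can be
      integrated before the factor 2 is cancelled.\<close>
    have "2 * (\<integral>\<^sup>+y. ennreal (?F y) \<partial>gauss (sqrt \<Delta>)) = (\<integral>\<^sup>+y. ennreal (?F y) \<partial>gauss (sqrt \<Delta>)) + (\<integral>\<^sup>+y. ennreal (?F (- y)) \<partial>gauss (sqrt \<Delta>))"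
    proof -
      have "(\<integral>\<^sup>+y. ennreal (?F y) \<partial>gauss (sqrt \<Delta>)) = (\<integral>\<^sup>+y. ennreal (?F y) \<partial>distr (gauss (sqrt \<Delta>)) borel uminus)"
        by (simp only: distr_gauss_uminus)
      also have "\<dots> = (\<integral>\<^sup>+y. ennreal (?F (- y)) \<partial>gauss (sqrt \<Delta>))" by (subst nn_integral_distr) auto
      finally show ?thesis by (simp only: mult_2)
    qed
    also have "\<dots> = (\<integral>\<^sup>+y. ennreal (?F y) + ennreal (?F (- y)) \<partial>gauss (sqrt \<Delta>))"
      by (rule nn_integral_add[symmetric]) measurable
    also have "\<dots> \<le> (\<integral>\<^sup>+y. ennreal (2 * R y) \<partial>gauss (sqrt \<Delta>))"
    proof (rule nn_integral_mono)
      fix y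
      have "?F y + ?F (- y) \<le> 2 * R y" using pointwise[of y] by simp
      then show "ennreal (?F y) + ennreal (?F (- y)) \<le> ennreal (2 * R y)"
        by (simp add: ennreal_plus[symmetric] ennreal_leI del: ennreal_plus)
    qed
    also have "\<dots> = ennreal (2 * ?I)"
    proof -
      have "0 \<le> 2 * R y" for y using pointwise[of y] by (smt (verit) powr_ge_zero divide_nonneg_nonneg)
      moreover have "has_bochner_integral (gauss (sqrt \<Delta>)) (\<lambda>y. 2 * R y) (2 * ?I)"
        by (rule has_bochner_integral_mult_right[OF R_int])
      ultimately show ?thesis by (subst nn_integral_eq_integral) (auto simp: has_bochner_integral_iff)
    qed
    also have "\<dots> = 2 * ennreal ?I" by (simp only: ennreal_mult'[OF zero_le_numeral] ennreal_numeral)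
    finally have main: "(\<integral>\<^sup>+y. ennreal (?F y) \<partial>gauss (sqrt \<Delta>)) \<le> ennreal ?I"
      by (subst (asm) ennreal_mult_le_mult_iff) auto
    have I: "?I \<le> z powr q + q * \<Delta> * z powr (q - 1) * (2 * (x \<bullet> a) + (2 * q - 1) * (norm G)\<^sup>2)
          + \<Delta> * (C1 * P powr q + C2 * \<Delta> powr ((q - 1) / 2) * (W * P powr (q - 1)))"
    proof -
      have 1: "q * (q - 1) / 2 * z powr (q - 2) * (4 * s) \<le> q * \<Delta> * z powr (q - 1) * ((2 * q - 2) * (norm G)\<^sup>2)"
      proof -
        have "s \<le> \<Delta> * (z * (norm G)\<^sup>2)"
          using s(2) \<Delta> by (elim order_trans) (auto intro!: mult_left_mono mult_right_mono simp: z_def)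
        then have "q * (q - 1) / 2 * z powr (q - 2) * (4 * s) \<le> q * (q - 1) / 2 * z powr (q - 2) * (4 * (\<Delta> * (z * (norm G)\<^sup>2)))"
          using q by (intro mult_left_mono) auto
        also have "\<dots> = q * \<Delta> * (z powr (q - 2) * z) * ((2 * q - 2) * (norm G)\<^sup>2)" by (simp add: field_simps)
        also have "z powr (q - 2) * z = z powr (q - 1)"
          using powr_eq_mult_powr_diff[of z "q - 1"] z by (simp add: mult.commute)
        finally show ?thesis .
      qed
      have 2: "q * z powr (q - 1) * (\<Delta>\<^sup>2 * (norm a)\<^sup>2) \<le> \<Delta> * (q * \<kappa>\<^sup>2 * P powr q)"
      proof -
        have "\<Delta>\<^sup>2 * (norm a)\<^sup>2 \<le> (\<kappa> * (S * sqrt P))\<^sup>2"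
          unfolding power_mult_distrib[of \<Delta>, symmetric] using da \<Delta> by (intro power_mono) auto
        also have "\<dots> = \<kappa>\<^sup>2 * (S\<^sup>2 * P)" using z by (simp add: power_mult_distrib)
        also have "\<dots> \<le> \<kappa>\<^sup>2 * (\<Delta> * P)" using S2 z by (intro mult_left_mono mult_right_mono) auto
        finally have *: "\<Delta>\<^sup>2 * (norm a)\<^sup>2 \<le> \<kappa>\<^sup>2 * (\<Delta> * P)" .
        have "q * z powr (q - 1) \<le> q * P powr (q - 1)" using q z by (intro mult_left_mono powr_mono2) auto
        from mult_mono[OF this *] have "q * z powr (q - 1) * (\<Delta>\<^sup>2 * (norm a)\<^sup>2) \<le> q * P powr (q - 1) * (\<kappa>\<^sup>2 * (\<Delta> * P))"
          using q by simp
        also have "\<dots> = \<Delta> * (q * \<kappa>\<^sup>2 * (P * P powr (q - 1)))" by simp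
        also have "P * P powr (q - 1) = P powr q" using z by (intro powr_eq_mult_powr_diff) auto
        finally show ?thesis .
      qed
      have 3: "C * (C' * E * m) = \<Delta> * (C2 * P powr q + C2 * \<Delta> powr ((q - 1) / 2) * (W * P powr (q - 1)))"
        by (simp add: C2_def E_def algebra_simps)
      have 4: "q * z powr (q - 1) * (2 * \<Delta> * (x \<bullet> a) + \<Delta>\<^sup>2 * (norm a)\<^sup>2 + (sqrt \<Delta>)\<^sup>2 * (norm G)\<^sup>2)
         = q * \<Delta> * z powr (q - 1) * (2 * (x \<bullet> a) + (norm G)\<^sup>2) + q * z powr (q - 1) * (\<Delta>\<^sup>2 * (norm a)\<^sup>2)"
        using \<Delta> by (simp add: algebra_simps)
      have 5: "q * \<Delta> * z powr (q - 1) * (2 * (x \<bullet> a) + (2 * q - 1) * (norm G)\<^sup>2)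
         = q * \<Delta> * z powr (q - 1) * (2 * (x \<bullet> a) + (norm G)\<^sup>2) + q * \<Delta> * z powr (q - 1) * ((2 * q - 2) * (norm G)\<^sup>2)"
        by (simp add: algebra_simps)
      have 6: "\<Delta> * (C1 * P powr q + C2 * \<Delta> powr ((q - 1) / 2) * (W * P powr (q - 1)))
         = \<Delta> * (C2 * P powr q + C2 * \<Delta> powr ((q - 1) / 2) * (W * P powr (q - 1))) + \<Delta> * (q * \<kappa>\<^sup>2 * P powr q)"
        by (simp add: C1_def algebra_simps)
      show ?thesis unfolding 3 4 5 6 using 1 2 by linarith
    qed
    show "(\<integral>\<^sup>+y. ennreal (?F y) \<partial>gauss (sqrt \<Delta>))
      \<le> ennreal ((1 + (norm x)\<^sup>2) powr q
          + q * \<Delta> * (1 + (norm x)\<^sup>2) powr (q - 1) * (2 * (x \<bullet> a) + (2 * q - 1) * (norm G)\<^sup>2)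
          + \<Delta> * (C1 * P powr q + C2 * \<Delta> powr ((q - 1) / 2) * (W * P powr (q - 1))))"
      unfolding z_def[symmetric] by (rule order_trans[OF main ennreal_leI[OF I]])
  qed
qed

section \<open>Dissipativity\<close>

text \<open>Lower powers are absorbed into an arbitrarily small multiple of a higher one: beyond the
  threshold \<open>Z\<close> the factor \<open>\<epsilon> * z powr (m - r)\<close> is at least 1,
  and below it the constant takes over.\<close>

lemma powr_le_eps_powr:
  fixes r m \<epsilon> :: real
  assumes "0 \<le> r" "r < m" "\<epsilon> > 0"
  obtains K where "K \<ge> 0" "\<And>z. z \<ge> 1 \<Longrightarrow> z powr r \<le> \<epsilon> * z powr m + K"
proof (rule that)
  define Z where "Z = (1 / \<epsilon>) powr (1 / (m - r))"
  show "0 \<le> Z powr r" by simp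
  fix z :: real assume z: "z \<ge> 1"
  show "z powr r \<le> \<epsilon> * z powr m + Z powr r"
  proof (cases "z \<le> Z")
    case True
    then have "z powr r \<le> Z powr r" using assms z by (intro powr_mono2) auto
    moreover have "0 \<le> \<epsilon> * z powr m" using assms by simp
    ultimately show ?thesis by linarith
  next
    case False
    have "1 / \<epsilon> = Z powr (m - r)" using assms by (simp add: Z_def powr_powr)
    also have "\<dots> \<le> z powr (m - r)" using False assms by (intro powr_mono2) (auto simp: Z_def)
    finally have "1 \<le> \<epsilon> * z powr (m - r)" using assms by (simp add: field_simps)
    then have "z powr r * 1 \<le> z powr r * (\<epsilon> * z powr (m - r))" by (intro mult_left_mono) auto
    also have "\<dots> = \<epsilon> * z powr m" by (simp add: powr_add[symmetric] mult.left_commute)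
    finally show ?thesis using powr_ge_zero[of Z r] by linarith
  qed
qed

text \<open>The dissipativity condition controls a power of |x|^2 = z - 1, whereas the recursion
  runs in powers of z. By the mean value theorem the exchange costs a term of order one
  lower.\<close>

lemma powr_diff_one_ge:
  fixes s z :: real
  assumes "s \<ge> 1" "z \<ge> 1"
  shows "z powr s - s * z powr (s - 1) \<le> (z - 1) powr s"
proof (cases "z = 1")
  case False
  then have z: "z > 1" using assms by simp
  have "\<exists>t. z - 1 < t \<and> t < z \<and> z powr s - (z - 1) powr s = (z - (z - 1)) * (s * t powr (s - 1))"
    using z by (intro MVT2) (auto intro!: derivative_eq_intros)
  then obtain t where t: "z - 1 < t" "t < z" "z powr s - (z - 1) powr s = s * t powr (s - 1)" by auto
  then have "s * t powr (s - 1) \<le> s * z powr (s - 1)" using assms z by (intro mult_left_mono powr_mono2) auto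
  then show ?thesis using t by linarith
qed (use assms in auto)

text \<open>Young's inequality in homogeneous form. Its two coefficients add up to 1, so the
  \<open>a3\<close>-term, distributed over present and past, keeps the total weight that is compared
  with \<open>a2\<close>.\<close>

lemma powr_mult_powr_le_weighted:
  fixes x y \<alpha> \<beta> :: real
  assumes "x > 0" "y > 0" "\<alpha> \<ge> 0" "\<beta> \<ge> 0" "\<alpha> + \<beta> > 0"
  shows "x powr \<alpha> * y powr \<beta> \<le> \<alpha> / (\<alpha> + \<beta>) * x powr (\<alpha> + \<beta>) + \<beta> / (\<alpha> + \<beta>) * y powr (\<alpha> + \<beta>)"
  using Youngs_inequality_0[of "\<alpha> / (\<alpha> + \<beta>)" "\<beta> / (\<alpha> + \<beta>)" "x powr (\<alpha> + \<beta>)" "y powr (\<alpha> + \<beta>)"] assms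
  by (simp add: powr_powr add_divide_distrib[symmetric])

lemma powr_weighted_sum_le:
  fixes w x :: "'a \<Rightarrow> real"
  assumes "finite I" "\<And>i. 0 \<le> w i" "sum w I = 1" "\<And>i. 0 < x i" "r \<ge> 1"
  shows "(\<Sum>i\<in>I. w i * x i) powr r \<le> (\<Sum>i\<in>I. w i * x i powr r)"
proof -
  have "I \<noteq> {}" using assms by auto
  then show ?thesis
    using convex_on_sum[of I "{0<..}" "\<lambda>x. x powr r" w x] powr_convex[OF assms(5)] assms by auto
qed

text \<open>The delay kernels enter only through the weights \<open>w\<close> (for \<open>\<rho>1\<close>) and \<open>w'\<close> (for the uniform average).
  Young's inequality with its sharp constants is needed for the \<open>a3\<close>-term alone: every other
  contribution is of lower order in \<open>zs\<close>, or carries the small factor \<open>\<Delta> powr ((q - 1) / 2)\<close>.\<close>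

lemma dissipative_step:
  fixes q s a1 a2 a3 C1 C2 :: real
  assumes q: "q \<ge> 1" and s: "s > 1" and a: "a1 > 0" "a2 > 0" "a3 > 0" "a2 > a3"
    and C: "C1 \<ge> 0" "C2 \<ge> 0" "q = 1 \<Longrightarrow> C2 = 0"
  obtains \<Delta>0 K \<alpha> \<beta>1 \<beta>2 where "\<Delta>0 > 0" "K \<ge> 0" "\<beta>1 \<ge> 0" "\<beta>2 \<ge> 0" "\<beta>1 + \<beta>2 < \<alpha>"
    "\<And>\<Delta> N w w' zs X D. 0 < \<Delta> \<Longrightarrow> \<Delta> \<le> \<Delta>0 \<Longrightarrow> (\<And>i. 0 \<le> w i) \<Longrightarrow> (\<And>i. 0 \<le> w' i) \<Longrightarrow>
      (\<Sum>i\<le>N::nat. w i) = 1 \<Longrightarrow> (\<Sum>i\<le>N. w' i) = 1 \<Longrightarrow> (\<And>i. 1 \<le> zs i) \<Longrightarrow> 0 \<le> X \<Longrightarrow> zs 0 = 1 + X\<^sup>2 \<Longrightarrow>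
      D \<le> a1 * (zs 0 + (\<Sum>i\<le>N. w' i * zs i)) - a2 * X powr (2 * s) + a3 * (\<Sum>i\<le>N. w i * zs i powr s) \<Longrightarrow>
      zs 0 powr q + q * \<Delta> * zs 0 powr (q - 1) * D
        + \<Delta> * (C1 * (zs 0 + (\<Sum>i\<le>N. w' i * zs i)) powr q
           + C2 * \<Delta> powr ((q - 1) / 2) * ((\<Sum>i\<le>N. w i * zs i powr s) * (zs 0 + (\<Sum>i\<le>N. w' i * zs i)) powr (q - 1)))
      \<le> zs 0 powr q + \<Delta> * (K - \<alpha> * zs 0 powr (q + s - 1) + (\<Sum>i\<le>N. (\<beta>1 * w i + \<beta>2 * w' i) * zs i powr (q + s - 1)))"
proof -
  define m where "m = q + s - 1"
  \<comment> \<open>An eighth of the gap: \<open>\<alpha>\<close> gives up 3 \<epsilon>,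
    \<open>\<beta>1\<close> receives one and the second delay coefficient two, so 2 \<epsilon> of
    the gap 8 \<epsilon> remain.\<close>
  define \<epsilon> where "\<epsilon> = q * (a2 - a3) / 8"
  have \<epsilon>: "\<epsilon> > 0" using q a by (simp add: \<epsilon>_def)
  have m: "m > q" "m \<ge> s" "m > 1" "m > 0" using q s by (auto simp: m_def)
  obtain K1 where K1: "K1 \<ge> 0" "\<And>z. z \<ge> 1 \<Longrightarrow> z powr (m - 1) \<le> \<epsilon> / (q * a2 * s) * z powr m + K1"
    using powr_le_eps_powr[of "m - 1" m "\<epsilon> / (q * a2 * s)"] m \<epsilon> q a s by auto
  \<comment> \<open>The divisor \<open>2 powr m\<close> anticipates the cost of splitting
    \<open>P powr m\<close> into the contribution of the present value and that of the window
    average.\<close>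
  obtain K2 where K2: "K2 \<ge> 0" "\<And>z. z \<ge> 1 \<Longrightarrow> z powr q \<le> \<epsilon> / 2 powr m / (q * a1 + C1) * z powr m + K2"
    using powr_le_eps_powr[of q m "\<epsilon> / 2 powr m / (q * a1 + C1)"] m \<epsilon> q a C
    by (auto simp: add_pos_nonneg)
  have qa: "q * a1 + C1 > 0" "q * a2 * s > 0" using q a C s by (auto simp: add_pos_nonneg)
  define K where "K = q * a2 * s * K1 + (q * a1 + C1) * K2"
  define \<alpha> where "\<alpha> = q * a2 - q * a3 * ((q - 1) / m) - 3 * \<epsilon>"
  define \<beta>1 where "\<beta>1 = q * a3 * (s / m) + \<epsilon>"
  \<comment> \<open>Solves \<open>(C2 + 1) * \<Delta>0 powr ((q - 1) / 2) = \<epsilon> / 2 powr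
    m\<close>; adding 1 avoids division by zero. For q = 1 the term to be controlled is absent
    because C2 = 0.\<close>
  define \<Delta>0 where "\<Delta>0 = (if q = 1 then 1 else (\<epsilon> / 2 powr m / (C2 + 1)) powr (2 / (q - 1)))"
  have \<Delta>0: "\<Delta>0 > 0" using \<epsilon> C by (auto simp: \<Delta>0_def)
  show ?thesis
  proof (rule that[of \<Delta>0 K \<beta>1 "2 * \<epsilon>" \<alpha>])
    show "\<Delta>0 > 0" by (rule \<Delta>0)
    show "K \<ge> 0" using K1 K2 qa by (auto simp: K_def)
    show "\<beta>1 \<ge> 0" "2 * \<epsilon> \<ge> 0" using \<epsilon> q a s m by (auto simp: \<beta>1_def)
    have "q * a3 * ((q - 1) / m) + q * a3 * (s / m) = q * a3 * (((q - 1) + s) / m)"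
      by (simp only: distrib_left add_divide_distrib)
    also have "((q - 1) + s) / m = 1" using m by (simp add: m_def add.commute add_diff_eq)
    also have "q * a3 * 1 = q * a3" by simp
    finally have "\<alpha> - (\<beta>1 + 2 * \<epsilon>) = q * a2 - q * a3 - 6 * \<epsilon>" by (simp add: \<alpha>_def \<beta>1_def)
    moreover have "q * a2 - q * a3 = 8 * \<epsilon>" by (simp add: \<epsilon>_def algebra_simps)
    ultimately show "\<beta>1 + 2 * \<epsilon> < \<alpha>" using \<epsilon> by linarith
    fix \<Delta> X D :: real and N :: nat and w w' zs :: "nat \<Rightarrow> real"
    assume \<Delta>: "0 < \<Delta>" "\<Delta> \<le> \<Delta>0" and w: "\<And>i. 0 \<le> w i" "(\<Sum>i\<le>N. w i) = 1" and w': "\<And>i. 0 \<le> w' i" "(\<Sum>i\<le>N. w' i) = 1"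
      and zs: "\<And>i. 1 \<le> zs i" and X: "0 \<le> X" "zs 0 = 1 + X\<^sup>2"
      and D: "D \<le> a1 * (zs 0 + (\<Sum>i\<le>N. w' i * zs i)) - a2 * X powr (2 * s) + a3 * (\<Sum>i\<le>N. w i * zs i powr s)"
    define z where "z = zs 0"
    define P where "P = z + (\<Sum>i\<le>N. w' i * zs i)"
    define W where "W = (\<Sum>i\<le>N. w i * zs i powr s)"
    define A where "A = (\<Sum>i\<le>N. w i * zs i powr m)"
    define B where "B = (\<Sum>i\<le>N. w' i * zs i powr m)"
    have z: "z \<ge> 1" using zs by (simp add: z_def)
    have zs0: "0 < zs i" for i using zs[of i] by linarith
    have sum1: "1 \<le> (\<Sum>i\<le>N. w' i * zs i)"
    proof -
      have "(\<Sum>i\<le>N. w' i * 1) \<le> (\<Sum>i\<le>N. w' i * zs i)" using w' zs by (intro sum_mono mult_left_mono) auto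
      then show ?thesis using w' by simp
    qed
    have zP: "z \<le> P" and P: "P \<ge> 1" using sum1 z by (auto simp: P_def)
    have zspos: "1 \<le> zs i powr s" for i using zs[of i] s by (intro ge_one_powr_ge_zero) auto
    have W: "W \<ge> 1"
    proof -
      have "(\<Sum>i\<le>N. w i * 1) \<le> W" unfolding W_def using w zspos by (intro sum_mono mult_left_mono) auto
      then show ?thesis using w by simp
    qed
    have A: "A \<ge> 0" and B: "B \<ge> 0" using w w' by (auto simp: A_def B_def intro!: sum_nonneg)
    have Pm: "P powr m \<le> 2 powr m * (z powr m + B)"
    proof -
      have "P powr m \<le> (2 * max z (\<Sum>i\<le>N. w' i * zs i)) powr m" using m P by (intro powr_mono2) (auto simp: P_def)
      also have "\<dots> = 2 powr m * max z (\<Sum>i\<le>N. w' i * zs i) powr m" using z by (simp add: powr_mult)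
      also have "max z (\<Sum>i\<le>N. w' i * zs i) powr m \<le> z powr m + (\<Sum>i\<le>N. w' i * zs i) powr m" by (auto simp: max_def)
      also have "(\<Sum>i\<le>N. w' i * zs i) powr m \<le> B" unfolding B_def
        using w' zs0 m by (intro powr_weighted_sum_le) auto
      finally show ?thesis by simp
    qed
    \<comment> \<open>W has the homogeneity of a power s. Comparing \<open>W powr (1 / s)\<close>
      with P, the larger of the two takes over the whole product, which becomes
      \<open>P powr m\<close> or \<open>W powr (m / s)\<close>; Jensen's inequality with exponent m
      / s >= 1 bounds the latter by A.\<close>
    have Wm: "W * P powr (q - 1) \<le> A + P powr m"
    proof (cases "W powr (1 / s) \<le> P")
      case True
      then have "(W powr (1 / s)) powr s \<le> P powr s" using s by (intro powr_mono2) auto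
      then have "W * P powr (q - 1) \<le> P powr s * P powr (q - 1)" using s W by (intro mult_right_mono) (auto simp: powr_powr)
      also have "\<dots> = P powr (s + (q - 1))" by (rule powr_add[symmetric])
      also have "s + (q - 1) = m" by (simp add: m_def)
      finally show ?thesis using A by linarith
    next
      case False
      then have "P powr (q - 1) \<le> (W powr (1 / s)) powr (q - 1)" using q P by (intro powr_mono2) auto
      then have "W * P powr (q - 1) \<le> W powr 1 * (W powr (1 / s)) powr (q - 1)" using W by (intro mult_mono) auto
      also have "\<dots> = W powr (m / s)"
        using s by (simp only: powr_powr powr_add[symmetric]) (simp add: m_def field_simps)
      also have "\<dots> \<le> (\<Sum>i\<le>N. w i * (zs i powr s) powr (m / s))"
        unfolding W_def by (rule powr_weighted_sum_le) (use w m s less_le_trans[OF zero_less_one zspos] in auto)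
      also have "\<dots> = A" using s by (simp add: A_def powr_powr)
      finally show ?thesis using powr_ge_zero[of P m] by linarith
    qed
    have small: "C2 * \<Delta> powr ((q - 1) / 2) \<le> \<epsilon> / 2 powr m"
    proof (cases "q = 1")
      case False
      then have "\<Delta> powr ((q - 1) / 2) \<le> \<Delta>0 powr ((q - 1) / 2)" using \<Delta> q by (intro powr_mono2) auto
      also have "\<dots> = \<epsilon> / 2 powr m / (C2 + 1)"
      proof -
        have "2 / (q - 1) * ((q - 1) / 2) = 1" using False by simp
        then show ?thesis using False C \<epsilon> by (simp only: \<Delta>0_def if_False powr_powr) simp
      qed
      finally have "(C2 + 1) * \<Delta> powr ((q - 1) / 2) \<le> \<epsilon> / 2 powr m" 
        using C by (simp only: pos_le_divide_eq[of "C2 + 1"] mult.commute[of "C2 + 1"])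
      then show ?thesis using powr_ge_zero[of \<Delta> "(q - 1) / 2"] unfolding distrib_right by linarith
    qed (use C \<epsilon> in auto)
    have drift: "z powr (q - 1) * W \<le> (q - 1) / m * z powr m + s / m * A"
    proof -
      have "z powr (q - 1) * W = (\<Sum>i\<le>N. w i * (z powr (q - 1) * zs i powr s))"
        by (simp add: W_def sum_distrib_left ac_simps)
      also have "\<dots> \<le> (\<Sum>i\<le>N. w i * ((q - 1) / m * z powr m + s / m * zs i powr m))"
      proof (intro sum_mono mult_left_mono w)
        fix i
        have "(q - 1) + s = m" by (simp add: m_def)
        then show "z powr (q - 1) * zs i powr s \<le> (q - 1) / m * z powr m + s / m * zs i powr m"
          using powr_mult_powr_le_weighted[of z "zs i" "q - 1" s] z zs0[of i] q s by simp
      qed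
      also have "\<dots> = (q - 1) / m * z powr m * (\<Sum>i\<le>N. w i) + s / m * A"
      proof -
        have "(\<Sum>i\<le>N. w i * (c + t * zs i powr m)) = c * (\<Sum>i\<le>N. w i) + t * A" for c t
          by (simp add: A_def distrib_left sum.distrib sum_distrib_left ac_simps)
        then show ?thesis .
      qed
      finally show ?thesis using w by simp
    qed
    have dissip: "z powr (q - 1) * X powr (2 * s) \<ge> z powr m - s * z powr (m - 1)"
    proof -
      have "X powr (2 * s) = (z - 1) powr s" using X by (simp add: z_def powr_powr[symmetric])
      then have "z powr s - s * z powr (s - 1) \<le> X powr (2 * s)" using powr_diff_one_ge[of s z] s z by simp
      then have "z powr (q - 1) * (z powr s - s * z powr (s - 1)) \<le> z powr (q - 1) * X powr (2 * s)" by (intro mult_left_mono) auto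
      moreover have "z powr (q - 1) * z powr s = z powr m" "z powr (q - 1) * z powr (s - 1) = z powr (m - 1)"
        unfolding powr_add[symmetric] by (simp_all add: m_def algebra_simps)
      ultimately show ?thesis by (simp add: right_diff_distrib mult.left_commute)
    qed
    have growth: "z powr (q - 1) * P \<le> P powr q"
    proof -
      have "z powr (q - 1) * P \<le> P powr (q - 1) * P" using zP z q by (intro mult_right_mono powr_mono2) auto
      also have "\<dots> = P powr q" using powr_mult_base[of P "q - 1"] P by (simp add: mult.commute)
      finally show ?thesis .
    qed
    have "q * (z powr (q - 1) * D) \<le> q * (z powr (q - 1) * (a1 * P - a2 * X powr (2 * s) + a3 * W))"
      using D q unfolding P_def W_def z_def by (intro mult_left_mono) auto
    also have "\<dots> = q * a1 * (z powr (q - 1) * P) - q * a2 * (z powr (q - 1) * X powr (2 * s)) + q * a3 * (z powr (q - 1) * W)"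
      by (simp add: algebra_simps)
    also have "\<dots> \<le> q * a1 * P powr q - q * a2 * (z powr m - s * z powr (m - 1)) + q * a3 * ((q - 1) / m * z powr m + s / m * A)"
      using growth dissip drift q a by (intro add_mono diff_mono mult_left_mono) auto
    finally have 1: "q * (z powr (q - 1) * D) \<le> q * a1 * P powr q - q * a2 * z powr m + q * a2 * s * z powr (m - 1)
         + q * a3 * ((q - 1) / m) * z powr m + q * a3 * (s / m) * A" by (simp add: algebra_simps)
    have scale: "c * (e / c * x + k) = e * x + c * k" if "c > 0" for c e x k :: real
      using that by (simp add: distrib_left)
    have 2: "q * a2 * s * z powr (m - 1) \<le> \<epsilon> * z powr m + q * a2 * s * K1"
      using mult_left_mono[OF K1(2)[OF z], of "q * a2 * s"] qa unfolding scale[OF qa(2)] by simp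
    have 3: "(q * a1 + C1) * P powr q \<le> \<epsilon> * (z powr m + B) + (q * a1 + C1) * K2"
    proof -
      have "(q * a1 + C1) * P powr q \<le> \<epsilon> / 2 powr m * P powr m + (q * a1 + C1) * K2"
        using mult_left_mono[OF K2(2)[OF P], of "q * a1 + C1"] qa unfolding scale[OF qa(1)] by simp
      also have "\<epsilon> / 2 powr m * P powr m \<le> \<epsilon> / 2 powr m * (2 powr m * (z powr m + B))"
        using Pm \<epsilon> by (intro mult_left_mono) auto
      finally show ?thesis by simp
    qed
    have 4: "C2 * \<Delta> powr ((q - 1) / 2) * (W * P powr (q - 1)) \<le> \<epsilon> * A + \<epsilon> * (z powr m + B)"
    proof -
      have m2: "1 \<le> 2 powr m" using m by (intro ge_one_powr_ge_zero) auto
      have "C2 * \<Delta> powr ((q - 1) / 2) * (W * P powr (q - 1)) \<le> \<epsilon> / 2 powr m * (A + 2 powr m * (z powr m + B))"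
        using small Wm Pm W C \<epsilon> by (intro mult_mono) auto
      also have "\<dots> = \<epsilon> * (A / 2 powr m) + \<epsilon> * (z powr m + B)" by (simp add: field_simps)
      also have "\<epsilon> * (A / 2 powr m) \<le> \<epsilon> * A" 
        using divide_left_mono[OF m2 A] \<epsilon> by (intro mult_left_mono) auto
      finally show ?thesis by simp
    qed
    have sum: "(\<Sum>i\<le>N. (\<beta>1 * w i + 2 * \<epsilon> * w' i) * zs i powr m) = \<beta>1 * A + 2 * \<epsilon> * B"
      by (simp add: A_def B_def distrib_right sum.distrib sum_distrib_left mult.assoc)
    have "q * (z powr (q - 1) * D) + (C1 * P powr q + C2 * \<Delta> powr ((q - 1) / 2) * (W * P powr (q - 1)))
      \<le> K - \<alpha> * z powr m + (\<beta>1 * A + 2 * \<epsilon> * B)"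
      using 1 2 3 4 unfolding K_def \<alpha>_def \<beta>1_def by (simp add: algebra_simps)
    then have "\<Delta> * (q * (z powr (q - 1) * D) + (C1 * P powr q + C2 * \<Delta> powr ((q - 1) / 2) * (W * P powr (q - 1))))
      \<le> \<Delta> * (K - \<alpha> * z powr m + (\<Sum>i\<le>N. (\<beta>1 * w i + 2 * \<epsilon> * w' i) * zs i powr m))"
      unfolding sum using \<Delta> by (intro mult_left_mono) auto
    moreover have "q * \<Delta> * z powr (q - 1) * D = \<Delta> * (q * (z powr (q - 1) * D))" by simp
    ultimately show "zs 0 powr q + q * \<Delta> * zs 0 powr (q - 1) * D
        + \<Delta> * (C1 * (zs 0 + (\<Sum>i\<le>N. w' i * zs i)) powr q
           + C2 * \<Delta> powr ((q - 1) / 2) * ((\<Sum>i\<le>N. w i * zs i powr s) * (zs 0 + (\<Sum>i\<le>N. w' i * zs i)) powr (q - 1)))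
      \<le> zs 0 powr q + \<Delta> * (K - \<alpha> * zs 0 powr (q + s - 1) + (\<Sum>i\<le>N. (\<beta>1 * w i + 2 * \<epsilon> * w' i) * zs i powr (q + s - 1)))"
      unfolding z_def[symmetric] P_def[symmetric] W_def[symmetric] m_def[symmetric] by (simp only: distrib_left add.assoc) 
  qed
qed

section \<open>Linear recursions with delay\<close>

text \<open>For each fixed delay i the sum is shifted by i, which raises the weights by at most
  \<open>r ^ N\<close>. The fewer than N + 1 terms that reach back before time 0 involve initial
  data only and are bounded by V0.\<close>

lemma sum_geometric_delay_le:
  fixes v b :: "_ \<Rightarrow> real"
  assumes r: "r \<ge> 1" and v: "\<And>k. v k \<ge> 0" and b: "\<And>i. b i \<ge> 0"
    and v0: "\<And>k::int. k < 0 \<Longrightarrow> v k \<le> V0" and V0: "V0 \<ge> 0" and N: "N > 0"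
  shows "(\<Sum>k<n. r ^ Suc k * (\<Sum>i\<le>N. b i * v (int k - int i)))
    \<le> r ^ N * (\<Sum>i\<le>N. b i) * ((\<Sum>k<n. r ^ Suc k * v (int k)) + real N * V0)"
proof -
  have inner: "(\<Sum>k<n. r ^ Suc k * v (int k - int i)) \<le> r ^ N * ((\<Sum>k<n. r ^ Suc k * v (int k)) + real N * V0)"
    if i: "i \<le> N" for i
  proof -
    have early: "(\<Sum>k\<in>{..<n} \<inter> {..<i}. r ^ Suc k * v (int k - int i)) \<le> r ^ N * (real N * V0)"
    proof -
      have "(\<Sum>k\<in>{..<n} \<inter> {..<i}. r ^ Suc k * v (int k - int i)) \<le> (\<Sum>k\<in>{..<n} \<inter> {..<i}. r ^ N * V0)"
      proof (rule sum_mono)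
        fix k assume k: "k \<in> {..<n} \<inter> {..<i}"
        show "r ^ Suc k * v (int k - int i) \<le> r ^ N * V0"
          using k i r v v0[of "int k - int i"] by (intro mult_mono power_increasing) auto
      qed
      also have "\<dots> \<le> real N * (r ^ N * V0)"
      proof -
        have "card ({..<n} \<inter> {..<i}) \<le> card {..<N}" using i by (intro card_mono) auto
        then show ?thesis using r V0 by (simp add: mult_right_mono)
      qed
      finally show ?thesis by (simp add: ac_simps)
    qed
    have "(\<Sum>k\<in>{..<n} - {..<i}. r ^ Suc k * v (int k - int i)) \<le> (\<Sum>k\<in>{..<n}. r ^ N * (r ^ Suc k * v (int k)))"
    proof -
      have "(\<Sum>k\<in>{..<n} - {..<i}. r ^ Suc k * v (int k - int i)) = (\<Sum>k\<in>{..<n - i}. r ^ Suc (k + i) * v (int k))"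
        by (rule sum.reindex_bij_witness[of _ "\<lambda>k. k + i" "\<lambda>k. k - i"]) auto
      also have "\<dots> \<le> (\<Sum>k\<in>{..<n - i}. r ^ N * (r ^ Suc k * v (int k)))"
      proof (rule sum_mono)
        fix k
        have "r ^ Suc (k + i) * v (int k) = r ^ i * (r ^ Suc k * v (int k))" by (simp add: power_add ac_simps)
        also have "\<dots> \<le> r ^ N * (r ^ Suc k * v (int k))"
          using r v i by (intro mult_right_mono power_increasing) auto
        finally show "r ^ Suc (k + i) * v (int k) \<le> r ^ N * (r ^ Suc k * v (int k))" .
      qed
      also have "\<dots> \<le> (\<Sum>k\<in>{..<n}. r ^ N * (r ^ Suc k * v (int k)))"
        using r v by (intro sum_mono2) auto
      finally show ?thesis .
    qed
    moreover have "(\<Sum>k<n. r ^ Suc k * v (int k - int i)) =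
       (\<Sum>k\<in>{..<n} \<inter> {..<i}. r ^ Suc k * v (int k - int i)) + (\<Sum>k\<in>{..<n} - {..<i}. r ^ Suc k * v (int k - int i))"
      by (rule sum.Int_Diff) auto
    ultimately show ?thesis using early by (simp add: distrib_left sum_distrib_left)
  qed
  have "(\<Sum>k<n. r ^ Suc k * (\<Sum>i\<le>N. b i * v (int k - int i)))
      = (\<Sum>k<n. \<Sum>i\<le>N. b i * (r ^ Suc k * v (int k - int i)))"
    by (simp add: sum_distrib_left ac_simps)
  also have "\<dots> = (\<Sum>i\<le>N. \<Sum>k<n. b i * (r ^ Suc k * v (int k - int i)))" by (rule sum.swap)
  also have "\<dots> = (\<Sum>i\<le>N. b i * (\<Sum>k<n. r ^ Suc k * v (int k - int i)))" by (simp add: sum_distrib_left)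
  also have "\<dots> \<le> (\<Sum>i\<le>N. b i * (r ^ N * ((\<Sum>k<n. r ^ Suc k * v (int k)) + real N * V0)))"
    using inner b by (intro sum_mono mult_left_mono) auto
  also have "\<dots> = r ^ N * (\<Sum>i\<le>N. b i) * ((\<Sum>k<n. r ^ Suc k * v (int k)) + real N * V0)"
    by (simp add: sum_distrib_right[symmetric] ac_simps)
  finally show ?thesis .
qed

text \<open>Multiplying the recursion by \<open>r ^ Suc k\<close> with \<open>r = 1 + \<gamma> \<Delta>\<close> makes the delayed terms
  cost a factor \<open>exp (\<gamma> \<tau>)\<close>, which the gap between \<open>\<alpha>\<close> and \<open>\<beta>\<close> absorbs.\<close>

lemma delayed_recursion_bound:
  fixes u v :: "int \<Rightarrow> real" and b :: "nat \<Rightarrow> real"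
  assumes \<Delta>: "\<Delta> > 0" and N: "N > 0" "real N * \<Delta> = \<tau>" and C: "C \<ge> 0"
    and \<gamma>: "\<gamma> > 0" "\<beta> \<ge> 0" "\<gamma> + \<beta> * exp (\<gamma> * \<tau>) \<le> \<alpha>"
    and b: "\<And>i. b i \<ge> 0" "(\<Sum>i\<le>N. b i) \<le> \<beta>"
    and uv: "\<And>k. 0 \<le> u k" "\<And>k. u k \<le> v k"
    and v0: "\<And>k. k < 0 \<Longrightarrow> v k \<le> V0" and u0: "u 0 \<le> V0"
    and step: "\<And>k. u (int (Suc k)) \<le> u (int k) + \<Delta> * (C - \<alpha> * v (int k) + (\<Sum>i\<le>N. b i * v (int k - int i)))"
  shows "u (int n) \<le> V0 + \<beta> * exp (\<gamma> * \<tau>) * \<tau> * V0 + C * (1 + \<gamma> * \<Delta>) / \<gamma>"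
proof -
  define r where "r = 1 + \<gamma> * \<Delta>"
  have r: "r \<ge> 1" "r > 0" using \<gamma> \<Delta> by (auto simp: r_def add_pos_pos)
  have v: "v k \<ge> 0" for k using uv[of k] by linarith
  have V0: "V0 \<ge> 0" using u0 uv(1)[of 0] by linarith
  have rN: "r ^ N \<le> exp (\<gamma> * \<tau>)"
  proof -
    have "r ^ N \<le> exp (\<gamma> * \<Delta>) ^ N" unfolding r_def
      using \<gamma> \<Delta> by (intro power_mono) auto
    also have "\<dots> = exp (real N * (\<gamma> * \<Delta>))" by (rule exp_of_nat_mult[symmetric])
    also have "real N * (\<gamma> * \<Delta>) = \<gamma> * \<tau>" unfolding N(2)[symmetric] by simp
    finally show ?thesis .
  qed
  have geom: "(\<Sum>k<n. r ^ Suc k) * (\<gamma> * \<Delta>) = r * (r ^ n - 1)"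
  proof (induction n)
    case (Suc n)
    then show ?case by (simp add: r_def algebra_simps)
  qed simp
  \<comment> \<open>Raising the weight from \<open>r ^ n\<close> to \<open>r ^ Suc n\<close> adds
    \<gamma> \<Delta> u, which is at most \<gamma> \<Delta> v and is charged to the dissipation;
    hence \<alpha> - \<gamma> in place of \<alpha>.\<close>
  have tele: "r ^ n * u (int n) \<le> u 0 + (\<Sum>k<n. r ^ Suc k * (\<Delta> * (C - (\<alpha> - \<gamma>) * v (int k)
       + (\<Sum>i\<le>N. b i * v (int k - int i)))))" for n
  proof (induction n)
    case (Suc n)
    have "r ^ Suc n * u (int (Suc n)) \<le> r ^ Suc n * (u (int n) + \<Delta> * (C - \<alpha> * v (int n) + (\<Sum>i\<le>N. b i * v (int n - int i))))"
      using step r by (intro mult_left_mono) auto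
    also have "\<dots> = r ^ n * u (int n) + r ^ n * (\<gamma> * \<Delta> * u (int n))
         + r ^ Suc n * (\<Delta> * (C - \<alpha> * v (int n) + (\<Sum>i\<le>N. b i * v (int n - int i))))"
      by (simp add: r_def algebra_simps)
    also have "r ^ n * (\<gamma> * \<Delta> * u (int n)) \<le> r ^ Suc n * (\<gamma> * \<Delta> * v (int n))"
      using r uv \<gamma> \<Delta> by (intro mult_mono power_increasing) auto
    also have "r ^ n * u (int n) + r ^ Suc n * (\<gamma> * \<Delta> * v (int n))
         + r ^ Suc n * (\<Delta> * (C - \<alpha> * v (int n) + (\<Sum>i\<le>N. b i * v (int n - int i))))
       = r ^ n * u (int n) + r ^ Suc n * (\<Delta> * (C - (\<alpha> - \<gamma>) * v (int n) + (\<Sum>i\<le>N. b i * v (int n - int i))))"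
      by (simp add: algebra_simps)
    finally show ?case using Suc.IH by simp
  qed simp
  define S where "S = (\<Sum>k<n. r ^ Suc k * v (int k))"
  have S: "S \<ge> 0" unfolding S_def using r v by (intro sum_nonneg) auto
  have delay: "(\<Sum>k<n. r ^ Suc k * (\<Sum>i\<le>N. b i * v (int k - int i))) \<le> exp (\<gamma> * \<tau>) * \<beta> * (S + real N * V0)"
  proof -
    have "(\<Sum>k<n. r ^ Suc k * (\<Sum>i\<le>N. b i * v (int k - int i)))
       \<le> r ^ N * (\<Sum>i\<le>N. b i) * (S + real N * V0)"
      unfolding S_def by (rule sum_geometric_delay_le) (use r v b v0 V0 N in auto)
    also have "\<dots> \<le> exp (\<gamma> * \<tau>) * \<beta> * (S + real N * V0)"
      using rN b r S V0 by (intro mult_right_mono mult_mono sum_nonneg) auto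
    finally show ?thesis .
  qed
  have "r ^ n * u (int n) \<le> u 0 + \<Delta> * (C * (\<Sum>k<n. r ^ Suc k) - (\<alpha> - \<gamma>) * S
     + (\<Sum>k<n. r ^ Suc k * (\<Sum>i\<le>N. b i * v (int k - int i))))"
    using tele[of n] unfolding S_def
    by (simp add: sum_distrib_left sum.distrib sum_subtractf algebra_simps)
  also have "\<dots> \<le> u 0 + \<Delta> * (C * (\<Sum>k<n. r ^ Suc k) - (\<alpha> - \<gamma>) * S + exp (\<gamma> * \<tau>) * \<beta> * (S + real N * V0))"
    using delay \<Delta> by simp
  also have "\<dots> \<le> u 0 + \<Delta> * (C * (\<Sum>k<n. r ^ Suc k) + exp (\<gamma> * \<tau>) * \<beta> * (real N * V0))"
  proof -
    have "(\<gamma> + \<beta> * exp (\<gamma> * \<tau>)) * S \<le> \<alpha> * S" using \<gamma> S by (intro mult_right_mono) auto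
    then have "- (\<alpha> - \<gamma>) * S + exp (\<gamma> * \<tau>) * \<beta> * S \<le> 0" by (simp add: algebra_simps)
    then show ?thesis using \<Delta> by (intro add_left_mono mult_left_mono) (auto simp: algebra_simps)
  qed
  also have "\<dots> = u 0 + C * (r * (r ^ n - 1) / \<gamma>) + \<beta> * exp (\<gamma> * \<tau>) * \<tau> * V0"
  proof -
    have "\<Delta> * (\<Sum>k<n. r ^ Suc k) = r * (r ^ n - 1) / \<gamma>" using geom \<gamma> by (simp add: field_simps)
    then have "\<Delta> * (C * (\<Sum>k<n. r ^ Suc k)) = C * (r * (r ^ n - 1) / \<gamma>)" by (metis mult.left_commute)
    then show ?thesis using N by (simp add: distrib_left) (simp add: ac_simps)
  qed
  \<comment> \<open>Every term is given the factor \<open>r ^ n\<close>, including those that do not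
    grow, so that dividing by it leaves a bound free of n.\<close>
  also have "\<dots> \<le> r ^ n * V0 + C * (r * r ^ n / \<gamma>) + r ^ n * (\<beta> * exp (\<gamma> * \<tau>) * \<tau> * V0)"
  proof -
    have rn: "r ^ n \<ge> 1" using r by simp
    have "u 0 \<le> r ^ n * V0" using u0 mult_right_mono[OF rn V0] by simp
    moreover have "C * (r * (r ^ n - 1) / \<gamma>) \<le> C * (r * r ^ n / \<gamma>)"
      using C r \<gamma> by (intro mult_left_mono divide_right_mono) auto
    moreover have "0 \<le> \<tau>" using N \<Delta> by (metis mult_nonneg_nonneg of_nat_0_le_iff less_imp_le)
    then have "0 \<le> \<beta> * exp (\<gamma> * \<tau>) * \<tau> * V0" using \<gamma> V0 by simp
    then have "\<beta> * exp (\<gamma> * \<tau>) * \<tau> * V0 \<le> r ^ n * (\<beta> * exp (\<gamma> * \<tau>) * \<tau> * V0)"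
      using mult_right_mono[OF rn] by fastforce
    ultimately show ?thesis by linarith
  qed
  also have "\<dots> = r ^ n * (V0 + \<beta> * exp (\<gamma> * \<tau>) * \<tau> * V0 + C * r / \<gamma>)" by (simp add: algebra_simps)
  finally have "r ^ n * u (int n) \<le> r ^ n * (V0 + \<beta> * exp (\<gamma> * \<tau>) * \<tau> * V0 + C * r / \<gamma>)" .
  then show ?thesis using r unfolding r_def[symmetric] by simp
qed

section \<open>Piecewise linear interpolation\<close>

text \<open>The tent functions at the integers form a partition of unity. Interpolation thereby
  becomes a convex combination of N + 1 node values, free of floors, and integration against a
  kernel becomes a weighted sum over nodes.\<close>

definition hat :: "real \<Rightarrow> real" where "hat x = max 0 (1 - \<bar>x\<bar>)"

lemma hat_nonneg: "0 \<le> hat x" by (simp add: hat_def)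

lemma hat_le_1: "hat x \<le> 1" by (simp add: hat_def)

lemma continuous_on_hat [continuous_intros]: "continuous_on S f \<Longrightarrow> continuous_on S (\<lambda>x. hat (f x))"
  unfolding hat_def by (intro continuous_intros)

lemma sum_hat_eq:
  fixes c :: "nat \<Rightarrow> 'a::real_vector"
  assumes l: "1 \<le> l" "l \<le> N" "- real l \<le> x" "x \<le> 1 - real l"
  shows "(\<Sum>i\<le>N. hat (x + real i) *\<^sub>R c i) = (1 - (x + real l)) *\<^sub>R c l + (x + real l) *\<^sub>R c (l - 1)"
proof -
  have "(\<Sum>i\<le>N. hat (x + real i) *\<^sub>R c i) = (\<Sum>i\<in>{l, l - 1}. hat (x + real i) *\<^sub>R c i)"
  proof (rule sum.mono_neutral_right)
    show "\<forall>i\<in>{..N} - {l, l - 1}. hat (x + real i) *\<^sub>R c i = 0"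
    proof
      fix i assume "i \<in> {..N} - {l, l - 1}"
      then have "i \<ge> l + 1 \<or> i + 2 \<le> l" using l by auto
      then have "real i \<ge> real l + 1 \<or> real i + 2 \<le> real l" by linarith
      then have "1 - \<bar>x + real i\<bar> \<le> 0" using l by linarith
      then show "hat (x + real i) *\<^sub>R c i = 0" by (simp add: hat_def)
    qed
  qed (use l in auto)
  also have "\<dots> = hat (x + real l) *\<^sub>R c l + hat (x + real (l - 1)) *\<^sub>R c (l - 1)" using l by auto
  also have "hat (x + real l) = 1 - (x + real l)" using l by (auto simp: hat_def)
  also have "hat (x + real (l - 1)) = x + real l" using l by (auto simp: hat_def of_nat_diff)
  finally show ?thesis .
qed

text \<open>The minimum with -1 assigns the right endpoint x = 0, whose floor is 0, to the last cell
  l = 1, as the definition of \<open>interp\<close> does.\<close>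

lemma hat_cell:
  assumes x: "- real N \<le> x" "x \<le> 0" and N: "N > 0"
  obtains l where "1 \<le> l" "l \<le> N" "- real l \<le> x" "x \<le> 1 - real l" "min (- 1) \<lfloor>x\<rfloor> = - int l"
proof
  define l where "l = nat (- min (- 1) \<lfloor>x\<rfloor>)"
  have l: "int l = - min (- 1) \<lfloor>x\<rfloor>" by (simp add: l_def)
  then show "min (- 1) \<lfloor>x\<rfloor> = - int l" by simp
  have fl: "- int N \<le> \<lfloor>x\<rfloor>" using x by (simp add: le_floor_iff)
  show "1 \<le> l" "l \<le> N" using l fl N by auto
  have "real l = - real_of_int (min (- 1) \<lfloor>x\<rfloor>)" using l by (metis of_int_minus of_int_of_nat_eq)
  then show "- real l \<le> x" "x \<le> 1 - real l" using x by (auto simp: min_def split: if_splits) linarith+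
qed

lemma sum_hat:
  assumes "- real N \<le> x" "x \<le> 0" "N > 0"
  shows "(\<Sum>i\<le>N. hat (x + real i)) = 1"
proof -
  obtain l where l: "1 \<le> l" "l \<le> N" "- real l \<le> x" "x \<le> 1 - real l" by (rule hat_cell[OF assms])
  show ?thesis using sum_hat_eq[OF l, of "\<lambda>_. 1 :: real"] by simp
qed

lemma interp_eq_sum_hat:
  assumes \<Delta>: "\<Delta> > 0" and N: "N > 0" and \<theta>: "- (real N * \<Delta>) \<le> \<theta>" "\<theta> \<le> 0"
  shows "interp \<Delta> N Y k \<theta> = (\<Sum>i\<le>N. hat (\<theta> / \<Delta> + real i) *\<^sub>R Y (k - int i))"
proof -
  have x: "- real N \<le> \<theta> / \<Delta>" "\<theta> / \<Delta> \<le> 0" using \<Delta> \<theta> by (auto simp: field_simps)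
  obtain l where l: "1 \<le> l" "l \<le> N" "- real l \<le> \<theta> / \<Delta>" "\<theta> / \<Delta> \<le> 1 - real l" "min (- 1) \<lfloor>\<theta> / \<Delta>\<rfloor> = - int l"
    by (rule hat_cell[OF x N])
  have 1: "((real_of_int (- int l) + 1) * \<Delta> - \<theta>) / \<Delta> = 1 - (\<theta> / \<Delta> + real l)"
    and 2: "(\<theta> - real_of_int (- int l) * \<Delta>) / \<Delta> = \<theta> / \<Delta> + real l" using \<Delta> by (simp_all add: field_simps)
  have 3: "k + - int l + 1 = k - int (l - 1)" "k + - int l = k - int l"
    "k - int l + 1 = k - int (l - 1)" using l by auto
  show ?thesis
    unfolding interp_def Let_def l(5) 1 2 3 sum_hat_eq[OF l(1-4), of "\<lambda>i. Y (k - int i)"] using \<theta> by simp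
qed

lemma interp_zero [simp]: "\<Delta> > 0 \<Longrightarrow> interp \<Delta> N Y k 0 = Y k"
  by (simp add: interp_def)

lemma norm_interp_le_sum:
  assumes \<Delta>: "\<Delta> > 0" and N: "N > 0" and \<theta>: "- (real N * \<Delta>) \<le> \<theta>" "\<theta> \<le> 0"
  shows "norm (interp \<Delta> N Y k \<theta>) \<le> (\<Sum>i\<le>N. hat (\<theta> / \<Delta> + real i) * norm (Y (k - int i)))"
  unfolding interp_eq_sum_hat[OF assms]
  by (rule order_trans[OF norm_sum]) (simp add: hat_nonneg)

lemma interp_diff:
  assumes \<Delta>: "\<Delta> > 0" and N: "N > 0" and \<theta>: "- (real N * \<Delta>) \<le> \<theta>" "\<theta> \<le> 0"
  shows "interp \<Delta> N Y k \<theta> - interp \<Delta> N Y' k \<theta> = interp \<Delta> N (\<lambda>j. Y j - Y' j) k \<theta>"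
  unfolding interp_eq_sum_hat[OF assms] by (simp add: sum_subtractf scaleR_diff_right)

lemma interp_in_Cset:
  assumes \<Delta>: "\<Delta> > 0" and N: "N > 0" and \<tau>: "real N * \<Delta> = \<tau>"
  shows "interp \<Delta> N Y k \<in> Cset \<tau>"
proof -
  have "continuous_on {-\<tau>..0} (\<lambda>\<theta>. \<Sum>i\<le>N. hat (\<theta> / \<Delta> + real i) *\<^sub>R Y (k - int i))"
    using \<Delta> by (intro continuous_intros) auto
  then have "continuous_on {-\<tau>..0} (interp \<Delta> N Y k)"
    by (rule continuous_on_eq) (simp add: interp_eq_sum_hat[OF \<Delta> N] \<tau>)
  then show ?thesis using \<tau> by (auto simp: Cset_def interp_def)
qed

lemma supnorm_interp_le:
  assumes \<Delta>: "\<Delta> > 0" and N: "N > 0" and \<tau>: "real N * \<Delta> = \<tau>" and Y: "\<And>j. norm (Y j) \<le> h"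
  shows "supnorm \<tau> (interp \<Delta> N Y k) \<le> h"
  unfolding supnorm_def
proof (rule cSUP_least)
  have "0 \<le> real N * \<Delta>" using \<Delta> by simp
  then show "{-\<tau>..0} \<noteq> {}" using \<tau> by simp
  fix \<theta> assume \<theta>: "\<theta> \<in> {-\<tau>..0}"
  have "norm (interp \<Delta> N Y k \<theta>) \<le> (\<Sum>i\<le>N. hat (\<theta> / \<Delta> + real i) * h)"
    using norm_interp_le_sum[OF \<Delta> N, of \<theta> Y k] \<theta> \<tau> sum_mono[of "{..N}" "\<lambda>i. hat (\<theta> / \<Delta> + real i) * norm (Y (k - int i))" "\<lambda>i. hat (\<theta> / \<Delta> + real i) * h"]
      Y by (auto simp: mult_left_mono hat_nonneg)
  also have "\<dots> = h"
  proof -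
    have "- real N \<le> \<theta> / \<Delta>" "\<theta> / \<Delta> \<le> 0" using \<Delta> \<theta> \<tau> by (auto simp: field_simps)
    then show ?thesis using sum_hat N by (simp add: sum_distrib_right[symmetric])
  qed
  finally show "norm (interp \<Delta> N Y k \<theta>) \<le> h" .
qed

lemma norm_interp_sq_le:
  assumes \<Delta>: "\<Delta> > 0" and N: "N > 0" and \<theta>: "- (real N * \<Delta>) \<le> \<theta>" "\<theta> \<le> 0"
    and zs: "\<And>i. (norm (Y (k - int i)))\<^sup>2 \<le> zs i"
  shows "(norm (interp \<Delta> N Y k \<theta>))\<^sup>2 \<le> (\<Sum>i\<le>N. hat (\<theta> / \<Delta> + real i) * zs i)"
proof -
  have x: "- real N \<le> \<theta> / \<Delta>" "\<theta> / \<Delta> \<le> 0" using \<Delta> \<theta> by (auto simp: field_simps)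
  have "(norm (interp \<Delta> N Y k \<theta>))\<^sup>2 \<le> (\<Sum>i\<le>N. hat (\<theta> / \<Delta> + real i) *\<^sub>R norm (Y (k - int i)))\<^sup>2"
    using norm_interp_le_sum[OF assms(1-4)] by (intro power_mono) auto
  also have "\<dots> \<le> (\<Sum>i\<le>N. hat (\<theta> / \<Delta> + real i) * (norm (Y (k - int i)))\<^sup>2)"
    using sum_hat[OF x N]
    by (intro convex_on_sum[where C=UNIV] convex_power2) (auto simp: hat_nonneg)
  also have "\<dots> \<le> (\<Sum>i\<le>N. hat (\<theta> / \<Delta> + real i) * zs i)"
    using zs by (intro sum_mono mult_left_mono) (auto simp: hat_nonneg)
  finally show ?thesis .
qed

lemma norm_interp_powr_le:
  assumes \<Delta>: "\<Delta> > 0" and N: "N > 0" and \<theta>: "- (real N * \<Delta>) \<le> \<theta>" "\<theta> \<le> 0"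
    and zs: "\<And>i. (norm (Y (k - int i)))\<^sup>2 \<le> zs i" "\<And>i. 0 < zs i" and s: "s \<ge> 1"
  shows "norm (interp \<Delta> N Y k \<theta>) powr (2 * s) \<le> (\<Sum>i\<le>N. hat (\<theta> / \<Delta> + real i) * zs i powr s)"
proof -
  have x: "- real N \<le> \<theta> / \<Delta>" "\<theta> / \<Delta> \<le> 0" using \<Delta> \<theta> by (auto simp: field_simps)
  have "norm (interp \<Delta> N Y k \<theta>) powr (2 * s) = ((norm (interp \<Delta> N Y k \<theta>))\<^sup>2) powr s"
    by (simp add: powr_powr[symmetric])
  also have "\<dots> \<le> (\<Sum>i\<le>N. hat (\<theta> / \<Delta> + real i) * zs i) powr s"
    using norm_interp_sq_le[where Y=Y and k=k and zs=zs, OF assms(1-5)] s by (intro powr_mono2) auto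
  also have "\<dots> \<le> (\<Sum>i\<le>N. hat (\<theta> / \<Delta> + real i) * zs i powr s)"
    using zs s sum_hat[OF x N] by (intro powr_weighted_sum_le) (auto simp: hat_nonneg)
  finally show ?thesis .
qed

section \<open>Averages of the interpolant against delay kernels\<close>

lemma Wset_integrable_mult:
  assumes \<rho>: "\<rho> \<in> Wset \<tau>" and c: "continuous_on {-\<tau>..0} c"
  shows "(\<lambda>\<theta>. c \<theta> * \<rho> \<theta>) integrable_on {-\<tau>..0}"
proof -
  have "bounded (c ` {-\<tau>..0})" using c by (intro compact_imp_bounded compact_continuous_image) auto
  then obtain b where b: "\<And>\<theta>. \<theta> \<in> {-\<tau>..0} \<Longrightarrow> \<bar>c \<theta>\<bar> \<le> b" by (metis bounded_iff imageI real_norm_def)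
  obtain r where r: "\<And>\<theta>. \<theta> \<in> {-\<tau>..0} \<Longrightarrow> \<bar>\<rho> \<theta>\<bar> \<le> r"
    using \<rho> unfolding Wset_def by (metis (no_types, lifting) bounded_iff imageI mem_Collect_eq real_norm_def)
  \<comment> \<open>\<open>Wset\<close> provides Borel measurability on the interval; it is passed
    to the completed measure, where bounded measurable functions are gauge integrable.\<close>
  have "\<rho> \<in> borel_measurable (restrict_space lborel {-\<tau>..0})"
    using \<rho> by (simp add: Wset_def measurable_cong_sets[OF sets_restrict_space_cong[OF sets_lborel] refl])
  then have \<rho>m: "\<rho> \<in> borel_measurable (lebesgue_on {-\<tau>..0})"
    by (subst (asm) borel_measurable_restrict_space_iff, simp, subst borel_measurable_restrict_space_iff)
      (auto intro: measurable_completion)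
  show ?thesis
  proof (rule measurable_bounded_by_integrable_imp_integrable_real)
    show "(\<lambda>\<theta>. c \<theta> * \<rho> \<theta>) \<in> borel_measurable (lebesgue_on {-\<tau>..0})"
      using continuous_imp_measurable_on_sets_lebesgue[OF c] \<rho>m by (intro borel_measurable_times) auto
    show "(\<lambda>_. b * r) integrable_on {-\<tau>..0}" by (rule integrable_const_ivl)
    show "\<bar>c \<theta> * \<rho> \<theta>\<bar> \<le> b * r" if "\<theta> \<in> {-\<tau>..0}" for \<theta>
      unfolding abs_mult using b[OF that] r[OF that] by (intro mult_mono) auto
  qed auto
qed

text \<open>The mass that the kernel assigns to the node i steps back. For kernels in
  \<open>Wset\<close> these weights again sum to one, so the hypothesis on the kernel survives
  discretisation without loss.\<close>

definition hat_weight :: "real \<Rightarrow> real \<Rightarrow> (real \<Rightarrow> real) \<Rightarrow> nat \<Rightarrow> real" where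
  "hat_weight \<tau> \<Delta> \<rho> i = integral {-\<tau>..0} (\<lambda>\<theta>. hat (\<theta> / \<Delta> + real i) * \<rho> \<theta>)"

text \<open>Stated for every \<Delta>, as the coefficients of the recursion are nonnegative for
  every \<Delta>. If the product failed to be integrable, its integral would be 0 by
  convention.\<close>

lemma hat_weight_nonneg: "\<rho> \<in> Wset \<tau> \<Longrightarrow> 0 \<le> hat_weight \<tau> \<Delta> \<rho> i"
  unfolding hat_weight_def
proof (cases "(\<lambda>\<theta>. hat (\<theta> / \<Delta> + real i) * \<rho> \<theta>) integrable_on {-\<tau>..0}")
  case True
  assume "\<rho> \<in> Wset \<tau>"
  then show "0 \<le> integral {-\<tau>..0} (\<lambda>\<theta>. hat (\<theta> / \<Delta> + real i) * \<rho> \<theta>)"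
    by (intro integral_nonneg[OF True] mult_nonneg_nonneg hat_nonneg) (simp add: Wset_def)
qed (simp add: not_integrable_integral)

lemma sum_hat_weight:
  assumes \<Delta>: "\<Delta> > 0" and N: "N > 0" and \<tau>: "real N * \<Delta> = \<tau>" and \<rho>: "\<rho> \<in> Wset \<tau>"
  shows "(\<Sum>i\<le>N. hat_weight \<tau> \<Delta> \<rho> i) = 1"
proof -
  have "(\<Sum>i\<le>N. hat_weight \<tau> \<Delta> \<rho> i) = integral {-\<tau>..0} (\<lambda>\<theta>. \<Sum>i\<le>N. hat (\<theta> / \<Delta> + real i) * \<rho> \<theta>)"
    unfolding hat_weight_def using \<Delta>
    by (intro integral_sum[symmetric] Wset_integrable_mult[OF \<rho>] continuous_intros) auto
  also have "\<dots> = integral {-\<tau>..0} \<rho>"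
  proof (rule integral_cong)
    fix \<theta> assume "\<theta> \<in> {-\<tau>..0}"
    then have "- real N \<le> \<theta> / \<Delta>" "\<theta> / \<Delta> \<le> 0" using \<Delta> \<tau> by (auto simp: field_simps)
    then show "(\<Sum>i\<le>N. hat (\<theta> / \<Delta> + real i) * \<rho> \<theta>) = \<rho> \<theta>"
      using sum_hat N by (simp add: sum_distrib_right[symmetric])
  qed
  also have "\<dots> = 1" using \<rho> by (auto simp: Wset_def)
  finally show ?thesis .
qed

lemma integral_le_hat_weight_sum:
  assumes \<Delta>: "\<Delta> > 0" and N: "N > 0" and \<rho>: "\<rho> \<in> Wset \<tau>" and F: "continuous_on {-\<tau>..0} F"
    and le: "\<And>\<theta>. \<theta> \<in> {-\<tau>..0} \<Longrightarrow> F \<theta> \<le> (\<Sum>i\<le>N. hat (\<theta> / \<Delta> + real i) * c i)"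
  shows "integral {-\<tau>..0} (\<lambda>\<theta>. F \<theta> * \<rho> \<theta>) \<le> (\<Sum>i\<le>N. hat_weight \<tau> \<Delta> \<rho> i * c i)"
proof -
  have int: "(\<lambda>\<theta>. c i * (hat (\<theta> / \<Delta> + real i) * \<rho> \<theta>)) integrable_on {-\<tau>..0}" for i
    using Wset_integrable_mult[OF \<rho>, of "\<lambda>\<theta>. c i * hat (\<theta> / \<Delta> + real i)"] \<Delta>
    by (simp add: mult.assoc continuous_intros)
  have "integral {-\<tau>..0} (\<lambda>\<theta>. F \<theta> * \<rho> \<theta>) \<le> integral {-\<tau>..0} (\<lambda>\<theta>. \<Sum>i\<le>N. c i * (hat (\<theta> / \<Delta> + real i) * \<rho> \<theta>))"
  proof (rule integral_le[OF Wset_integrable_mult[OF \<rho> F] integrable_sum])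
    fix \<theta> assume \<theta>: "\<theta> \<in> {-\<tau>..0}"
    then have "F \<theta> * \<rho> \<theta> \<le> (\<Sum>i\<le>N. hat (\<theta> / \<Delta> + real i) * c i) * \<rho> \<theta>"
      using le \<rho> by (intro mult_right_mono) (auto simp: Wset_def)
    then show "F \<theta> * \<rho> \<theta> \<le> (\<Sum>i\<le>N. c i * (hat (\<theta> / \<Delta> + real i) * \<rho> \<theta>))"
      by (simp add: sum_distrib_right sum_distrib_left ac_simps)
  qed (use int in auto)
  also have "\<dots> = (\<Sum>i\<le>N. hat_weight \<tau> \<Delta> \<rho> i * c i)"
    by (subst integral_sum) (use int in \<open>auto simp: hat_weight_def mult.commute\<close>)
  finally show ?thesis .
qed

lemma uniform_in_Wset:
  assumes "\<tau> > 0"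
  shows "(\<lambda>_. 1 / \<tau>) \<in> Wset \<tau>"
proof -
  have "((\<lambda>_. 1 / \<tau>) has_integral measure lborel {-\<tau>..0} *\<^sub>R (1 / \<tau>)) {-\<tau>..0}" by (rule has_integral_const_real)
  also have "measure lborel {-\<tau>..0} *\<^sub>R (1 / \<tau>) = 1" using assms by simp
  finally show ?thesis using assms by (simp add: Wset_def image_constant_conv)
qed

section \<open>The scheme as a function of the Brownian increments\<close>

text \<open>The recursion of \<open>breve_seq\<close> with the increments as a free argument. A step
  then acts on one coordinate of a product space, and conditioning on the past turns into Fubini's
  theorem.\<close>

primrec driven_seq ::
  "((real \<Rightarrow> real^'n) \<Rightarrow> real^'n) \<Rightarrow> ((real \<Rightarrow> real^'n) \<Rightarrow> real^'d^'n) \<Rightarrow>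
   (real \<Rightarrow> real^'n) \<Rightarrow> real \<Rightarrow> nat \<Rightarrow> real \<Rightarrow> (nat \<Rightarrow> real^'d) \<Rightarrow> nat \<Rightarrow> int \<Rightarrow> real^'n" where
  "driven_seq f g \<xi> \<Delta> N h d 0 = (\<lambda>j. \<xi> (real_of_int j * \<Delta>))"
| "driven_seq f g \<xi> \<Delta> N h d (Suc k) =
     (driven_seq f g \<xi> \<Delta> N h d k)(int k + 1 := trunc h (driven_seq f g \<xi> \<Delta> N h d k (int k))
        + \<Delta> *\<^sub>R f (interp \<Delta> N (\<lambda>j. trunc h (driven_seq f g \<xi> \<Delta> N h d k j)) (int k))
        + g (interp \<Delta> N (\<lambda>j. trunc h (driven_seq f g \<xi> \<Delta> N h d k j)) (int k)) *v d k)"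

lemma breve_seq_eq_driven_seq:
  "breve_seq f g B \<xi> \<Delta> N h \<omega> k
    = driven_seq f g \<xi> \<Delta> N h (\<lambda>i. B (real (Suc i) * \<Delta>) \<omega> - B (real i * \<Delta>) \<omega>) k"
  by (induction k) (simp_all add: Let_def)

lemma driven_seq_cong:
  "(\<And>i. i < k \<Longrightarrow> d i = d' i) \<Longrightarrow> driven_seq f g \<xi> \<Delta> N h d k = driven_seq f g \<xi> \<Delta> N h d' k"
  by (induction k) simp_all

lemma driven_seq_stable:
  "j \<le> int k \<Longrightarrow> driven_seq f g \<xi> \<Delta> N h d k j = driven_seq f g \<xi> \<Delta> N h d (nat j) j"
proof (induction k)
  case (Suc k)
  show ?case
  proof (cases "j = int k + 1")
    case True
    then have "nat j = Suc k" by simp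
    then show ?thesis by simp
  next
    case False
    then show ?thesis using Suc by simp
  qed
qed simp

section \<open>Continuity and measurability of the truncated scheme\<close>

lemma norm_trunc: "h \<ge> 0 \<Longrightarrow> norm (trunc h x) = min (norm x) h"
  by (cases "x = 0") (auto simp: trunc_def norm_sgn)

text \<open>In this form the scalar factor is continuous also at the origin, where
  \<open>sgn\<close> is not.\<close>

lemma trunc_eq_scaleR: "h > 0 \<Longrightarrow> trunc h x = (h / max h (norm x)) *\<^sub>R x"
  by (cases "x = 0") (auto simp: trunc_def sgn_div_norm min_def max_def divide_inverse)

lemma continuous_on_trunc [continuous_intros]:
  assumes "h > 0" "continuous_on S c"
  shows "continuous_on S (\<lambda>x. trunc h (c x))"
  unfolding trunc_eq_scaleR[OF assms(1)] using assms by (intro continuous_intros) auto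

text \<open>The local Lipschitz condition for a single coefficient at a single radius h. It serves
  the measurability of the scheme, whose values stay within that radius.\<close>

definition delay_lipschitz_on :: "real \<Rightarrow> real \<Rightarrow> ((real \<Rightarrow> real^'n) \<Rightarrow> 'b::real_normed_vector) \<Rightarrow> bool" where
  "delay_lipschitz_on \<tau> h F \<longleftrightarrow> (\<exists>R\<ge>0. \<forall>\<phi>\<in>Cset \<tau>. \<forall>\<phi>'\<in>Cset \<tau>. supnorm \<tau> \<phi> \<le> h \<and> supnorm \<tau> \<phi>' \<le> h \<longrightarrow>
     norm (F \<phi> - F \<phi>') \<le> R * (norm (\<phi> 0 - \<phi>' 0) + (1/\<tau>) * integral {-\<tau>..0} (\<lambda>\<theta>. norm (\<phi> \<theta> - \<phi>' \<theta>))))"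

text \<open>The coefficients act on paths, but the interpolant depends on finitely many nodes only.
  The Lipschitz condition bounds the change of \<open>F\<close> by the sum \<open>G\<close> of the
  node distances, which tends to 0 in the product topology on sequences, so the composition is
  continuous and hence Borel.\<close>

lemma continuous_on_delay_functional:
  fixes F :: "(real \<Rightarrow> real^'n) \<Rightarrow> 'b::real_normed_vector"
  assumes F: "delay_lipschitz_on \<tau> h F" and h: "h > 0" and \<Delta>: "\<Delta> > 0" and N: "N > 0" and \<tau>: "real N * \<Delta> = \<tau>"
  shows "continuous_on UNIV (\<lambda>y. F (interp \<Delta> N (\<lambda>j. trunc h (y j)) k))"
proof -
  have \<tau>0: "\<tau> > 0" using \<Delta> N \<tau> by (metis mult_pos_pos of_nat_0_less_iff)
  define \<Phi> where "\<Phi> y = interp \<Delta> N (\<lambda>j. trunc h (y j)) k" for y :: "int \<Rightarrow> real^'n"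
  obtain R where R: "R \<ge> 0"
    and lip: "\<And>\<phi> \<phi>'. \<phi> \<in> Cset \<tau> \<Longrightarrow> \<phi>' \<in> Cset \<tau> \<Longrightarrow> supnorm \<tau> \<phi> \<le> h \<Longrightarrow> supnorm \<tau> \<phi>' \<le> h \<Longrightarrow>
     norm (F \<phi> - F \<phi>') \<le> R * (norm (\<phi> 0 - \<phi>' 0) + (1/\<tau>) * integral {-\<tau>..0} (\<lambda>\<theta>. norm (\<phi> \<theta> - \<phi>' \<theta>)))"
    using F unfolding delay_lipschitz_on_def by blast
  define G where "G y y' = (\<Sum>i\<le>N. norm (trunc h (y' (k - int i)) - trunc h (y (k - int i))))" for y y' :: "int \<Rightarrow> real^'n"
  have bound: "norm (F (\<Phi> y') - F (\<Phi> y)) \<le> R * (2 * G y y')" for y y'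
  proof -
    have pt: "norm (\<Phi> y' \<theta> - \<Phi> y \<theta>) \<le> G y y'" if "\<theta> \<in> {-\<tau>..0}" for \<theta>
    proof -
      have \<theta>: "- (real N * \<Delta>) \<le> \<theta>" "\<theta> \<le> 0" using that \<tau> by auto
      show ?thesis unfolding \<Phi>_def interp_diff[OF \<Delta> N \<theta>] G_def
        by (rule order_trans[OF norm_interp_le_sum[OF \<Delta> N \<theta>]] sum_mono)+
          (simp add: mult_left_le_one_le hat_nonneg hat_le_1)
    qed
    have mem: "\<Phi> y \<in> Cset \<tau>" for y unfolding \<Phi>_def by (rule interp_in_Cset[OF \<Delta> N \<tau>])
    have sup: "supnorm \<tau> (\<Phi> y) \<le> h" for y unfolding \<Phi>_def
      using h by (intro supnorm_interp_le[OF \<Delta> N \<tau>]) (simp add: norm_trunc)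
    have "integral {-\<tau>..0} (\<lambda>\<theta>. norm (\<Phi> y' \<theta> - \<Phi> y \<theta>)) \<le> integral {-\<tau>..0} (\<lambda>_. G y y')"
    proof (rule integral_le)
      show "(\<lambda>\<theta>. norm (\<Phi> y' \<theta> - \<Phi> y \<theta>)) integrable_on {-\<tau>..0}"
        using mem[of y] mem[of y'] by (intro integrable_continuous_interval continuous_intros) (auto simp: Cset_def)
    qed (use pt in auto)
    also have "\<dots> = \<tau> * G y y'" using \<tau>0 by simp
    finally have "(1/\<tau>) * integral {-\<tau>..0} (\<lambda>\<theta>. norm (\<Phi> y' \<theta> - \<Phi> y \<theta>)) \<le> G y y'"
      using \<tau>0 by (simp add: field_simps)
    moreover have "norm (\<Phi> y' 0 - \<Phi> y 0) \<le> G y y'" using pt[of 0] \<tau>0 by simp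
    ultimately have "R * (norm (\<Phi> y' 0 - \<Phi> y 0) + (1/\<tau>) * integral {-\<tau>..0} (\<lambda>\<theta>. norm (\<Phi> y' \<theta> - \<Phi> y \<theta>)))
       \<le> R * (2 * G y y')" using R by (intro mult_left_mono) auto
    then show ?thesis using lip[OF mem mem sup sup, of y' y] by linarith
  qed
  show ?thesis
    unfolding continuous_on_def \<Phi>_def[symmetric]
  proof
    fix y :: "int \<Rightarrow> real^'n"
    have "continuous_on UNIV (\<lambda>y'. R * (2 * G y y'))" unfolding G_def
      using h by (intro continuous_intros continuous_on_product_coordinates)
    then have "((\<lambda>y'. R * (2 * G y y')) \<longlongrightarrow> R * (2 * G y y)) (at y)"
      unfolding continuous_on_def by auto
    then have lim: "((\<lambda>y'. R * (2 * G y y')) \<longlongrightarrow> 0) (at y)" by (simp add: G_def)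
    have "((\<lambda>y'. dist (F (\<Phi> y')) (F (\<Phi> y))) \<longlongrightarrow> 0) (at y)"
      by (rule tendsto_sandwich[OF _ _ tendsto_const lim]) (auto simp: dist_norm bound)
    then show "((\<lambda>y. F (\<Phi> y)) \<longlongrightarrow> F (\<Phi> y)) (at y within UNIV)"
      by (subst tendsto_dist_iff) simp
  qed
qed

lemma borel_measurable_matrix_vector_mult:
  fixes A :: "'a \<Rightarrow> real^'d^'n"
  assumes [measurable]: "A \<in> borel_measurable M" "v \<in> borel_measurable M"
  shows "(\<lambda>\<omega>. A \<omega> *v v \<omega>) \<in> borel_measurable M"
proof (rule borel_measurable_euclidean_space[THEN iffD2], rule ballI)
  fix b :: "real^'n" assume "b \<in> Basis"
  then obtain i where i: "b = axis i 1" by (auto simp: Basis_vec_def)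
  have "(\<lambda>x::real^'d^'n. x $ i) \<in> borel_measurable borel"
    by (intro borel_measurable_continuous_onI continuous_intros)
  then have [measurable]: "(\<lambda>\<omega>. A \<omega> $ i) \<in> borel_measurable M" by (rule measurable_compose[OF assms(1)])
  show "(\<lambda>\<omega>. (A \<omega> *v v \<omega>) \<bullet> b) \<in> borel_measurable M"
    by (simp add: i inner_axis matrix_vector_mult_inner)
qed

lemma borel_measurable_trunc:
  "h > 0 \<Longrightarrow> c \<in> borel_measurable M \<Longrightarrow> (\<lambda>\<omega>. trunc h (c \<omega>)) \<in> borel_measurable M"
  by (rule measurable_compose[where N=borel and g="trunc h"])
    (auto intro!: borel_measurable_continuous_onI continuous_on_trunc continuous_on_id)

lemma borel_measurable_driven_seq:
  fixes f :: "(real \<Rightarrow> real^'n) \<Rightarrow> real^'n" and g :: "(real \<Rightarrow> real^'n) \<Rightarrow> real^'d^'n"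
  assumes f: "delay_lipschitz_on \<tau> h f" and g: "delay_lipschitz_on \<tau> h g"
    and h: "h > 0" and \<Delta>: "\<Delta> > 0" and N: "N > 0" and \<tau>: "real N * \<Delta> = \<tau>"
  shows "k \<le> n \<Longrightarrow> (\<lambda>d. driven_seq f g \<xi> \<Delta> N h d k j) \<in> borel_measurable (Pi\<^sub>M {..<n} (\<lambda>_. borel))"
proof (induction k arbitrary: j)
  case (Suc k)
  have IH[measurable]: "(\<lambda>d. driven_seq f g \<xi> \<Delta> N h d k j) \<in> borel_measurable (Pi\<^sub>M {..<n} (\<lambda>_. borel))" for j
    using Suc by simp
  have "(\<lambda>d. driven_seq f g \<xi> \<Delta> N h d k) \<in> borel_measurable (Pi\<^sub>M {..<n} (\<lambda>_. borel))"
    by (rule measurable_coordinatewise_then_product) (rule IH)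
  note func = measurable_compose[OF this borel_measurable_continuous_onI[OF continuous_on_delay_functional]]
  have [measurable]: "(\<lambda>d. f (interp \<Delta> N (\<lambda>j. trunc h (driven_seq f g \<xi> \<Delta> N h d k j)) (int k))) \<in> borel_measurable (Pi\<^sub>M {..<n} (\<lambda>_. borel))"
    by (rule func[OF f h \<Delta> N \<tau>])
  have gm: "(\<lambda>d. g (interp \<Delta> N (\<lambda>j. trunc h (driven_seq f g \<xi> \<Delta> N h d k j)) (int k))) \<in> borel_measurable (Pi\<^sub>M {..<n} (\<lambda>_. borel))"
    by (rule func[OF g h \<Delta> N \<tau>])
  have "(\<lambda>d. d k) \<in> borel_measurable (Pi\<^sub>M {..<n} (\<lambda>_. borel :: (real^'d) measure))"
    using Suc by (intro measurable_component_singleton) auto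
  note [measurable] = borel_measurable_matrix_vector_mult[OF gm this] borel_measurable_trunc[OF h IH]
  show ?case by (cases "j = int k + 1") simp_all
qed simp

section \<open>Joint law of the increments and integrating out the last one\<close>

lemma brownian_increments_distr:
  fixes B :: "real \<Rightarrow> 'a \<Rightarrow> real^'d"
  assumes BM: "brownian_motion M B" and \<Delta>: "\<Delta> > 0" and n: "n > 0"
  shows "distr M (Pi\<^sub>M {..<n} (\<lambda>_. borel)) (\<lambda>\<omega>. \<lambda>i\<in>{..<n}. B (real (Suc i) * \<Delta>) \<omega> - B (real i * \<Delta>) \<omega>)
    = Pi\<^sub>M {..<n} (\<lambda>_. gauss (sqrt \<Delta>))"
proof -
  interpret prob_space M using BM by (simp add: brownian_motion_def)
  define D where "D i \<omega> = B (real (Suc i) * \<Delta>) \<omega> - B (real i * \<Delta>) \<omega>" for i \<omega>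
  \<comment> \<open>The grid points 0, \<Delta>, ..., n \<Delta>: n + 1 times, so that the list has
    n increments.\<close>
  define ts where "ts = map (\<lambda>i. real i * \<Delta>) [0..<Suc n]"
  have Bm[measurable]: "B t \<in> borel_measurable M" for t using BM by (simp add: brownian_motion_def)
  have Dm: "D i \<in> borel_measurable M" for i unfolding D_def by measurable
  have nth: "ts ! i = real i * \<Delta>" if "i \<le> n" for i
    using that by (simp add: ts_def del: upt_Suc)
  have "sorted ts"
    unfolding sorted_iff_nth_mono using \<Delta> by (auto simp: ts_def simp del: upt_Suc intro!: mult_right_mono)
  moreover have "distinct ts"
    unfolding ts_def distinct_map using \<Delta> by (auto simp: inj_on_def simp del: upt_Suc)
  moreover have "\<forall>t\<in>set ts. 0 \<le> t" using \<Delta> by (auto simp: ts_def simp del: upt_Suc)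
  moreover have "length ts - 1 = n" by (simp add: ts_def)
  moreover have "sorted ts \<and> distinct ts \<and> (\<forall>t\<in>set ts. 0 \<le> t) \<longrightarrow>
      indep_vars (\<lambda>_. borel) (\<lambda>i \<omega>. B (ts ! Suc i) \<omega> - B (ts ! i) \<omega>) {..<length ts - 1}" for ts
    using BM unfolding brownian_motion_def by blast
  ultimately have "indep_vars (\<lambda>_. borel) (\<lambda>i \<omega>. B (ts ! Suc i) \<omega> - B (ts ! i) \<omega>) {..<n}"
    by fastforce
  then have "indep_vars (\<lambda>_. borel) D {..<n}"
    by (rule indep_vars_cong[THEN iffD1, rotated -1]) (auto simp: nth D_def)
  then have "distr M (Pi\<^sub>M {..<n} (\<lambda>_. borel)) (\<lambda>\<omega>. \<lambda>i\<in>{..<n}. D i \<omega>) = Pi\<^sub>M {..<n} (\<lambda>i. distr M borel (D i))"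
    using n Dm by (subst (asm) indep_vars_iff_distr_eq_PiM') auto
  moreover have "distr M borel (D i) = gauss (sqrt \<Delta>)" for i
  proof -
    have "0 \<le> real i * \<Delta>" "real i * \<Delta> < real (Suc i) * \<Delta>" using \<Delta> by auto
    moreover have "real (Suc i) * \<Delta> - real i * \<Delta> = \<Delta>" by (simp add: algebra_simps)
    moreover have "0 \<le> r \<and> r < t \<longrightarrow> distr M borel (\<lambda>\<omega>. B t \<omega> - B r \<omega>) = gauss (sqrt (t - r))" for r t
      using BM unfolding brownian_motion_def gauss_def by blast
    ultimately show ?thesis unfolding D_def[abs_def] by fastforce
  qed
  ultimately show ?thesis unfolding D_def by (simp only:)
qed

text \<open>This replaces conditional expectation given the first k increments: under their product
  law the coordinate k is integrated out, with the earlier ones held fixed.\<close>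

lemma brownian_expectation_step:
  fixes B :: "real \<Rightarrow> 'a \<Rightarrow> real^'d"
  assumes BM: "brownian_motion M B" and \<Delta>: "\<Delta> > 0"
    and H[measurable]: "H \<in> borel_measurable (Pi\<^sub>M {..<Suc k} (\<lambda>_. borel))"
    and b[measurable]: "b \<in> borel_measurable (Pi\<^sub>M {..<k} (\<lambda>_. borel))"
    and le: "\<And>x. (\<integral>\<^sup>+y. H (x(k := y)) \<partial>gauss (sqrt \<Delta>)) \<le> b x"
  defines "D \<equiv> \<lambda>n \<omega>. \<lambda>i\<in>{..<n}. B (real (Suc i) * \<Delta>) \<omega> - B (real i * \<Delta>) \<omega>"
  shows "(\<integral>\<^sup>+\<omega>. H (D (Suc k) \<omega>) \<partial>M) \<le> (\<integral>\<^sup>+\<omega>. b (D k \<omega>) \<partial>M)"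
proof -
  interpret G: prob_space "gauss (sqrt \<Delta>) :: (real^'d) measure" using \<Delta> by (intro prob_space_gauss) simp
  interpret P: product_sigma_finite "\<lambda>_::nat. gauss (sqrt \<Delta>) :: (real^'d) measure" ..
  let ?Q = "\<lambda>n. Pi\<^sub>M {..<n} (\<lambda>_::nat. gauss (sqrt \<Delta>) :: (real^'d) measure)"
  have sets: "sets (?Q n) = sets (Pi\<^sub>M {..<n} (\<lambda>_. borel))" for n by (intro sets_PiM_cong) auto
  have Bm[measurable]: "B t \<in> borel_measurable M" for t using BM by (simp add: brownian_motion_def)
  have Dm[measurable]: "D n \<in> M \<rightarrow>\<^sub>M Pi\<^sub>M {..<n} (\<lambda>_. borel)" for n unfolding D_def by measurable
  have distr: "distr M (Pi\<^sub>M {..<Suc k} (\<lambda>_. borel)) (D (Suc k)) = ?Q (Suc k)"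
    unfolding D_def by (rule brownian_increments_distr[OF BM \<Delta>]) simp
  have Qins: "?Q (Suc k) = Pi\<^sub>M (insert k {..<k}) (\<lambda>_. gauss (sqrt \<Delta>))" by (simp add: lessThan_Suc)
  have HQ: "H \<in> borel_measurable (?Q (Suc k))" using H by (simp add: measurable_cong_sets[OF sets refl])
  have rm[measurable]: "(\<lambda>x. restrict x {..<k}) \<in> Pi\<^sub>M {..<Suc k} (\<lambda>_. borel :: (real^'d) measure) \<rightarrow>\<^sub>M Pi\<^sub>M {..<k} (\<lambda>_. borel)"
    by (rule measurable_restrict_subset) auto
  have bQ: "(\<lambda>x. b (restrict x {..<k})) \<in> borel_measurable (?Q (Suc k))"
    unfolding measurable_cong_sets[OF sets refl] by measurable
  have "(\<integral>\<^sup>+\<omega>. H (D (Suc k) \<omega>) \<partial>M) = (\<integral>\<^sup>+x. H x \<partial>?Q (Suc k))"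
    unfolding distr[symmetric] by (subst nn_integral_distr) auto
  also have "\<dots> = (\<integral>\<^sup>+x. (\<integral>\<^sup>+y. H (x(k := y)) \<partial>gauss (sqrt \<Delta>)) \<partial>?Q k)"
    using HQ unfolding Qins by (intro P.product_nn_integral_insert) auto
  also have "\<dots> \<le> (\<integral>\<^sup>+x. b x \<partial>?Q k)" by (intro nn_integral_mono le)
  \<comment> \<open>A dummy integration over coordinate k brings \<open>b\<close> back to k + 1
    coordinates. The law of the increments is thus used for Suc k alone, which also covers k = 0,
    where there are no increments.\<close>
  also have "\<dots> = (\<integral>\<^sup>+x. (\<integral>\<^sup>+y. b (restrict (x(k := y)) {..<k}) \<partial>gauss (sqrt \<Delta>)) \<partial>?Q k)"
  proof (rule nn_integral_cong)
    fix x assume "x \<in> space (?Q k)"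
    then have "restrict (x(k := y)) {..<k} = x" for y
      by (auto simp: space_PiM PiE_def extensional_def restrict_def fun_eq_iff)
    then show "b x = (\<integral>\<^sup>+y. b (restrict (x(k := y)) {..<k}) \<partial>gauss (sqrt \<Delta>))"
      using G.emeasure_space_1 by simp
  qed
  also have "\<dots> = (\<integral>\<^sup>+x. b (restrict x {..<k}) \<partial>?Q (Suc k))"
    using bQ unfolding Qins by (intro P.product_nn_integral_insert[symmetric]) auto
  also have "\<dots> = (\<integral>\<^sup>+\<omega>. b (restrict (D (Suc k) \<omega>) {..<k}) \<partial>M)"
    unfolding distr[symmetric] by (subst nn_integral_distr) auto
  also have "\<dots> = (\<integral>\<^sup>+\<omega>. b (D k \<omega>) \<partial>M)"
    by (intro nn_integral_cong arg_cong[where f=b]) (auto simp: D_def restrict_def fun_eq_iff)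
  finally show ?thesis .
qed

section \<open>Moment recursion for the scheme\<close>

text \<open>Existence comes from the intermediate value theorem and the limit at infinity;
  uniqueness, required by \<open>THE\<close>, from strict monotonicity.\<close>

lemma Gamma_inv_properties:
  assumes mono: "strict_mono_on {1..} \<Gamma>" and cont: "continuous_on {1..} \<Gamma>"
    and lim: "filterlim \<Gamma> at_top at_top" and y: "\<Gamma> 1 \<le> y"
  shows "1 \<le> Gamma_inv \<Gamma> y" "\<Gamma> (Gamma_inv \<Gamma> y) = y"
proof -
  have "eventually (\<lambda>l. y \<le> \<Gamma> l \<and> 1 \<le> l) at_top"
    using lim by (intro eventually_conj eventually_ge_at_top) (simp add: filterlim_at_top)
  then obtain u where u: "y \<le> \<Gamma> u" "1 \<le> u" unfolding eventually_at_top_linorder by auto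
  have "\<exists>l\<ge>1. l \<le> u \<and> \<Gamma> l = y"
    using u y by (intro IVT') (auto intro: continuous_on_subset[OF cont])
  then obtain l where l: "1 \<le> l" "\<Gamma> l = y" by auto
  have "Gamma_inv \<Gamma> y = l" unfolding Gamma_inv_def
    using l strict_mono_on_imp_inj_on[OF mono] by (intro the_equality) (auto simp: inj_on_def)
  then show "1 \<le> Gamma_inv \<Gamma> y" "\<Gamma> (Gamma_inv \<Gamma> y) = y" using l by auto
qed

text \<open>The bound defining \<Gamma> is a bound on quotients, and division by 0 yields 0, so it
  carries information only where \<open>Psi\<close> is positive. Members of \<open>Cset\<close>
  vanish off the interval, hence a nonzero one is nonzero at a point of it.\<close>

lemma Psi_pos:
  assumes \<tau>: "\<tau> > 0" and \<phi>: "\<phi> \<in> Cset \<tau>" "\<phi> \<noteq> (\<lambda>_. 0)"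
  shows "Psi \<tau> \<phi> (\<lambda>_. 0) > 0"
proof -
  have c: "continuous_on {-\<tau>..0} (\<lambda>\<theta>. (norm (\<phi> \<theta>))\<^sup>2)"
    using \<phi> by (intro continuous_intros) (auto simp: Cset_def)
  obtain \<theta> where \<theta>: "\<phi> \<theta> \<noteq> 0" using \<phi> by auto
  then have "\<theta> \<in> {-\<tau>..0}" using \<phi> by (auto simp: Cset_def)
  then have "integral {-\<tau>..0} (\<lambda>\<theta>. (norm (\<phi> \<theta>))\<^sup>2) \<noteq> 0"
    using integral_eq_0_iff[OF c] \<tau> \<theta> by auto
  moreover have "integral {-\<tau>..0} (\<lambda>\<theta>. (norm (\<phi> \<theta>))\<^sup>2) \<ge> 0"
    using c by (intro integral_nonneg integrable_continuous_interval) auto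
  ultimately have "integral {-\<tau>..0} (\<lambda>\<theta>. (norm (\<phi> \<theta>))\<^sup>2) > 0" by linarith
  then show ?thesis using \<tau> by (simp add: Psi_def add_nonneg_pos)
qed

text \<open>Comparison with the zero path turns the Lipschitz quotients into linear growth. It is
  applied with l the truncation radius and with \<open>K * \<Delta> powr (-lam)\<close>, the value
  of \<Gamma> there, in the role of K. The factor 2 accounts for the values at the zero
  path.\<close>

lemma truncated_growth:
  fixes f :: "(real \<Rightarrow> real^'n) \<Rightarrow> real^'n" and g :: "(real \<Rightarrow> real^'n) \<Rightarrow> real^'d^'n"
  assumes \<tau>: "\<tau> > 0" and l: "l \<ge> 1"
    and bound: "\<forall>l\<ge>1. \<forall>\<phi>\<in>Cset \<tau>. \<forall>\<phi>'\<in>Cset \<tau>.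
              supnorm \<tau> \<phi> \<le> l \<and> supnorm \<tau> \<phi>' \<le> l \<and> \<phi> \<noteq> \<phi>' \<longrightarrow>
              norm (f \<phi> - f \<phi>') / sqrt (Psi \<tau> \<phi> \<phi>') \<le> \<Gamma> l
              \<and> (norm (g \<phi> - g \<phi>'))\<^sup>2 / Psi \<tau> \<phi> \<phi>' \<le> \<Gamma> l"
    and K: "\<Gamma> l \<le> K" "norm (f (\<lambda>_. 0)) \<le> K" "(norm (g (\<lambda>_. 0)))\<^sup>2 \<le> K"
    and \<phi>: "\<phi> \<in> Cset \<tau>" "supnorm \<tau> \<phi> \<le> l" and P: "1 + Psi \<tau> \<phi> (\<lambda>_. 0) \<le> P"
  shows "norm (f \<phi>) \<le> 2 * K * sqrt P" "(norm (g \<phi>))\<^sup>2 \<le> 2 * K * P"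
proof -
  let ?o = "\<lambda>_::real. 0 :: real^'n"
  define \<psi> where "\<psi> = Psi \<tau> \<phi> ?o"
  have o: "?o \<in> Cset \<tau>" by (simp add: Cset_def)
  have so: "supnorm \<tau> ?o \<le> l" using \<tau> l by (simp add: supnorm_def image_constant_conv)
  have K0: "K \<ge> 0" using K(2) norm_ge_zero[of "f ?o"] by linarith
  have \<psi>0: "\<psi> \<ge> 0" using Psi_pos[OF \<tau> \<phi>(1)] \<tau> by (cases "\<phi> = ?o") (auto simp: \<psi>_def Psi_def)
  have P1: "P \<ge> 1" "\<psi> \<le> P" "1 + \<psi> \<le> P" using P \<psi>0 by (auto simp: \<psi>_def)
  have df: "norm (f \<phi> - f ?o) \<le> K * sqrt \<psi>" and dg: "(norm (g \<phi> - g ?o))\<^sup>2 \<le> K * \<psi>"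
  proof -
    have "norm (f \<phi> - f ?o) \<le> K * sqrt \<psi> \<and> (norm (g \<phi> - g ?o))\<^sup>2 \<le> K * \<psi>"
    proof (cases "\<phi> = ?o")
      case True
      then show ?thesis using K0 \<psi>0 by simp
    next
      case False
      then have pos: "\<psi> > 0" using Psi_pos[OF \<tau> \<phi>(1)] by (simp add: \<psi>_def)
      have "norm (f \<phi> - f ?o) / sqrt \<psi> \<le> \<Gamma> l \<and> (norm (g \<phi> - g ?o))\<^sup>2 / \<psi> \<le> \<Gamma> l"
        unfolding \<psi>_def using bound l \<phi> o so False by blast
      then have "norm (f \<phi> - f ?o) / sqrt \<psi> \<le> K" "(norm (g \<phi> - g ?o))\<^sup>2 / \<psi> \<le> K" using K(1) by linarith+
      then show ?thesis using pos by (simp add: pos_divide_le_eq)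
    qed
    then show "norm (f \<phi> - f ?o) \<le> K * sqrt \<psi>" "(norm (g \<phi> - g ?o))\<^sup>2 \<le> K * \<psi>" by auto
  qed
  have "norm (f \<phi>) \<le> norm (f ?o) + norm (f \<phi> - f ?o)" by (metis add.commute diff_add_cancel norm_triangle_ineq)
  also have "\<dots> \<le> K * sqrt P + K * sqrt P"
  proof (rule add_mono)
    have "K * 1 \<le> K * sqrt P" using K0 P1 by (intro mult_left_mono) auto
    then show "norm (f ?o) \<le> K * sqrt P" using K by linarith
    have "K * sqrt \<psi> \<le> K * sqrt P" using K0 P1 by (intro mult_left_mono) auto
    then show "norm (f \<phi> - f ?o) \<le> K * sqrt P" using df by linarith
  qed
  finally show "norm (f \<phi>) \<le> 2 * K * sqrt P" by simp
  have "norm (g \<phi>) \<le> norm (g ?o) + norm (g \<phi> - g ?o)" by (metis add.commute diff_add_cancel norm_triangle_ineq)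
  then have "(norm (g \<phi>))\<^sup>2 \<le> (norm (g ?o) + norm (g \<phi> - g ?o))\<^sup>2" by (intro power_mono) auto
  also have "\<dots> \<le> 2 * (norm (g ?o))\<^sup>2 + 2 * (norm (g \<phi> - g ?o))\<^sup>2"
    using zero_le_power2[of "norm (g ?o) - norm (g \<phi> - g ?o)"] by (simp add: power2_sum power2_diff)
  also have "\<dots> \<le> 2 * (K * (1 + \<psi>))" using K dg by (simp add: distrib_left)
  also have "\<dots> \<le> 2 * (K * P)" using K0 P1 by (intro mult_left_mono) auto
  finally show "(norm (g \<phi>))\<^sup>2 \<le> 2 * K * P" by simp
qed

text \<open>The restriction to \<open>{..<n}\<close> makes the increments a point of the product
  space over n coordinates.\<close>

definition incr :: "(real \<Rightarrow> 'a \<Rightarrow> real^'d) \<Rightarrow> real \<Rightarrow> nat \<Rightarrow> 'a \<Rightarrow> nat \<Rightarrow> real^'d" where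
  "incr B \<Delta> n \<omega> = (\<lambda>i\<in>{..<n}. B (real (Suc i) * \<Delta>) \<omega> - B (real i * \<Delta>) \<omega>)"

lemma breve_seq_eq_incr:
  "k \<le> n \<Longrightarrow> breve_seq f g B \<xi> \<Delta> N h \<omega> k = driven_seq f g \<xi> \<Delta> N h (incr B \<Delta> n \<omega>) k"
  unfolding breve_seq_eq_driven_seq by (rule driven_seq_cong) (simp add: incr_def)

text \<open>The hypothesis \<open>step\<close> concerns deterministic configurations bounded by h;
  truncation ensures that every realisation is one. Truncating the new value can only lower its
  norm, and X <= 1 + h^2 makes all expectations finite, so the bound can be integrated term by
  term.\<close>

lemma moment_recursion:
  fixes f :: "(real \<Rightarrow> real^'n) \<Rightarrow> real^'n" and g :: "(real \<Rightarrow> real^'n) \<Rightarrow> real^'d^'n" and B :: "real \<Rightarrow> 'a \<Rightarrow> real^'d" and \<xi> :: "real \<Rightarrow> real^'n"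
  assumes BM: "brownian_motion M B" and f: "delay_lipschitz_on \<tau> h f" and g: "delay_lipschitz_on \<tau> h g"
    and h: "h > 0" and \<Delta>: "\<Delta> > 0" and N: "N > 0" and \<tau>: "real N * \<Delta> = \<tau>" and q: "q \<ge> 0" "m \<ge> 0"
    and step: "\<And>Y k. (\<And>j. norm (Y j) \<le> h) \<Longrightarrow>
      (\<integral>\<^sup>+y. ennreal ((1 + (norm (Y k + \<Delta> *\<^sub>R f (interp \<Delta> N Y k) + g (interp \<Delta> N Y k) *v y))\<^sup>2) powr q) \<partial>gauss (sqrt \<Delta>))
      \<le> ennreal ((1 + (norm (Y k))\<^sup>2) powr q + \<Delta> * (K - \<alpha> * (1 + (norm (Y k))\<^sup>2) powr m
          + (\<Sum>i\<le>N. b i * (1 + (norm (Y (k - int i)))\<^sup>2) powr m)))"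
  defines "X \<equiv> \<lambda>j \<omega>. 1 + (norm (trunc h (breve_seq f g B \<xi> \<Delta> N h \<omega> (nat j) j)))\<^sup>2"
  shows "X j \<in> borel_measurable M"
    and "(\<integral>\<omega>. X (int (Suc k)) \<omega> powr q \<partial>M) \<le> (\<integral>\<omega>. X (int k) \<omega> powr q \<partial>M)
      + \<Delta> * (K - \<alpha> * (\<integral>\<omega>. X (int k) \<omega> powr m \<partial>M) + (\<Sum>i\<le>N. b i * (\<integral>\<omega>. X (int k - int i) \<omega> powr m \<partial>M)))"
proof -
  interpret prob_space M using BM by (simp add: brownian_motion_def)
  let ?S = "driven_seq f g \<xi> \<Delta> N h"
  have Bm[measurable]: "B t \<in> borel_measurable M" for t using BM by (simp add: brownian_motion_def)
  have Dm[measurable]: "incr B \<Delta> n \<in> M \<rightarrow>\<^sub>M Pi\<^sub>M {..<n} (\<lambda>_. borel)" for n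
    unfolding incr_def[abs_def] by measurable
  have Sm[measurable]: "(\<lambda>d. ?S d k j) \<in> borel_measurable (Pi\<^sub>M {..<n} (\<lambda>_. borel))" if "k \<le> n" for k n j
    by (rule borel_measurable_driven_seq[OF f g h \<Delta> N \<tau> that])
  have Xm[measurable]: "X j \<in> borel_measurable M" for j
  proof -
    have "(\<lambda>\<omega>. breve_seq f g B \<xi> \<Delta> N h \<omega> (nat j) j) \<in> borel_measurable M"
      unfolding breve_seq_eq_incr[OF order_refl] by (rule measurable_compose[OF Dm Sm]) simp
    from borel_measurable_trunc[OF h this] have [measurable]: "(\<lambda>\<omega>. trunc h (breve_seq f g B \<xi> \<Delta> N h \<omega> (nat j) j)) \<in> borel_measurable M" .
    show ?thesis unfolding X_def by measurable
  qed
  show "X j \<in> borel_measurable M" by (rule Xm)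
  have nt: "norm (trunc h x) \<le> h" "norm (trunc h x) \<le> norm x" for x :: "real^'n" using h by (simp_all add: norm_trunc)
  have X1: "1 \<le> X j \<omega>" and Xh: "X j \<omega> \<le> 1 + h\<^sup>2" for j \<omega> using nt by (auto simp: X_def intro!: power_mono)
  have int: "integrable M (\<lambda>\<omega>. X j \<omega> powr r)" if "r \<ge> 0" for j r
  proof (rule integrable_const_bound[where B="(1 + h\<^sup>2) powr r"])
    have "X j \<omega> powr r \<le> (1 + h\<^sup>2) powr r" for \<omega>
      using X1[of j \<omega>] Xh[of j \<omega>] that by (intro powr_mono2) auto
    then show "AE \<omega> in M. norm (X j \<omega> powr r) \<le> (1 + h\<^sup>2) powr r" by simp
  qed measurable
  define T where "T d j = trunc h (?S d k j)" for d j
  \<comment> \<open>Entries of the sequence are never overwritten, so all values up to time k can be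
    read from the one sequence after k steps.\<close>
  have Xeq: "X j \<omega> = 1 + (norm (T (incr B \<Delta> k \<omega>) j))\<^sup>2" if "j \<le> int k" for j \<omega>
  proof -
    have "nat j \<le> k" using that by simp
    then show ?thesis
      using driven_seq_stable[OF that, where f=f and g=g and \<xi>=\<xi> and \<Delta>=\<Delta> and N=N and h=h and d="incr B \<Delta> k \<omega>"]
      by (simp add: X_def T_def breve_seq_eq_incr)
  qed
  define bd where "bd d = (1 + (norm (T d (int k)))\<^sup>2) powr q + \<Delta> * (K - \<alpha> * (1 + (norm (T d (int k)))\<^sup>2) powr m
      + (\<Sum>i\<le>N. b i * (1 + (norm (T d (int k - int i)))\<^sup>2) powr m))" for d
  have [measurable]: "(\<lambda>d. T d j) \<in> borel_measurable (Pi\<^sub>M {..<k} (\<lambda>_. borel))" for j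
    unfolding T_def by (rule borel_measurable_trunc[OF h Sm]) simp
  have [measurable]: "(\<lambda>d. ?S d (Suc k) (int (Suc k))) \<in> borel_measurable (Pi\<^sub>M {..<Suc k} (\<lambda>_. borel))" by (rule Sm) simp
  have kernel: "(\<integral>\<^sup>+y. ennreal ((1 + (norm (?S (d(k := y)) (Suc k) (int (Suc k))))\<^sup>2) powr q) \<partial>gauss (sqrt \<Delta>)) \<le> ennreal (bd d)" for d
  proof -
    have "?S (d(k := y)) k = ?S d k" for y by (rule driven_seq_cong) simp
    then have "?S (d(k := y)) (Suc k) (int (Suc k)) = T d (int k) + \<Delta> *\<^sub>R f (interp \<Delta> N (T d) (int k)) + g (interp \<Delta> N (T d) (int k)) *v y" for y
      by (simp add: T_def[abs_def] add.commute)
    then show ?thesis unfolding bd_def using step[of "T d" "int k"] nt by (simp add: T_def)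
  qed
  \<comment> \<open>Because of the dissipative term \<open>bd\<close> has no evident sign, and
    \<open>ennreal\<close> would send a negative value to 0. But the integral it dominates is at
    least 1, since the integrand is, so \<open>bd\<close> is positive.\<close>
  have bd_pos: "0 \<le> bd d" for d
  proof -
    interpret G: prob_space "gauss (sqrt \<Delta>) :: (real^'d) measure" using \<Delta> by (intro prob_space_gauss) simp
    have "(1::ennreal) = (\<integral>\<^sup>+(y::real^'d). 1 \<partial>gauss (sqrt \<Delta>))" using G.emeasure_space_1 by simp
    also have "\<dots> \<le> (\<integral>\<^sup>+y. ennreal ((1 + (norm (?S (d(k := y)) (Suc k) (int (Suc k))))\<^sup>2) powr q) \<partial>gauss (sqrt \<Delta>))"
      using q by (intro nn_integral_mono) (auto simp del: driven_seq.simps intro!: ge_one_powr_ge_zero)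
    also have "\<dots> \<le> ennreal (bd d)" by (rule kernel)
    finally show ?thesis by (metis ennreal_neg linorder_le_cases not_one_le_zero)
  qed
  have bdeq: "bd (incr B \<Delta> k \<omega>) = X (int k) \<omega> powr q + \<Delta> * (K - \<alpha> * X (int k) \<omega> powr m
      + (\<Sum>i\<le>N. b i * X (int k - int i) \<omega> powr m))" for \<omega>
    unfolding bd_def by (simp add: Xeq)
  have bdint: "integrable M (\<lambda>\<omega>. bd (incr B \<Delta> k \<omega>))"
    unfolding bdeq using int q by (intro Bochner_Integration.integrable_add Bochner_Integration.integrable_diff
        Bochner_Integration.integrable_sum integrable_mult_right integrable_const) auto
  have "ennreal (\<integral>\<omega>. X (int (Suc k)) \<omega> powr q \<partial>M) = (\<integral>\<^sup>+\<omega>. ennreal (X (int (Suc k)) \<omega> powr q) \<partial>M)"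
    using int[OF q(1)] by (intro nn_integral_eq_integral[symmetric]) auto
  also have "\<dots> \<le> (\<integral>\<^sup>+\<omega>. ennreal ((1 + (norm (?S (incr B \<Delta> (Suc k) \<omega>) (Suc k) (int (Suc k))))\<^sup>2) powr q) \<partial>M)"
  proof (intro nn_integral_mono ennreal_leI powr_mono2 q)
    fix \<omega>
    show "X (int (Suc k)) \<omega> \<le> 1 + (norm (?S (incr B \<Delta> (Suc k) \<omega>) (Suc k) (int (Suc k))))\<^sup>2"
      unfolding X_def nat_int breve_seq_eq_incr[OF order_refl] using nt by (intro add_left_mono power_mono) auto
    show "0 \<le> X (int (Suc k)) \<omega>" using X1[of "int (Suc k)" \<omega>] by linarith
  qed
  also have "\<dots> \<le> (\<integral>\<^sup>+\<omega>. ennreal (bd (incr B \<Delta> k \<omega>)) \<partial>M)"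
    unfolding incr_def
    by (rule brownian_expectation_step[OF BM \<Delta> _ _ kernel]) (unfold bd_def, measurable)
  also have "\<dots> = ennreal (\<integral>\<omega>. bd (incr B \<Delta> k \<omega>) \<partial>M)"
    using bdint bd_pos by (intro nn_integral_eq_integral) auto
  finally have "(\<integral>\<omega>. X (int (Suc k)) \<omega> powr q \<partial>M) \<le> (\<integral>\<omega>. bd (incr B \<Delta> k \<omega>) \<partial>M)"
    using bd_pos by (subst (asm) ennreal_le_iff) (auto intro!: Bochner_Integration.integral_nonneg)
  also have "\<dots> = (\<integral>\<omega>. X (int k) \<omega> powr q \<partial>M)
      + \<Delta> * (K - \<alpha> * (\<integral>\<omega>. X (int k) \<omega> powr m \<partial>M) + (\<Sum>i\<le>N. b i * (\<integral>\<omega>. X (int k - int i) \<omega> powr m \<partial>M)))"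
    unfolding bdeq using int q prob_space by (simp add: Bochner_Integration.integral_sum)
  finally show "(\<integral>\<omega>. X (int (Suc k)) \<omega> powr q \<partial>M) \<le> (\<integral>\<omega>. X (int k) \<omega> powr q \<partial>M)
      + \<Delta> * (K - \<alpha> * (\<integral>\<omega>. X (int k) \<omega> powr m \<partial>M) + (\<Sum>i\<le>N. b i * (\<integral>\<omega>. X (int k - int i) \<omega> powr m \<partial>M)))" .
qed

section \<open>Uniform one-step inequality and the final bound\<close>

lemma delay_lipschitz_onI:
  assumes A1: "\<forall>ell>0. \<exists>R>0. \<forall>\<phi>\<in>Cset \<tau>. \<forall>\<phi>'\<in>Cset \<tau>. supnorm \<tau> \<phi> \<le> ell \<and> supnorm \<tau> \<phi>' \<le> ell \<longrightarrow>
      norm (F \<phi> - F \<phi>') \<le> R * (norm (\<phi> 0 - \<phi>' 0) + (1/\<tau>) * integral {-\<tau>..0} (\<lambda>\<theta>. norm (\<phi> \<theta> - \<phi>' \<theta>)))"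
    and h: "h > 0"
  shows "delay_lipschitz_on \<tau> h F"
proof -
  obtain R where "R > 0" "\<forall>\<phi>\<in>Cset \<tau>. \<forall>\<phi>'\<in>Cset \<tau>. supnorm \<tau> \<phi> \<le> h \<and> supnorm \<tau> \<phi>' \<le> h \<longrightarrow>
      norm (F \<phi> - F \<phi>') \<le> R * (norm (\<phi> 0 - \<phi>' 0) + (1/\<tau>) * integral {-\<tau>..0} (\<lambda>\<theta>. norm (\<phi> \<theta> - \<phi>' \<theta>)))"
    using A1 h by blast
  then show ?thesis unfolding delay_lipschitz_on_def by (intro exI[of _ R]) auto
qed

text \<open>At \<gamma> = 0 the left side equals \<beta> < \<alpha>, and it is continuous in
  \<gamma>. The choice involves \<tau> but no step size.\<close>

lemma exponential_gap:
  fixes \<alpha> \<beta> \<tau> :: real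
  assumes "\<beta> < \<alpha>"
  obtains \<gamma> where "\<gamma> > 0" "\<gamma> + \<beta> * exp (\<gamma> * \<tau>) \<le> \<alpha>"
proof -
  have "((\<lambda>\<gamma>. \<gamma> + \<beta> * exp (\<gamma> * \<tau>)) \<longlongrightarrow> 0 + \<beta> * exp (0 * \<tau>)) (at_right 0)"
    by (intro tendsto_intros)
  then have "eventually (\<lambda>\<gamma>. \<gamma> + \<beta> * exp (\<gamma> * \<tau>) < \<alpha>) (at_right 0)"
    using assms by (intro order_tendstoD) auto
  then have "eventually (\<lambda>\<gamma>. \<gamma> + \<beta> * exp (\<gamma> * \<tau>) < \<alpha> \<and> \<gamma> > 0) (at_right 0)"
    by (intro eventually_conj eventually_at_right_less)
  then obtain \<gamma> where "\<gamma> + \<beta> * exp (\<gamma> * \<tau>) < \<alpha>" "\<gamma> > 0"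
    using eventually_happens[of _ "at_right (0::real)"] by (auto simp: trivial_limit_at_right_real)
  then show ?thesis using that by (simp add: less_imp_le)
qed

text \<open>The order of quantifiers is the point: threshold, constants and total delay weight are
  fixed before N and the truncation radius h appear. Only the individual coefficients
  \<open>b\<close> vary with \<Delta>, and their sum is bounded by \<beta>.\<close>

lemma dissipative_scheme_step:
  fixes f :: "(real \<Rightarrow> real^'n) \<Rightarrow> real^'n" and g :: "(real \<Rightarrow> real^'n) \<Rightarrow> real^'d^'n"
  assumes \<tau>: "\<tau> > 0" and q: "q \<ge> 1" and s: "s > 1" and a: "a1 > 0" "a2 > 0" "a3 > 0" "a2 > a3"
    and K: "K \<ge> 0" and lam: "lam \<le> 1/2" "lam \<ge> 0" and \<rho>1: "\<rho>1 \<in> Wset \<tau>"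
    and A2: "\<And>\<phi>. \<phi> \<in> Cset \<tau> \<Longrightarrow> 2 * (\<phi> 0 \<bullet> f \<phi>) + (2 * q - 1) * (norm (g \<phi>))\<^sup>2
              \<le> a1 * (1 + (norm (\<phi> 0))\<^sup>2 + (1/\<tau>) * integral {-\<tau>..0} (\<lambda>\<theta>. (norm (\<phi> \<theta>))\<^sup>2))
                 - a2 * norm (\<phi> 0) powr (2 * s)
                 + a3 * integral {-\<tau>..0} (\<lambda>\<theta>. norm (\<phi> \<theta>) powr (2 * s) * \<rho>1 \<theta>)"
  obtains \<Delta>0 C \<alpha> \<beta> b where "\<Delta>0 > 0" "C \<ge> 0" "\<beta> \<ge> 0" "\<beta> < \<alpha>"
    "\<And>\<Delta> i. 0 \<le> b \<Delta> i" "\<And>\<Delta> N. 0 < \<Delta> \<Longrightarrow> 0 < N \<Longrightarrow> real N * \<Delta> = \<tau> \<Longrightarrow> (\<Sum>i\<le>N. b \<Delta> i) \<le> \<beta>"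
    "\<And>\<Delta> N h Y k. 0 < \<Delta> \<Longrightarrow> \<Delta> \<le> 1 \<Longrightarrow> \<Delta> \<le> \<Delta>0 \<Longrightarrow> 0 < N \<Longrightarrow> real N * \<Delta> = \<tau> \<Longrightarrow>
      (\<And>\<phi> P. \<phi> \<in> Cset \<tau> \<Longrightarrow> supnorm \<tau> \<phi> \<le> h \<Longrightarrow> 1 + Psi \<tau> \<phi> (\<lambda>_. 0) \<le> P \<Longrightarrow>
        norm (f \<phi>) \<le> 2 * (K * \<Delta> powr (-lam)) * sqrt P \<and> (norm (g \<phi>))\<^sup>2 \<le> 2 * (K * \<Delta> powr (-lam)) * P) \<Longrightarrow>
      (\<And>j. norm (Y j) \<le> h) \<Longrightarrow>
      (\<integral>\<^sup>+y. ennreal ((1 + (norm (Y k + \<Delta> *\<^sub>R f (interp \<Delta> N Y k) + g (interp \<Delta> N Y k) *v y))\<^sup>2) powr q) \<partial>gauss (sqrt \<Delta>))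
      \<le> ennreal ((1 + (norm (Y k))\<^sup>2) powr q + \<Delta> * (C - \<alpha> * (1 + (norm (Y k))\<^sup>2) powr (q + s - 1)
          + (\<Sum>i\<le>N. b \<Delta> i * (1 + (norm (Y (k - int i)))\<^sup>2) powr (q + s - 1))))"
proof -
  \<comment> \<open>Growth of the coefficients needs 2 K; 4 K, \<open>a1\<close> and
    \<open>a3\<close> come from the second bound on g, where twice the inner product with f is moved
    to the right.\<close>
  define \<kappa> where "\<kappa> = 1 + 4 * K + a1 + a3"
  have \<kappa>: "\<kappa> \<ge> 1" "2 * K \<le> \<kappa>" "4 * K \<le> \<kappa>" "a1 \<le> \<kappa>" "a3 \<le> \<kappa>" using K a by (auto simp: \<kappa>_def)
  obtain C1 C2 where C: "C1 \<ge> 0" "C2 \<ge> 0" "q = 1 \<Longrightarrow> C2 = 0"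
    and gstep: "\<And>\<Delta> lam (x::real^'n) a (G::real^'d^'n) P W. 0 < \<Delta> \<Longrightarrow> \<Delta> \<le> 1 \<Longrightarrow> lam \<le> 1/2 \<Longrightarrow>
      1 + (norm x)\<^sup>2 \<le> P \<Longrightarrow> 0 \<le> W \<Longrightarrow> norm a \<le> \<kappa> * (\<Delta> powr (-lam) * sqrt P) \<Longrightarrow>
      (norm G)\<^sup>2 \<le> \<kappa> * (\<Delta> powr (-lam) * P) \<Longrightarrow>
      (norm G)\<^sup>2 \<le> \<kappa> * (\<Delta> powr (-lam) * (sqrt (1 + (norm x)\<^sup>2) * sqrt P) + (P + W)) \<Longrightarrow>
      (\<integral>\<^sup>+y. ennreal ((1 + (norm (x + \<Delta> *\<^sub>R a + G *v y))\<^sup>2) powr q) \<partial>gauss (sqrt \<Delta>))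
      \<le> ennreal ((1 + (norm x)\<^sup>2) powr q
          + q * \<Delta> * (1 + (norm x)\<^sup>2) powr (q - 1) * (2 * (x \<bullet> a) + (2 * q - 1) * (norm G)\<^sup>2)
          + \<Delta> * (C1 * P powr q + C2 * \<Delta> powr ((q - 1) / 2) * (W * P powr (q - 1))))"
    using gauss_step_bound[OF q \<kappa>(1), where 'n='n and 'd='d] by blast
  show ?thesis
  proof (rule dissipative_step[OF q s a C])
    fix \<Delta>0 C \<alpha> \<beta>1 \<beta>2
    assume D: "\<Delta>0 > 0" "C \<ge> 0" "\<beta>1 \<ge> 0" "\<beta>2 \<ge> 0" "\<beta>1 + \<beta>2 < \<alpha>"
      and dstep: "\<And>\<Delta> N w w' zs X D. 0 < \<Delta> \<Longrightarrow> \<Delta> \<le> \<Delta>0 \<Longrightarrow> (\<And>i. 0 \<le> w i) \<Longrightarrow> (\<And>i. 0 \<le> w' i) \<Longrightarrow>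
        (\<Sum>i\<le>N::nat. w i) = 1 \<Longrightarrow> (\<Sum>i\<le>N. w' i) = 1 \<Longrightarrow> (\<And>i. 1 \<le> zs i) \<Longrightarrow> 0 \<le> X \<Longrightarrow> zs 0 = 1 + X\<^sup>2 \<Longrightarrow>
        D \<le> a1 * (zs 0 + (\<Sum>i\<le>N. w' i * zs i)) - a2 * X powr (2 * s) + a3 * (\<Sum>i\<le>N. w i * zs i powr s) \<Longrightarrow>
        zs 0 powr q + q * \<Delta> * zs 0 powr (q - 1) * D
          + \<Delta> * (C1 * (zs 0 + (\<Sum>i\<le>N. w' i * zs i)) powr q
             + C2 * \<Delta> powr ((q - 1) / 2) * ((\<Sum>i\<le>N. w i * zs i powr s) * (zs 0 + (\<Sum>i\<le>N. w' i * zs i)) powr (q - 1)))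
        \<le> zs 0 powr q + \<Delta> * (C - \<alpha> * zs 0 powr (q + s - 1) + (\<Sum>i\<le>N. (\<beta>1 * w i + \<beta>2 * w' i) * zs i powr (q + s - 1)))"
    define w where "w \<Delta> i = hat_weight \<tau> \<Delta> \<rho>1 i" for \<Delta> i
    define w' where "w' \<Delta> i = hat_weight \<tau> \<Delta> (\<lambda>_. 1 / \<tau>) i" for \<Delta> i
    have w0: "0 \<le> w \<Delta> i" "0 \<le> w' \<Delta> i" for \<Delta> i
      unfolding w_def w'_def by (intro hat_weight_nonneg \<rho>1 uniform_in_Wset \<tau>)+
    have w1: "(\<Sum>i\<le>N. w \<Delta> i) = 1" "(\<Sum>i\<le>N. w' \<Delta> i) = 1" if "0 < \<Delta>" "0 < N" "real N * \<Delta> = \<tau>" for \<Delta> N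
      unfolding w_def w'_def by (intro sum_hat_weight that \<rho>1 uniform_in_Wset \<tau>)+
    show ?thesis
    proof (rule that[of \<Delta>0 C "\<beta>1 + \<beta>2" \<alpha> "\<lambda>\<Delta> i. \<beta>1 * w \<Delta> i + \<beta>2 * w' \<Delta> i"])
      show "\<Delta>0 > 0" "C \<ge> 0" "\<beta>1 + \<beta>2 \<ge> 0" "\<beta>1 + \<beta>2 < \<alpha>" using D by auto
      show "0 \<le> \<beta>1 * w \<Delta> i + \<beta>2 * w' \<Delta> i" for \<Delta> i using D w0 by simp
      show "(\<Sum>i\<le>N. \<beta>1 * w \<Delta> i + \<beta>2 * w' \<Delta> i) \<le> \<beta>1 + \<beta>2" if "0 < \<Delta>" "0 < N" "real N * \<Delta> = \<tau>" for \<Delta> N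
        using w1[OF that] by (simp add: sum.distrib sum_distrib_left[symmetric])
      fix \<Delta> h :: real and N :: nat and Y :: "int \<Rightarrow> real^'n" and k :: int
      assume \<Delta>: "0 < \<Delta>" "\<Delta> \<le> 1" "\<Delta> \<le> \<Delta>0" and N: "0 < N" "real N * \<Delta> = \<tau>"
        and growth: "\<And>\<phi> P. \<phi> \<in> Cset \<tau> \<Longrightarrow> supnorm \<tau> \<phi> \<le> h \<Longrightarrow> 1 + Psi \<tau> \<phi> (\<lambda>_. 0) \<le> P \<Longrightarrow>
          norm (f \<phi>) \<le> 2 * (K * \<Delta> powr (-lam)) * sqrt P \<and> (norm (g \<phi>))\<^sup>2 \<le> 2 * (K * \<Delta> powr (-lam)) * P"
        and Y: "\<And>j. norm (Y j) \<le> h"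
      define \<phi> where "\<phi> = interp \<Delta> N Y k"
      define zs where "zs i = 1 + (norm (Y (k - int i)))\<^sup>2" for i
      define P where "P = zs 0 + (\<Sum>i\<le>N. w' \<Delta> i * zs i)"
      define W where "W = (\<Sum>i\<le>N. w \<Delta> i * zs i powr s)"
      define \<mu> where "\<mu> = \<Delta> powr (-lam)"
      have \<mu>: "\<mu> \<ge> 1" using \<Delta> lam powr_mono'[of "-lam" 0 \<Delta>] by (simp add: \<mu>_def)
      have zs: "1 \<le> zs i" "0 < zs i" "(norm (Y (k - int i)))\<^sup>2 \<le> zs i" for i
        by (auto simp: zs_def add_pos_nonneg)
      have \<phi>C: "\<phi> \<in> Cset \<tau>" unfolding \<phi>_def by (rule interp_in_Cset[OF \<Delta>(1) N])
      have \<phi>s: "supnorm \<tau> \<phi> \<le> h" unfolding \<phi>_def by (rule supnorm_interp_le[OF \<Delta>(1) N Y])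
      have \<phi>c: "continuous_on {-\<tau>..0} \<phi>" using \<phi>C by (simp add: Cset_def)
      have \<phi>0: "\<phi> 0 = Y k" using \<Delta> by (simp add: \<phi>_def)
      have zs0: "zs 0 = 1 + (norm (Y k))\<^sup>2" by (simp add: zs_def)
      have avg: "(1/\<tau>) * integral {-\<tau>..0} (\<lambda>\<theta>. (norm (\<phi> \<theta>))\<^sup>2) \<le> (\<Sum>i\<le>N. w' \<Delta> i * zs i)"
      proof -
        have "integral {-\<tau>..0} (\<lambda>\<theta>. (norm (\<phi> \<theta>))\<^sup>2 * (1 / \<tau>)) \<le> (\<Sum>i\<le>N. w' \<Delta> i * zs i)"
          unfolding w'_def
        proof (rule integral_le_hat_weight_sum[OF \<Delta>(1) N(1) uniform_in_Wset[OF \<tau>]])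
          show "continuous_on {-\<tau>..0} (\<lambda>\<theta>. (norm (\<phi> \<theta>))\<^sup>2)" using \<phi>c by (intro continuous_intros)
          show "(norm (\<phi> \<theta>))\<^sup>2 \<le> (\<Sum>i\<le>N. hat (\<theta> / \<Delta> + real i) * zs i)" if "\<theta> \<in> {-\<tau>..0}" for \<theta>
            unfolding \<phi>_def by (rule norm_interp_sq_le[OF \<Delta>(1) N(1)]) (use that N(2) zs in auto)
        qed
        then show ?thesis by (simp only: mult.commute[of _ "1 / \<tau>"] integral_mult_right)
      qed
      have delay: "integral {-\<tau>..0} (\<lambda>\<theta>. norm (\<phi> \<theta>) powr (2 * s) * \<rho>1 \<theta>) \<le> W"
        unfolding W_def w_def
      proof (rule integral_le_hat_weight_sum[OF \<Delta>(1) N(1) \<rho>1])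
        show "continuous_on {-\<tau>..0} (\<lambda>\<theta>. norm (\<phi> \<theta>) powr (2 * s))"
          using \<phi>c s by (intro continuous_on_powr' continuous_intros) auto
        show "norm (\<phi> \<theta>) powr (2 * s) \<le> (\<Sum>i\<le>N. hat (\<theta> / \<Delta> + real i) * zs i powr s)" if "\<theta> \<in> {-\<tau>..0}" for \<theta>
          unfolding \<phi>_def by (rule norm_interp_powr_le[OF \<Delta>(1) N(1)]) (use that N(2) zs s in auto)
      qed
      have W: "0 \<le> W" unfolding W_def using w0 by (intro sum_nonneg) auto
      have "0 \<le> w' \<Delta> i * zs i" for i using w0 zs(2)[of i] by simp
      then have zP: "zs 0 \<le> P" by (simp add: P_def sum_nonneg)
      have PsiP: "1 + Psi \<tau> \<phi> (\<lambda>_. 0) \<le> P"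
        using avg by (simp add: Psi_def P_def zs0 \<phi>0)
      have gf: "norm (f \<phi>) \<le> 2 * (K * \<mu>) * sqrt P" and gg: "(norm (g \<phi>))\<^sup>2 \<le> 2 * (K * \<mu>) * P"
        using growth[OF \<phi>C \<phi>s PsiP] by (auto simp: \<mu>_def)
      have P0: "P \<ge> 0" using zP zs(1)[of 0] by linarith
      have drift: "2 * (Y k \<bullet> f \<phi>) + (2 * q - 1) * (norm (g \<phi>))\<^sup>2 \<le> a1 * P - a2 * norm (Y k) powr (2 * s) + a3 * W"
      proof -
        have "a1 * (1 + (norm (\<phi> 0))\<^sup>2 + (1/\<tau>) * integral {-\<tau>..0} (\<lambda>\<theta>. (norm (\<phi> \<theta>))\<^sup>2)) \<le> a1 * P"
          using avg a by (intro mult_left_mono) (auto simp: P_def zs0 \<phi>0)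
        moreover have "a3 * integral {-\<tau>..0} (\<lambda>\<theta>. norm (\<phi> \<theta>) powr (2 * s) * \<rho>1 \<theta>) \<le> a3 * W"
          using delay a by (intro mult_left_mono) auto
        ultimately show ?thesis using A2[OF \<phi>C] unfolding \<phi>0 by linarith
      qed
      have b1: "norm (f \<phi>) \<le> \<kappa> * (\<mu> * sqrt P)"
      proof -
        have "2 * K * (\<mu> * sqrt P) \<le> \<kappa> * (\<mu> * sqrt P)" using \<kappa> \<mu> P0 by (intro mult_right_mono) auto
        then show ?thesis using gf by (simp add: mult.assoc)
      qed
      have b2: "(norm (g \<phi>))\<^sup>2 \<le> \<kappa> * (\<mu> * P)"
      proof -
        have "2 * K * (\<mu> * P) \<le> \<kappa> * (\<mu> * P)" using \<kappa> \<mu> P0 by (intro mult_right_mono) auto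
        then show ?thesis using gg by (simp add: mult.assoc)
      qed
      \<comment> \<open>The dissipativity condition solved for |g|^2: the coefficient 2 q - 1 is at
        least 1, the term with \<open>a2\<close> has a favourable sign, and the drift part is
        estimated by Cauchy-Schwarz. This retains the factor sqrt z that the remainder estimate
        relies on.\<close>
      have b3: "(norm (g \<phi>))\<^sup>2 \<le> \<kappa> * (\<mu> * (sqrt (zs 0) * sqrt P) + (P + W))"
      proof -
        have "1 * (norm (g \<phi>))\<^sup>2 \<le> (2 * q - 1) * (norm (g \<phi>))\<^sup>2" using q by (intro mult_right_mono) auto
        moreover have "0 \<le> a2 * norm (Y k) powr (2 * s)" using a by simp
        moreover have "\<bar>Y k \<bullet> f \<phi>\<bar> \<le> norm (Y k) * norm (f \<phi>)" by (rule Cauchy_Schwarz_ineq2)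
        moreover have "norm (Y k) * norm (f \<phi>) \<le> sqrt (zs 0) * (2 * (K * \<mu>) * sqrt P)"
          using gf zs[of 0] by (intro mult_mono real_le_rsqrt) auto
        ultimately have "(norm (g \<phi>))\<^sup>2 \<le> 4 * K * (\<mu> * (sqrt (zs 0) * sqrt P)) + a1 * P + a3 * W"
          using drift by (simp add: ac_simps)
        also have "\<dots> \<le> \<kappa> * (\<mu> * (sqrt (zs 0) * sqrt P)) + \<kappa> * P + \<kappa> * W"
          using \<kappa> \<mu> P0 W zs(2)[of 0] by (intro add_mono mult_right_mono) auto
        finally show ?thesis by (simp add: distrib_left)
      qed
      have "(\<integral>\<^sup>+y. ennreal ((1 + (norm (Y k + \<Delta> *\<^sub>R f \<phi> + g \<phi> *v y))\<^sup>2) powr q) \<partial>gauss (sqrt \<Delta>))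
        \<le> ennreal ((1 + (norm (Y k))\<^sup>2) powr q
            + q * \<Delta> * (1 + (norm (Y k))\<^sup>2) powr (q - 1) * (2 * (Y k \<bullet> f \<phi>) + (2 * q - 1) * (norm (g \<phi>))\<^sup>2)
            + \<Delta> * (C1 * P powr q + C2 * \<Delta> powr ((q - 1) / 2) * (W * P powr (q - 1))))"
        using zP b1 b2 b3 by (intro gstep[OF \<Delta>(1,2) lam(1) _ W]) (auto simp: zs0 \<mu>_def)
      also have "\<dots> \<le> ennreal (zs 0 powr q + \<Delta> * (C - \<alpha> * zs 0 powr (q + s - 1)
            + (\<Sum>i\<le>N. (\<beta>1 * w \<Delta> i + \<beta>2 * w' \<Delta> i) * zs i powr (q + s - 1))))"
        unfolding zs0[symmetric] P_def W_def
        by (rule ennreal_leI, rule dstep[where X="norm (Y k)", OF \<Delta>(1,3) w0 w1[OF \<Delta>(1) N] zs(1)])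
          (use zs0 drift in \<open>auto simp: P_def W_def\<close>)
      finally show "(\<integral>\<^sup>+y. ennreal ((1 + (norm (Y k + \<Delta> *\<^sub>R f (interp \<Delta> N Y k) + g (interp \<Delta> N Y k) *v y))\<^sup>2) powr q) \<partial>gauss (sqrt \<Delta>))
        \<le> ennreal ((1 + (norm (Y k))\<^sup>2) powr q + \<Delta> * (C - \<alpha> * (1 + (norm (Y k))\<^sup>2) powr (q + s - 1)
            + (\<Sum>i\<le>N. (\<beta>1 * w \<Delta> i + \<beta>2 * w' \<Delta> i) * (1 + (norm (Y (k - int i)))\<^sup>2) powr (q + s - 1))))"
        unfolding \<phi>_def zs_def by simp
    qed
  qed
qed

lemma Cset_norm_bounded:
  assumes "\<xi> \<in> Cset \<tau>"
  obtains X0 where "X0 \<ge> 0" "\<And>t. norm (\<xi> t) \<le> X0"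
proof -
  have "bounded (\<xi> ` {-\<tau>..0})"
    using assms by (intro compact_imp_bounded compact_continuous_image) (auto simp: Cset_def)
  then obtain X where X: "\<And>t. t \<in> {-\<tau>..0} \<Longrightarrow> norm (\<xi> t) \<le> X" by (metis bounded_iff imageI)
  have "norm (\<xi> t) \<le> max 0 X" for t
    using X[of t] assms by (cases "t \<in> {-\<tau>..0}") (auto simp: Cset_def)
  then show ?thesis using that[of "max 0 X"] by auto
qed

theorem theorem3p1:
  fixes \<tau> :: real
    and f :: "(real \<Rightarrow> real^'n) \<Rightarrow> real^'n"
    and g :: "(real \<Rightarrow> real^'n) \<Rightarrow> real^'d^'n"
    and \<xi> :: "real \<Rightarrow> real^'n"
    and M :: "'a measure"
    and B :: "real \<Rightarrow> 'a \<Rightarrow> real^'d"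
    and p vrho a1 a2 a3 :: real
    and \<rho>1 :: "real \<Rightarrow> real"
    and \<Gamma> :: "real \<Rightarrow> real"
    and lam :: real
  assumes tau_pos: "\<tau> > 0"
    and BM: "brownian_motion M B"
    and xi: "\<xi> \<in> Cset \<tau>"
    and A1: "\<forall>ell>0. \<exists>R>0. \<forall>\<phi>\<in>Cset \<tau>. \<forall>\<phi>'\<in>Cset \<tau>.
              supnorm \<tau> \<phi> \<le> ell \<and> supnorm \<tau> \<phi>' \<le> ell \<longrightarrow>
              max (norm (f \<phi> - f \<phi>')) (norm (g \<phi> - g \<phi>'))
                \<le> R * (norm (\<phi> 0 - \<phi>' 0) + (1/\<tau>) * integral {-\<tau>..0} (\<lambda>\<theta>. norm (\<phi> \<theta> - \<phi>' \<theta>)))"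
    and p: "p \<ge> 2" and rho: "vrho > 0"
    and a1: "a1 > 0" and a2: "a2 > 0" and a3: "a3 > 0" and a23: "a2 > a3"
    and rho1: "\<rho>1 \<in> Wset \<tau>"
    and A2: "\<forall>\<phi>\<in>Cset \<tau>. 2 * (\<phi> 0 \<bullet> f \<phi>) + (p - 1) * (norm (g \<phi>))\<^sup>2
              \<le> a1 * (1 + (norm (\<phi> 0))\<^sup>2 + (1/\<tau>) * integral {-\<tau>..0} (\<lambda>\<theta>. (norm (\<phi> \<theta>))\<^sup>2))
                 - a2 * norm (\<phi> 0) powr (2 + vrho)
                 + a3 * integral {-\<tau>..0} (\<lambda>\<theta>. norm (\<phi> \<theta>) powr (2 + vrho) * \<rho>1 \<theta>)"
    and Gamma_mono: "strict_mono_on {1..} \<Gamma>"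
    and Gamma_cont: "continuous_on {1..} \<Gamma>"
    and Gamma_nonneg: "\<forall>l\<ge>1. \<Gamma> l \<ge> 0"
    and Gamma_lim: "filterlim \<Gamma> at_top at_top"
    and Gamma_bound: "\<forall>l\<ge>1. \<forall>\<phi>\<in>Cset \<tau>. \<forall>\<phi>'\<in>Cset \<tau>.
              supnorm \<tau> \<phi> \<le> l \<and> supnorm \<tau> \<phi>' \<le> l \<and> \<phi> \<noteq> \<phi>' \<longrightarrow>
              norm (f \<phi> - f \<phi>') / sqrt (Psi \<tau> \<phi> \<phi>') \<le> \<Gamma> l
              \<and> (norm (g \<phi> - g \<phi>'))\<^sup>2 / Psi \<tau> \<phi> \<phi>' \<le> \<Gamma> l"
    and lam: "0 < lam" "lam < 1/2"
  shows "\<exists>L>0. \<forall>N::nat. real N \<ge> \<tau> \<longrightarrow> (\<forall>k::int. k \<ge> - int N \<longrightarrow>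
           (\<integral>\<^sup>+ \<omega>. ennreal (norm (TEM_Y f g B \<xi> \<tau> \<Gamma> lam N k \<omega>) powr p) \<partial>M) \<le> ennreal L)"
proof -
  interpret prob_space M using BM by (simp add: brownian_motion_def)
  define q where "q = p / 2"
  define s where "s = 1 + vrho / 2"
  \<comment> \<open>Equal to (p + vrho) / 2, the order of the dissipation in powers of 1 +
    |Y|^2.\<close>
  define m where "m = q + s - 1"
  define K where "K = max (\<Gamma> 1) (max (norm (f (\<lambda>_. 0))) ((norm (g (\<lambda>_. 0)))\<^sup>2))"
  define hN where "hN N = Gamma_inv \<Gamma> (K * (\<tau> / real N) powr (-lam))" for N :: nat
  have q: "q \<ge> 1" "p = 2 * q" using p by (auto simp: q_def)
  have s: "s > 1" "2 + vrho = 2 * s" using rho by (auto simp: s_def)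
  have m: "m \<ge> q" "m \<ge> 0" using q s by (auto simp: m_def)
  have K: "\<Gamma> 1 \<le> K" "norm (f (\<lambda>_. 0)) \<le> K" "(norm (g (\<lambda>_. 0)))\<^sup>2 \<le> K" by (auto simp: K_def)
  have K0: "K \<ge> 0" using K(3) zero_le_power2[of "norm (g (\<lambda>_. 0))"] by linarith
  have lam': "lam \<le> 1/2" "lam \<ge> 0" using lam by auto
  have A2': "2 * (\<phi> 0 \<bullet> f \<phi>) + (2 * q - 1) * (norm (g \<phi>))\<^sup>2
              \<le> a1 * (1 + (norm (\<phi> 0))\<^sup>2 + (1/\<tau>) * integral {-\<tau>..0} (\<lambda>\<theta>. (norm (\<phi> \<theta>))\<^sup>2))
                 - a2 * norm (\<phi> 0) powr (2 * s)
                 + a3 * integral {-\<tau>..0} (\<lambda>\<theta>. norm (\<phi> \<theta>) powr (2 * s) * \<rho>1 \<theta>)" if "\<phi> \<in> Cset \<tau>" for \<phi>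
    using A2 that unfolding q(2) s(2) by blast
  show ?thesis
  proof (rule dissipative_scheme_step[OF tau_pos q(1) s(1) a1 a2 a3 a23 K0 lam' rho1 A2'])
    fix \<Delta>0 C \<alpha> \<beta> b
    assume D: "\<Delta>0 > 0" "C \<ge> 0" "\<beta> \<ge> 0" "\<beta> < \<alpha>"
      and b: "\<And>\<Delta> i. 0 \<le> b \<Delta> i" "\<And>\<Delta> N. 0 < \<Delta> \<Longrightarrow> 0 < N \<Longrightarrow> real N * \<Delta> = \<tau> \<Longrightarrow> (\<Sum>i\<le>N. b \<Delta> i) \<le> \<beta>"
      and step': "\<And>\<Delta> N h Y k. 0 < \<Delta> \<Longrightarrow> \<Delta> \<le> 1 \<Longrightarrow> \<Delta> \<le> \<Delta>0 \<Longrightarrow> 0 < N \<Longrightarrow> real N * \<Delta> = \<tau> \<Longrightarrow>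
        (\<And>\<phi> P. \<phi> \<in> Cset \<tau> \<Longrightarrow> supnorm \<tau> \<phi> \<le> h \<Longrightarrow> 1 + Psi \<tau> \<phi> (\<lambda>_. 0) \<le> P \<Longrightarrow>
          norm (f \<phi>) \<le> 2 * (K * \<Delta> powr (-lam)) * sqrt P \<and> (norm (g \<phi>))\<^sup>2 \<le> 2 * (K * \<Delta> powr (-lam)) * P) \<Longrightarrow>
        (\<And>j. norm (Y j) \<le> h) \<Longrightarrow>
        (\<integral>\<^sup>+y. ennreal ((1 + (norm (Y k + \<Delta> *\<^sub>R f (interp \<Delta> N Y k) + g (interp \<Delta> N Y k) *v y))\<^sup>2) powr q) \<partial>gauss (sqrt \<Delta>))
        \<le> ennreal ((1 + (norm (Y k))\<^sup>2) powr q + \<Delta> * (C - \<alpha> * (1 + (norm (Y k))\<^sup>2) powr (q + s - 1)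
            + (\<Sum>i\<le>N. b \<Delta> i * (1 + (norm (Y (k - int i)))\<^sup>2) powr (q + s - 1))))"
    note step = step'[folded m_def]
    obtain \<gamma> where \<gamma>: "\<gamma> > 0" "\<gamma> + \<beta> * exp (\<gamma> * \<tau>) \<le> \<alpha>" using exponential_gap[OF D(4)] by blast
    obtain X0 where X0: "X0 \<ge> 0" "\<And>t. norm (\<xi> t) \<le> X0" using Cset_norm_bounded[OF xi] by blast
    \<comment> \<open>Bounds the larger moments v, not just u, on the initial segment. It is
      independent of the truncation radius, as truncation does not increase the norm of the initial
      datum.\<close>
    define V0 where "V0 = (1 + X0\<^sup>2) powr m"
    define L1 where "L1 = V0 + \<beta> * exp (\<gamma> * \<tau>) * \<tau> * V0 + C * (1 + \<gamma>) / \<gamma>"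
    \<comment> \<open>All N whose step exceeds \<open>\<Delta>0\<close>. It may also contain N <
      \<tau>, including 0, for which \<open>hN N\<close> can be an unspecified value; this only adds
      nonnegative terms to L.\<close>
    define NN where "NN = {N. real N \<le> \<tau> / \<Delta>0}"
    define L where "L = L1 + (\<Sum>N\<in>NN. \<bar>hN N\<bar> powr p) + 1"
    have NN: "finite NN"
    proof -
      have "NN \<subseteq> {..nat \<lfloor>\<tau> / \<Delta>0\<rfloor>}" by (auto simp: NN_def le_nat_floor)
      then show ?thesis using finite_subset by blast
    qed
    have V0: "V0 \<ge> 0" by (simp add: V0_def)
    have L1: "V0 \<le> L1" "L1 \<ge> 0" using V0 D \<gamma> tau_pos by (auto simp: L1_def)
    have sum0: "(\<Sum>N\<in>NN. \<bar>hN N\<bar> powr p) \<ge> 0" by (intro sum_nonneg) auto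
    have Lpos: "L > 0" using L1 sum0 by (simp add: L_def)
    show ?thesis
    proof (intro exI[of _ L] conjI allI impI Lpos)
      fix N :: nat and k :: int
      assume N: "real N \<ge> \<tau>" and k: "k \<ge> - int N"
      define \<Delta> where "\<Delta> = \<tau> / real N"
      define h where "h = hN N"
      have N0: "N > 0" using N tau_pos by (cases N) auto
      have \<Delta>: "\<Delta> > 0" "\<Delta> \<le> 1" "real N * \<Delta> = \<tau>" using N N0 tau_pos by (auto simp: \<Delta>_def)
      have mu: "\<Delta> powr (-lam) \<ge> 1" using \<Delta> lam powr_mono'[of "-lam" 0 \<Delta>] by simp
      have KK: "K \<le> K * \<Delta> powr (-lam)" using mult_left_mono[OF mu K0] by simp
      have h: "1 \<le> h" "\<Gamma> h = K * \<Delta> powr (-lam)"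
        unfolding h_def hN_def \<Delta>_def[symmetric]
        using Gamma_inv_properties[OF Gamma_mono Gamma_cont Gamma_lim, of "K * \<Delta> powr (-lam)"] K KK by auto
      define X where "X j \<omega> = 1 + (norm (trunc h (breve_seq f g B \<xi> \<Delta> N h \<omega> (nat j) j)))\<^sup>2" for j \<omega>
      have Y: "TEM_Y f g B \<xi> \<tau> \<Gamma> lam N k \<omega> = trunc h (breve_seq f g B \<xi> \<Delta> N h \<omega> (nat k) k)" for \<omega>
        by (simp add: TEM_Y_def Let_def h_def hN_def K_def \<Delta>_def)
      show "(\<integral>\<^sup>+ \<omega>. ennreal (norm (TEM_Y f g B \<xi> \<tau> \<Gamma> lam N k \<omega>) powr p) \<partial>M) \<le> ennreal L"
      proof (cases "\<Delta> \<le> \<Delta>0")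
        case False
        then have "\<tau> / real N > \<Delta>0" by (simp add: \<Delta>_def)
        then have "N \<in> NN" using D N0 by (simp add: NN_def field_simps)
        then have hL: "h powr p \<le> L"
          using member_le_sum[of N NN "\<lambda>N. \<bar>hN N\<bar> powr p"] NN L1 h by (simp add: L_def h_def)
        have "(\<integral>\<^sup>+ \<omega>. ennreal (norm (TEM_Y f g B \<xi> \<tau> \<Gamma> lam N k \<omega>) powr p) \<partial>M) \<le> (\<integral>\<^sup>+ \<omega>. ennreal L \<partial>M)"
        proof (intro nn_integral_mono ennreal_leI)
          fix \<omega>
          have "norm (TEM_Y f g B \<xi> \<tau> \<Gamma> lam N k \<omega>) powr p \<le> h powr p"
            unfolding Y using h p by (intro powr_mono2) (auto simp: norm_trunc)
          then show "norm (TEM_Y f g B \<xi> \<tau> \<Gamma> lam N k \<omega>) powr p \<le> L" using hL by linarith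
        qed
        then show ?thesis by (simp add: emeasure_space_1)
      next
        case True
        have lipf: "delay_lipschitz_on \<tau> h f" and lipg: "delay_lipschitz_on \<tau> h g"
          by (rule delay_lipschitz_onI; use A1 h in \<open>auto; meson max.bounded_iff\<close>)+
        have growth: "norm (f \<phi>) \<le> 2 * (K * \<Delta> powr (-lam)) * sqrt P \<and> (norm (g \<phi>))\<^sup>2 \<le> 2 * (K * \<Delta> powr (-lam)) * P"
          if "\<phi> \<in> Cset \<tau>" "supnorm \<tau> \<phi> \<le> h" "1 + Psi \<tau> \<phi> (\<lambda>_. 0) \<le> P" for \<phi> P
          using truncated_growth[OF tau_pos h(1) Gamma_bound _ _ _ that, of "K * \<Delta> powr (-lam)"] h(2) K KK by auto
        have h0: "h > 0" using h by linarith
        note rec = moment_recursion[OF BM lipf lipg h0 \<Delta>(1) N0 \<Delta>(3) _ m(2)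
            step[OF \<Delta>(1,2) True N0 \<Delta>(3) growth], where \<xi>=\<xi>, folded X_def]
        have Xm[measurable]: "X j \<in> borel_measurable M" for j using rec(1) q by auto
        have nt: "norm (trunc h x) \<le> h" "norm (trunc h x) \<le> norm x" for x :: "real^'n" using h0 by (simp_all add: norm_trunc)
        have X1: "1 \<le> X j \<omega>" and Xh: "X j \<omega> \<le> 1 + h\<^sup>2" for j \<omega> using nt by (auto simp: X_def intro!: power_mono)
        have int: "integrable M (\<lambda>\<omega>. X j \<omega> powr r)" if "r \<ge> 0" for j r
        proof (rule integrable_const_bound[where B="(1 + h\<^sup>2) powr r"])
          have "X j \<omega> powr r \<le> (1 + h\<^sup>2) powr r" for \<omega>
            using X1[of j \<omega>] Xh[of j \<omega>] that by (intro powr_mono2) auto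
          then show "AE \<omega> in M. norm (X j \<omega> powr r) \<le> (1 + h\<^sup>2) powr r" by simp
        qed measurable
        define u where "u j = (\<integral>\<omega>. X j \<omega> powr q \<partial>M)" for j
        define v where "v j = (\<integral>\<omega>. X j \<omega> powr m \<partial>M)" for j
        have u0: "0 \<le> u j" for j by (simp add: u_def)
        have uv: "u j \<le> v j" for j unfolding u_def v_def
          using int q m X1 by (intro integral_mono powr_mono) auto
        have init: "v j \<le> V0" if "j \<le> 0" for j
        proof -
          have "X j \<omega> powr m \<le> V0" for \<omega>
          proof -
            have "X j \<omega> \<le> 1 + X0\<^sup>2" unfolding X_def
              using that order_trans[OF nt(2) X0(2)] by (intro add_left_mono power_mono) auto
            then show ?thesis unfolding V0_def using X1[of j \<omega>] m by (intro powr_mono2) auto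
          qed
          then have "v j \<le> (\<integral>\<omega>. V0 \<partial>M)" unfolding v_def
            using int m by (intro integral_mono) auto
          then show ?thesis by (simp add: prob_space)
        qed
        have bound: "u (int n) \<le> V0 + \<beta> * exp (\<gamma> * \<tau>) * \<tau> * V0 + C * (1 + \<gamma> * \<Delta>) / \<gamma>" for n
        proof (rule delayed_recursion_bound[where v=v and b="b \<Delta>" and N=N and \<alpha>=\<alpha>])
          show "u 0 \<le> V0" using uv[of 0] init[of 0] by simp
          show "u (int (Suc k)) \<le> u (int k) + \<Delta> * (C - \<alpha> * v (int k) + (\<Sum>i\<le>N. b \<Delta> i * v (int k - int i)))" for k
            unfolding u_def v_def by (rule rec(2)) (use q in auto)
        qed (use \<Delta> N0 D \<gamma> b u0 uv init in auto)
        have uL: "u k \<le> L1"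
        proof (cases "k \<ge> 0")
          case True
          \<comment> \<open>Using \<Delta> <= 1 removes the last trace of the step size from the
            bound.\<close>
          have "\<gamma> * \<Delta> \<le> \<gamma> * 1" using \<Delta> \<gamma> by (intro mult_left_mono) auto
          then have "C * (1 + \<gamma> * \<Delta>) / \<gamma> \<le> C * (1 + \<gamma>) / \<gamma>"
            using D \<gamma> by (intro divide_right_mono mult_left_mono) auto
          then show ?thesis using bound[of "nat k"] True by (simp add: L1_def)
        next
          case False
          then show ?thesis using uv[of k] init[of k] L1 by simp
        qed
        have "(\<integral>\<^sup>+ \<omega>. ennreal (norm (TEM_Y f g B \<xi> \<tau> \<Gamma> lam N k \<omega>) powr p) \<partial>M) \<le> (\<integral>\<^sup>+ \<omega>. ennreal (X k \<omega> powr q) \<partial>M)"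
        proof (intro nn_integral_mono ennreal_leI)
          fix \<omega>
          have "norm (TEM_Y f g B \<xi> \<tau> \<Gamma> lam N k \<omega>) powr p = ((norm (TEM_Y f g B \<xi> \<tau> \<Gamma> lam N k \<omega>))\<^sup>2) powr q"
            unfolding q(2) by (simp add: powr_powr[symmetric])
          also have "\<dots> \<le> X k \<omega> powr q" unfolding Y X_def using q by (intro powr_mono2) auto
          finally show "norm (TEM_Y f g B \<xi> \<tau> \<Gamma> lam N k \<omega>) powr p \<le> X k \<omega> powr q" .
        qed
        also have "\<dots> = ennreal (u k)" unfolding u_def using int q by (intro nn_integral_eq_integral) auto
        also have "\<dots> \<le> ennreal L" using uL sum0 by (intro ennreal_leI) (simp add: L_def)
        finally show ?thesis .
      qed
    qed
  qed
qed

end
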